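(* Let $h\ge 1$, $i\ge 1$ and $1<k<n$ be integers such that $\mathcal{F}_h^i(k,n)$ is non-empty. Then the fundamental group of the $i$-th unordered configuration space $\mathcal{F}_h^i(k,n)/\Sigma_h$ is isomorphic to the symmetric group $\Sigma_h$.
   Context: For $0<k<n$, $Gr(k,n)$ denotes the Grassmannian manifold of $k$-dimensional complex linear subspaces of $\mathbb{C}^n$. For $h\ge 1$, $\mathcal{F}_h^i(k,n)$ is the space of all ordered $h$-tuples $(H_1,\ldots,H_h)$ of pairwise distinct points of $Gr(k,n)$ such that $\dim(H_1+\cdots+H_h)=i$, topologized as a subspace of $Gr(k,n)^h$. The symmetric group $\Sigma_h$ on $h$ elements acts on $\mathcal{F}_h^i(k,n)$ by permuting the entries, and $\mathcal{F}_h^i(k,n)/\Sigma_h$ is the quotient space. *)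

theory Defs
  imports
    "HOL-Analysis.Analysis"
    "HOL-Algebra.Sym_Groups"
    "HOL-Library.Set_Algebras"
begin

section \<open>Quotient topology\<close>

definition quotient_topology :: "'a topology \<Rightarrow> ('a \<Rightarrow> 'b) \<Rightarrow> 'b topology" where
  "quotient_topology X f =
     topology (\<lambda>U. U \<subseteq> f ` topspace X \<and> openin X {x \<in> topspace X. f x \<in> U})"

lemma openin_quotient_topology:
  "openin (quotient_topology X f) U \<longleftrightarrow>
     U \<subseteq> f ` topspace X \<and> openin X {x \<in> topspace X. f x \<in> U}"
proof -
  let ?P = "\<lambda>U. U \<subseteq> f ` topspace X \<and> openin X {x \<in> topspace X. f x \<in> U}"
  have "istopology ?P"
    unfolding istopology_def
  proof (intro conjI allI impI)
    fix S T assume S: "?P S" and T: "?P T"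
    then show "S \<inter> T \<subseteq> f ` topspace X" by blast
    have "{x \<in> topspace X. f x \<in> S \<inter> T}
        = {x \<in> topspace X. f x \<in> S} \<inter> {x \<in> topspace X. f x \<in> T}"
      by blast
    then show "openin X {x \<in> topspace X. f x \<in> S \<inter> T}"
      using S T by (simp add: openin_Int)
  next
    fix K assume K: "\<forall>S\<in>K. ?P S"
    then show "\<Union>K \<subseteq> f ` topspace X" by blast
    have "{x \<in> topspace X. f x \<in> \<Union>K} = (\<Union>S\<in>K. {x \<in> topspace X. f x \<in> S})"
      by blast
    then show "openin X {x \<in> topspace X. f x \<in> \<Union>K}"
      using K by (metis (no_types, lifting) imageE openin_Union)
  qed
  then show ?thesis
    by (simp add: quotient_topology_def)
qed

lemma topspace_quotient_topology: "topspace (quotient_topology X f) = f ` topspace X"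
proof -
  have "{x \<in> topspace X. f x \<in> f ` topspace X} = topspace X"
    by blast
  then have "openin (quotient_topology X f) (f ` topspace X)"
    by (simp add: openin_quotient_topology)
  then show ?thesis
    by (metis openin_quotient_topology openin_subset openin_topspace subset_antisym)
qed

lemma quotient_map_quotient_topology: "quotient_map X (quotient_topology X f) f"
  unfolding quotient_map_def
  by (auto simp: topspace_quotient_topology openin_quotient_topology)


section \<open>Fundamental group of an abstract topological space\<close>

definition loop_at :: "'a topology \<Rightarrow> 'a \<Rightarrow> (real \<Rightarrow> 'a) \<Rightarrow> bool" where
  "loop_at X x p \<longleftrightarrow> pathin X p \<and> p 0 = x \<and> p 1 = x"

definition loop_join :: "(real \<Rightarrow> 'a) \<Rightarrow> (real \<Rightarrow> 'a) \<Rightarrow> real \<Rightarrow> 'a" where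
  "loop_join p q = (\<lambda>t. if t \<le> 1/2 then p (2 * t) else q (2 * t - 1))"

definition loop_class :: "'a topology \<Rightarrow> 'a \<Rightarrow> (real \<Rightarrow> 'a) \<Rightarrow> (real \<Rightarrow> 'a) set" where
  "loop_class X x p =
     {q. homotopic_with (\<lambda>g. g 0 = x \<and> g 1 = x) (top_of_set {0..1}) X p q}"

definition fundamental_group :: "'a topology \<Rightarrow> 'a \<Rightarrow> (real \<Rightarrow> 'a) set monoid" where
  "fundamental_group X x =
     \<lparr> carrier = {loop_class X x p | p. loop_at X x p},
       mult = (\<lambda>A B. \<Union>p\<in>A. \<Union>q\<in>B. loop_class X x (loop_join p q)),
       one = loop_class X x (\<lambda>t. x) \<rparr>"


section \<open>Grassmannians\<close>

text \<open>The locale prefix \<open>vec\<close> refers to scalar multiplication by complex numbers, so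
  \<open>vec.subspace\<close>, \<open>vec.dim\<close> and \<open>vec.span\<close> are complex-linear, unlike the real notions
  \<open>subspace\<close>, \<open>dim\<close> and \<open>span\<close>.\<close>

definition grassmannian :: "nat \<Rightarrow> (complex^'n) set set" where
  "grassmannian k = {V. vec.subspace V \<and> vec.dim V = k}"

text \<open>The (non-compact) Stiefel space of linearly independent \<open>k\<close>-tuples in \<open>\<complex>\<^sup>n\<close>; the
  Grassmannian carries the quotient topology under sending a tuple to its span.\<close>

definition frames :: "nat \<Rightarrow> (nat \<Rightarrow> complex^'n) set" where
  "frames k = {v \<in> extensional {..<k}. inj_on v {..<k} \<and> vec.independent (v ` {..<k})}"

definition grassmannian_topology :: "nat \<Rightarrow> (complex^'n) set topology" where
  "grassmannian_topology k =
     quotient_topology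
       (subtopology (product_topology (\<lambda>_. euclidean) {..<k}) (frames k))
       (\<lambda>v. vec.span (v ` {..<k}))"

lemma topspace_grassmannian_topology:
  "topspace (grassmannian_topology k :: (complex^'n) set topology) = grassmannian k"
proof -
  have top: "topspace (subtopology (product_topology (\<lambda>_. euclidean) {..<k}) (frames k))
      = (frames k :: (nat \<Rightarrow> complex^'n) set)"
    by (auto simp: frames_def PiE_def)
  have "(\<lambda>v. vec.span (v ` {..<k})) ` frames k = (grassmannian k :: (complex^'n) set set)"
  proof (intro equalityI subsetI)
    fix V :: "(complex^'n) set"
    assume "V \<in> (\<lambda>v. vec.span (v ` {..<k})) ` frames k"
    then show "V \<in> grassmannian k"
      by (auto simp: grassmannian_def frames_def vec.dim_eq_card_independent card_image)
  next
    fix V :: "(complex^'n) set"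
    assume "V \<in> grassmannian k"
    then have V: "vec.subspace V" "vec.dim V = k"
      by (auto simp: grassmannian_def)
    obtain B where B: "B \<subseteq> V" "vec.independent B" "V \<subseteq> vec.span B" "card B = vec.dim V"
      using vec.basis_exists by blast
    have "finite B"
      using B(2) vec.independent_bound_general by blast
    then obtain f where f: "bij_betw f {..<k} B"
      using B(4) V(2) by (metis bij_betw_from_nat_into_finite)
    define v where "v = restrict f {..<k}"
    have v: "v ` {..<k} = B" "inj_on v {..<k}"
      using f by (auto simp: v_def bij_betw_def inj_on_def)
    have "v \<in> frames k"
      using v B(2) by (simp add: frames_def v_def)
    moreover have "V = vec.span (v ` {..<k})"
      using B V(1) v(1) vec.span_minimal by blast
    ultimately show "V \<in> (\<lambda>v. vec.span (v ` {..<k})) ` frames k"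
      by blast
  qed
  then show ?thesis
    by (simp only: grassmannian_topology_def topspace_quotient_topology top)
qed


section \<open>Configuration spaces\<close>

text \<open>An \<open>h\<close>-tuple is an extensional function on \<open>{1..h}\<close>. The sum below is the sum of sets of
  \<open>Set_Algebras\<close>, i.e. the subspace \<open>H\<^sub>1 + \<dots> + H\<^sub>h\<close> of all sums of vectors from the \<open>H\<^sub>j\<close>.\<close>

definition ordered_conf :: "nat \<Rightarrow> nat \<Rightarrow> nat \<Rightarrow> (nat \<Rightarrow> (complex^'n) set) set" where
  "ordered_conf h i k =
     {H \<in> {1..h} \<rightarrow>\<^sub>E grassmannian k. inj_on H {1..h} \<and> vec.dim (\<Sum>j\<in>{1..h}. H j) = i}"

definition ordered_conf_topology ::
    "nat \<Rightarrow> nat \<Rightarrow> nat \<Rightarrow> (nat \<Rightarrow> (complex^'n) set) topology" where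
  "ordered_conf_topology h i k =
     subtopology (product_topology (\<lambda>_. grassmannian_topology k) {1..h}) (ordered_conf h i k)"

definition perm_orbit :: "nat \<Rightarrow> (nat \<Rightarrow> 'a) \<Rightarrow> (nat \<Rightarrow> 'a) set" where
  "perm_orbit h H = {H \<circ> \<sigma> | \<sigma>. \<sigma> permutes {1..h}}"

definition unordered_conf_topology ::
    "nat \<Rightarrow> nat \<Rightarrow> nat \<Rightarrow> (nat \<Rightarrow> (complex^'n) set) set topology" where
  "unordered_conf_topology h i k =
     quotient_topology (ordered_conf_topology h i k) (perm_orbit h)"

end

(*
Idea.  The symmetric group acts freely on the Hausdorff space F = F_h^i(k,n), so it suffices that
F is simply connected.  F is covered by charts, one for every choice of linear coordinates on C^n,
in which all H_j have a normalised frame with identity upper block; "generic" conditions along a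
complex line fail only for finitely many parameters, so any two charts meet in a path-connected set
and any two points lie in a common chart.  Hence (the easy half of van Kampen) it is enough to
contract in F the loops of one chart.

If hk = i, the H_j are in direct sum and a chart is a big cell: H_j is first moved inside
H_1 + ... + H_j, keeping it complementary to H_1 + ... + H_(j-1), and then to a coordinate subspace.

If hk > i, killing the coordinates beyond the i-th turns the loop into one of i x hk matrices of rank
i whose first k rows are fixed and whose blocks have distinct column spans.  Since there are more
columns than rows (and 2k >= k + 2 when two blocks are compared), the remaining rows can be replaced
one after the other by generic constant ones through straight-line homotopies; the loops for which a
given choice of constant rows works form again a chart of a cover of the above kind.
*)

theory Submission
  imports Defs "HOL-Computational_Algebra.Polynomial"
begin

section \<open>Independence of rows of a matrix\<close>

text \<open>Every requirement on a configuration (frames in general position, distinctness, the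
  dimension of the sum) is phrased as surjectivity of the first \<open>q\<close> coordinates, that
  is, by \<open>indep_rows\<close>. Distinctness fits because two different k-dimensional subspaces
  have a sum of dimension at least k + 1. Such conditions are open, and a finite set of bad
  parameters does not separate the complex plane. A row can be moved along a segment to a new one
  without losing independence if the old row, the new row and all other rows are independent
  together. This takes one more column than there are rows, which is available for hk > i but not
  for hk = i; hence the two cases. For a pair of blocks, rows 0, ..., k with row k in both versions
  make k + 2. Null-homotopies are free ones, since the contractions move the base point;
  \<open>path_hom_of_null_loop\<close> turns them into homotopies with fixed ends. Linear algebra is
  done by fraction-free elimination instead of determinants, which allows infinitely many columns
  and keeps polynomial entries polynomial.\<close>

text \<open>The set \<open>J\<close> of columns may be infinite. For vectors as columns and \<open>M r x\<close> the \<open>r\<close>-th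
  coordinate of \<open>x\<close>, the predicate says that the coordinates in \<open>R\<close> map the span of \<open>J\<close> onto
  \<open>\<complex>\<^sup>R\<close>.\<close>

definition indep_rows :: "'r set \<Rightarrow> 'c set \<Rightarrow> ('r \<Rightarrow> 'c \<Rightarrow> complex) \<Rightarrow> bool" where
  "indep_rows R J M \<longleftrightarrow>
     (\<forall>w. (\<forall>c\<in>J. (\<Sum>r\<in>R. w r * M r c) = 0) \<longrightarrow> (\<forall>r\<in>R. w r = 0))"

lemma indep_rowsD:
  "indep_rows R J M \<Longrightarrow> (\<And>c. c \<in> J \<Longrightarrow> (\<Sum>r\<in>R. w r * M r c) = 0) \<Longrightarrow> r \<in> R \<Longrightarrow> w r = 0"
  by (auto simp: indep_rows_def)

lemma indep_rows_cong:
  assumes "\<And>r c. r \<in> R \<Longrightarrow> c \<in> J \<Longrightarrow> M r c = N r c"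
  shows "indep_rows R J M = indep_rows R J N"
proof -
  have "(\<Sum>r\<in>R. w r * M r c) = (\<Sum>r\<in>R. w r * N r c)" if "c \<in> J" for w c
    using assms that by (intro sum.cong) auto
  then show ?thesis by (simp add: indep_rows_def)
qed

lemma indep_rows_mono_cols: "indep_rows R J M \<Longrightarrow> J \<subseteq> J' \<Longrightarrow> indep_rows R J' M"
  by (auto simp: indep_rows_def)

lemma indep_rows_subset_rows:
  assumes "indep_rows R J M" "R' \<subseteq> R" "finite R"
  shows "indep_rows R' J M"
  unfolding indep_rows_def
proof (intro allI impI ballI)
  fix w r assume w: "\<forall>c\<in>J. (\<Sum>r\<in>R'. w r * M r c) = 0" and r: "r \<in> R'"
  have "(\<Sum>r\<in>R. (if r \<in> R' then w r else 0) * M r c) = (\<Sum>r\<in>R'. w r * M r c)" for c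
    using assms by (intro sum.mono_neutral_cong_right) auto
  then have "(if r \<in> R' then w r else 0) = 0"
    using assms w r by (intro indep_rowsD[OF assms(1), where w = "\<lambda>r. if r \<in> R' then w r else 0"]) auto
  then show "w r = 0" using r by simp
qed

text \<open>One step of Gaussian elimination with pivot \<open>M q c\<close>, without division, so
  that polynomial, convergent or continuous entries stay so.\<close>

definition pivot_step :: "('r \<Rightarrow> 'c \<Rightarrow> complex) \<Rightarrow> 'r \<Rightarrow> 'c \<Rightarrow> 'r \<Rightarrow> 'c \<Rightarrow> complex" where
  "pivot_step M q c = (\<lambda>r d. M q c * M r d - M r c * M q d)"

lemma sum_rows_pivot_step:
  "(\<Sum>r\<in>R. v r * pivot_step N q c r d)
     = N q c * (\<Sum>r\<in>R. v r * N r d) - (\<Sum>r\<in>R. v r * N r c) * N q d"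
proof -
  have "(\<Sum>r\<in>R. v r * pivot_step N q c r d)
      = (\<Sum>r\<in>R. N q c * (v r * N r d)) - (\<Sum>r\<in>R. v r * N r c * N q d)"
    unfolding sum_subtractf[symmetric] by (intro sum.cong) (auto simp: pivot_step_def algebra_simps)
  then show ?thesis by (simp only: sum_distrib_left sum_distrib_right)
qed

lemma sum_cols_pivot_step:
  "(\<Sum>d\<in>J. v d * pivot_step N q c r d)
     = N q c * (\<Sum>d\<in>J. v d * N r d) - N r c * (\<Sum>d\<in>J. v d * N q d)"
proof -
  have "(\<Sum>d\<in>J. v d * pivot_step N q c r d)
      = (\<Sum>d\<in>J. N q c * (v d * N r d)) - (\<Sum>d\<in>J. N r c * (v d * N q d))"
    unfolding sum_subtractf[symmetric] by (intro sum.cong) (auto simp: pivot_step_def algebra_simps)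
  then show ?thesis by (simp only: sum_distrib_left)
qed

text \<open>If row \<open>q\<close> vanished on \<open>J\<close>, the unit vector at
  \<open>q\<close> would be a nontrivial relation.\<close>

lemma pivot_exists:
  assumes "indep_rows (insert q R) J M" "q \<notin> R" "finite R"
  shows "\<exists>c\<in>J. M q c \<noteq> 0"
proof (rule ccontr)
  assume "\<not> ?thesis"
  then have z: "M q c = 0" if "c \<in> J" for c using that by auto
  have "(\<Sum>r\<in>insert q R. (if r = q then 1 else 0) * M r c) = 0" if "c \<in> J" for c
    using z[OF that] assms by (simp add: sum.insert) (intro sum.neutral, auto)
  then have "(if q = q then 1 else 0::complex) = 0"
    by (intro indep_rowsD[OF assms(1), where w = "\<lambda>r. if r = q then 1 else 0"]) auto
  then show False by simp
qed

text \<open>The induction step of all that follows: one row is traded for an elimination, for an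
  arbitrary set of columns.\<close>

lemma indep_rows_pivot:
  assumes "q \<notin> R" "finite R" "c \<in> J" "M q c \<noteq> 0"
  shows "indep_rows (insert q R) J M \<longleftrightarrow> indep_rows R J (pivot_step M q c)"
proof
  assume L: "indep_rows (insert q R) J M"
  show "indep_rows R J (pivot_step M q c)"
    unfolding indep_rows_def
  proof (intro allI impI ballI)
    fix w r assume w: "\<forall>d\<in>J. (\<Sum>r\<in>R. w r * pivot_step M q c r d) = 0" and r: "r \<in> R"
    \<comment> \<open>The coefficient of row \<open>q\<close> is forced: it has to cancel the
      contribution of the rows in \<open>R\<close> to column \<open>c\<close>.\<close>
    define v where "v r = (if r = q then - (\<Sum>r\<in>R. w r * M r c) else w r * M q c)" for r
    have "(\<Sum>r\<in>insert q R. v r * M r d) = 0" if "d \<in> J" for d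
    proof -
      have "(\<Sum>r\<in>insert q R. v r * M r d) = v q * M q d + (\<Sum>r\<in>R. M q c * (w r * M r d))"
        using assms by (subst sum.insert) (auto simp: v_def intro!: sum.cong)
      also have "\<dots> = (\<Sum>r\<in>R. w r * pivot_step M q c r d)"
        unfolding sum_rows_pivot_step by (simp add: v_def flip: sum_distrib_left)
      finally show ?thesis using w that by simp
    qed
    from indep_rowsD[OF L this, of r] have "v r = 0" using r by auto
    moreover have "r \<noteq> q" using assms r by blast
    ultimately show "w r = 0" using assms by (simp add: v_def)
  qed
next
  assume L: "indep_rows R J (pivot_step M q c)"
  show "indep_rows (insert q R) J M"
    unfolding indep_rows_def
  proof (intro allI impI)
    fix w assume w: "\<forall>d\<in>J. (\<Sum>r\<in>insert q R. w r * M r d) = 0"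
    have s: "(\<Sum>r\<in>R. w r * M r d) = - w q * M q d" if "d \<in> J" for d
      using bspec[OF w that] assms by (simp add: add_eq_0_iff)
    have "(\<Sum>r\<in>R. w r * pivot_step M q c r d) = 0" if "d \<in> J" for d
      unfolding sum_rows_pivot_step using s[OF that] s[OF assms(3)] by simp
    then have R: "w r = 0" if "r \<in> R" for r using indep_rowsD[OF L] that by blast
    then have "w q * M q c = 0" using s[OF assms(3)] by simp
    then show "\<forall>r\<in>insert q R. w r = 0" using R assms by auto
  qed
qed

section \<open>Genericity and continuity: independence as a function of parameters\<close>

definition is_polyfun :: "(complex \<Rightarrow> complex) \<Rightarrow> bool" where
  "is_polyfun f \<longleftrightarrow> (\<exists>p. \<forall>t. f t = poly p t)"

lemma is_polyfun_intros [simp, intro]: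
  "is_polyfun (\<lambda>t. c)" "is_polyfun (\<lambda>t. t)"
  "is_polyfun f \<Longrightarrow> is_polyfun g \<Longrightarrow> is_polyfun (\<lambda>t. f t + g t)"
  "is_polyfun f \<Longrightarrow> is_polyfun g \<Longrightarrow> is_polyfun (\<lambda>t. f t - g t)"
  "is_polyfun f \<Longrightarrow> is_polyfun g \<Longrightarrow> is_polyfun (\<lambda>t. f t * g t)"
proof -
  show "is_polyfun (\<lambda>t. c)" unfolding is_polyfun_def by (rule exI[of _ "[:c:]"]) simp
  show "is_polyfun (\<lambda>t. t)" unfolding is_polyfun_def by (rule exI[of _ "[:0,1:]"]) simp
  assume "is_polyfun f" "is_polyfun g"
  then obtain p q where pq: "\<And>t. f t = poly p t" "\<And>t. g t = poly q t"
    by (auto simp: is_polyfun_def)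
  show "is_polyfun (\<lambda>t. f t + g t)" unfolding is_polyfun_def by (rule exI[of _ "p+q"]) (simp add: pq)
  show "is_polyfun (\<lambda>t. f t - g t)" unfolding is_polyfun_def by (rule exI[of _ "p-q"]) (simp add: pq)
  show "is_polyfun (\<lambda>t. f t * g t)" unfolding is_polyfun_def by (rule exI[of _ "p*q"]) (simp add: pq)
qed

lemma is_polyfun_sum [intro]:
  "(\<And>i. i \<in> A \<Longrightarrow> is_polyfun (f i)) \<Longrightarrow> is_polyfun (\<lambda>t. \<Sum>i\<in>A. f i t)"
  by (induction A rule: infinite_finite_induct) auto

text \<open>A pivot that is nonzero at \<open>a\<close> is a nonzero polynomial in the parameter, so
  it has finitely many zeros; away from them the elimination step is an equivalence, and the
  eliminated entries are polynomial again.\<close>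

lemma indep_rows_polyfun:
  assumes "finite R" "indep_rows R J (M a)" "\<And>r c. r \<in> R \<Longrightarrow> c \<in> J \<Longrightarrow> is_polyfun (\<lambda>t. M t r c)"
  shows "finite {t. \<not> indep_rows R J (M t)}"
  using assms
proof (induction R arbitrary: M rule: finite_induct)
  case empty
  then show ?case by (simp add: indep_rows_def)
next
  case (insert q R)
  obtain c where c: "c \<in> J" "M a q c \<noteq> 0" using pivot_exists[OF insert.prems(1)] insert.hyps by auto
  have fin: "finite {t. \<not> indep_rows R J (pivot_step (M t) q c)}"
  proof (rule insert.IH)
    show "indep_rows R J (pivot_step (M a) q c)"
      using indep_rows_pivot[of q R c J] insert.hyps insert.prems(1) c by blast
    show "is_polyfun (\<lambda>t. pivot_step (M t) q c r d)" if "r \<in> R" "d \<in> J" for r d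
      using insert.prems(2) c that unfolding pivot_step_def by auto
  qed
  obtain p where p: "\<And>t. M t q c = poly p t"
    using insert.prems(2)[of q c] c by (auto simp: is_polyfun_def)
  have "p \<noteq> 0" using c p[of a] by auto
  then have "finite {t. M t q c = 0}" using poly_roots_finite p by auto
  moreover have "{t. \<not> indep_rows (insert q R) J (M t)}
      \<subseteq> {t. M t q c = 0} \<union> {t. \<not> indep_rows R J (pivot_step (M t) q c)}"
    using indep_rows_pivot[of q R c J] insert.hyps c(1) by blast
  ultimately show ?case using fin by (meson finite_UnI finite_subset)
qed

text \<open>A pivot of the limit matrix stays nonzero nearby, and elimination preserves the
  convergence of the entries.\<close>

lemma indep_rows_eventually:
  assumes "finite R" "indep_rows R J M0"
    "\<And>r c. r \<in> R \<Longrightarrow> c \<in> J \<Longrightarrow> ((\<lambda>x. M x r c) \<longlongrightarrow> M0 r c) F"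
  shows "eventually (\<lambda>x. indep_rows R J (M x)) F"
  using assms
proof (induction R arbitrary: M M0 rule: finite_induct)
  case empty
  then show ?case by (simp add: indep_rows_def)
next
  case (insert q R)
  obtain c where c: "c \<in> J" "M0 q c \<noteq> 0" using pivot_exists[OF insert.prems(1)] insert.hyps by auto
  have "eventually (\<lambda>x. indep_rows R J (pivot_step (M x) q c)) F"
  proof (rule insert.IH)
    show "indep_rows R J (pivot_step M0 q c)"
      using indep_rows_pivot[of q R c J] insert.hyps insert.prems(1) c by blast
    show "((\<lambda>x. pivot_step (M x) q c r d) \<longlongrightarrow> pivot_step M0 q c r d) F" if "r \<in> R" "d \<in> J" for r d
      using insert.prems(2) c that unfolding pivot_step_def by (auto intro!: tendsto_intros)
  qed
  moreover have "eventually (\<lambda>x. M x q c \<noteq> 0) F"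
    using insert.prems(2)[of q c] c by (auto intro: tendsto_imp_eventually_ne)
  ultimately show ?case
    by eventually_elim (use indep_rows_pivot[of q R c J] insert.hyps c(1) in blast)
qed

text \<open>Continuous dependence of the solution of a linear system, for any function
  \<open>w\<close> that solves it. The unknowns indexed by \<open>R\<close> also solve the
  eliminated system; the last one is recovered by dividing by the pivot.\<close>

lemma indep_rows_solution_tendsto:
  assumes "finite R" "indep_rows R J M0"
    "\<And>r c. r \<in> R \<Longrightarrow> c \<in> J \<Longrightarrow> ((\<lambda>x. M x r c) \<longlongrightarrow> M0 r c) F"
    "\<And>c. c \<in> J \<Longrightarrow> ((\<lambda>x. b x c) \<longlongrightarrow> b0 c) F"
    "\<And>c. c \<in> J \<Longrightarrow> eventually (\<lambda>x. (\<Sum>r\<in>R. w x r * M x r c) = b x c) F"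
    "\<And>c. c \<in> J \<Longrightarrow> (\<Sum>r\<in>R. w0 r * M0 r c) = b0 c" "r \<in> R"
  shows "((\<lambda>x. w x r) \<longlongrightarrow> w0 r) F"
  using assms
proof (induction R arbitrary: M M0 b b0 r rule: finite_induct)
  case (insert q R)
  obtain c where c: "c \<in> J" "M0 q c \<noteq> 0" using pivot_exists[OF insert.prems(1)] insert.hyps by auto
  have *: "(\<Sum>r\<in>R. v r * pivot_step N q c r d) = N q c * e d - e c * N q d"
    if "(\<Sum>r\<in>insert q R. v r * N r d) = e d" "(\<Sum>r\<in>insert q R. v r * N r c) = e c" for v N e d
  proof -
    have "(\<Sum>r\<in>R. v r * N r d) = e d - v q * N q d" "(\<Sum>r\<in>R. v r * N r c) = e c - v q * N q c"
      using that insert.hyps by (auto simp: algebra_simps)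
    then show ?thesis unfolding sum_rows_pivot_step by (simp only:) (simp add: algebra_simps)
  qed
  have R: "((\<lambda>x. w x r) \<longlongrightarrow> w0 r) F" if r: "r \<in> R" for r
  proof (rule insert.IH)
    show "indep_rows R J (pivot_step M0 q c)"
      using indep_rows_pivot[of q R c J] insert.hyps insert.prems(1) c by blast
    show "((\<lambda>x. pivot_step (M x) q c r d) \<longlongrightarrow> pivot_step M0 q c r d) F" if "r \<in> R" "d \<in> J" for r d
      using insert.prems(2) c that unfolding pivot_step_def by (auto intro!: tendsto_intros)
    show "((\<lambda>x. M x q c * b x d - b x c * M x q d) \<longlongrightarrow> M0 q c * b0 d - b0 c * M0 q d) F"
      if "d \<in> J" for d
      using insert.prems(2,3) c that by (auto intro!: tendsto_intros)
    show "eventually (\<lambda>x. (\<Sum>r\<in>R. w x r * pivot_step (M x) q c r d) = M x q c * b x d - b x c * M x q d) F"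
      if "d \<in> J" for d
      using insert.prems(4)[OF that] insert.prems(4)[OF c(1)] by eventually_elim (rule *)
    show "(\<Sum>r\<in>R. w0 r * pivot_step M0 q c r d) = M0 q c * b0 d - b0 c * M0 q d" if "d \<in> J" for d
      using insert.prems(5)[OF that] insert.prems(5)[OF c(1)] by (rule *)
  qed (fact r)
  have "((\<lambda>x. (b x c - (\<Sum>r\<in>R. w x r * M x r c)) / M x q c) \<longlongrightarrow>
      (b0 c - (\<Sum>r\<in>R. w0 r * M0 r c)) / M0 q c) F"
    using insert.prems(2,3) R c by (auto intro!: tendsto_intros)
  moreover have **: "(e - (\<Sum>r\<in>R. v r * N r)) / N q = v q"
    if "(\<Sum>r\<in>insert q R. v r * N r) = e" "N q \<noteq> 0" for v N and e :: complex
    using that(1)[symmetric] that(2) insert.hyps by simp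
  have "(b0 c - (\<Sum>r\<in>R. w0 r * M0 r c)) / M0 q c = w0 q"
    using insert.prems(5)[OF c(1)] c(2) by (rule **)
  moreover have "eventually (\<lambda>x. (b x c - (\<Sum>r\<in>R. w x r * M x r c)) / M x q c = w x q) F"
  proof -
    have "eventually (\<lambda>x. M x q c \<noteq> 0) F"
      using insert.prems(2)[of q c] c by (auto intro: tendsto_imp_eventually_ne)
    with insert.prems(4)[OF c(1)] show ?thesis
      by eventually_elim (rule **)
  qed
  ultimately have "((\<lambda>x. w x q) \<longlongrightarrow> w0 q) F"
    using Lim_transform_eventually by fastforce
  then show ?case using R insert.prems(6) by auto
qed simp

text \<open>Solve the eliminated system without row \<open>q\<close> and column \<open>c\<close>,
  then choose entry \<open>c\<close> so that row \<open>q\<close> is satisfied as well. A row that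
  vanishes on \<open>J\<close> is simply dropped.\<close>

lemma underdetermined_kernel:
  fixes M :: "'r \<Rightarrow> 'c \<Rightarrow> complex"
  assumes "finite R" "finite J" "card R < card J"
  shows "\<exists>v. (\<forall>r\<in>R. (\<Sum>c\<in>J. v c * M r c) = 0) \<and> (\<exists>c\<in>J. v c \<noteq> 0)"
  using assms
proof (induction R arbitrary: J M rule: finite_induct)
  case empty
  then obtain c where "c \<in> J" by fastforce
  then show ?case by (intro exI[of _ "\<lambda>_. 1"]) auto
next
  case (insert q R)
  show ?case
  proof (cases "\<exists>c\<in>J. M q c \<noteq> 0")
    case False
    have "card R < card J" using insert by simp
    from insert.IH[OF insert.prems(1) this, of M] False show ?thesis by auto
  next
    case True
    then obtain c where c: "c \<in> J" "M q c \<noteq> 0" by blast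
    have "card R < card (J - {c})" using insert c by (simp add: card_Diff_singleton)
    from insert.IH[OF _ this, of "pivot_step M q c"] insert.prems(1)
    obtain v where v: "\<And>r. r \<in> R \<Longrightarrow> (\<Sum>d\<in>J-{c}. v d * pivot_step M q c r d) = 0"
      "\<exists>d\<in>J-{c}. v d \<noteq> 0" by auto
    define u where "u d = (if d = c then - (\<Sum>d\<in>J-{c}. v d * M q d) else v d * M q c)" for d
    have s: "(\<Sum>d\<in>J. u d * M r d) = (\<Sum>d\<in>J-{c}. v d * pivot_step M q c r d)" for r
    proof -
      have 1: "(\<Sum>d\<in>J. u d * M r d) = u c * M r c + (\<Sum>d\<in>J-{c}. u d * M r d)"
        using insert.prems(1) c by (simp add: sum.remove)
      have 2: "(\<Sum>d\<in>J-{c}. u d * M r d) = M q c * (\<Sum>d\<in>J-{c}. v d * M r d)"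
        unfolding sum_distrib_left by (intro sum.cong) (auto simp: u_def)
      have 3: "u c = - (\<Sum>d\<in>J-{c}. v d * M q d)" by (simp add: u_def)
      show ?thesis unfolding 1 2 3 sum_cols_pivot_step by simp
    qed
    have "(\<Sum>d\<in>J. u d * M q d) = 0" unfolding s pivot_step_def by (simp add: algebra_simps)
    moreover have "\<exists>d\<in>J. u d \<noteq> 0" using v(2) c by (auto simp: u_def)
    ultimately show ?thesis using s v(1) by (intro exI[of _ u]) auto
  qed
qed

text \<open>With more rows than columns, the transposed system would have a nonzero kernel vector,
  which is a relation between the rows.\<close>

lemma indep_rows_card_le:
  assumes "indep_rows R J M" "finite R" "finite J"
  shows "card R \<le> card J"
proof (rule ccontr)
  assume "\<not> ?thesis"
  then have "card J < card R" by simp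
  from underdetermined_kernel[OF assms(3,2) this, of "\<lambda>c r. M r c"]
  obtain v where "\<forall>c\<in>J. (\<Sum>r\<in>R. v r * M r c) = 0" "\<exists>r\<in>R. v r \<noteq> 0" by blast
  then show False using assms(1) by (auto simp: indep_rows_def)
qed

text \<open>A relation between the columns with nonzero coefficient at \<open>c\<close> expresses
  column \<open>c\<close> through the others. The rows would then stay independent on fewer columns
  than there are rows.\<close>

lemma indep_rows_transpose:
  assumes "indep_rows R J M" "finite R" "finite J" "card J = card R"
  shows "indep_rows J R (\<lambda>c r. M r c)"
proof (rule ccontr)
  assume "\<not> ?thesis"
  then obtain v c where v: "\<And>r. r \<in> R \<Longrightarrow> (\<Sum>c\<in>J. v c * M r c) = 0" and c: "c \<in> J" "v c \<noteq> 0"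
    by (auto simp: indep_rows_def)
  have "indep_rows R (J - {c}) M"
    unfolding indep_rows_def
  proof (intro allI impI)
    fix w assume w: "\<forall>c\<in>J - {c}. (\<Sum>r\<in>R. w r * M r c) = 0"
    have "0 = (\<Sum>r\<in>R. w r * (\<Sum>d\<in>J. v d * M r d))" using v by simp
    also have "\<dots> = (\<Sum>d\<in>J. v d * (\<Sum>r\<in>R. w r * M r d))"
      by (simp add: sum_distrib_left algebra_simps) (rule sum.swap)
    also have "\<dots> = v c * (\<Sum>r\<in>R. w r * M r c)"
      using assms(3) c w by (simp add: sum.remove)
    finally have "(\<Sum>r\<in>R. w r * M r c) = 0" using c by simp
    then have "\<forall>d\<in>J. (\<Sum>r\<in>R. w r * M r d) = 0" using w by blast
    then show "\<forall>r\<in>R. w r = 0" using assms(1) by (auto simp: indep_rows_def)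
  qed
  from indep_rows_card_le[OF this] assms c show False
    by (metis card_Diff1_less finite_Diff not_le)
qed

lemma indep_rows_solvable:
  assumes "finite R" "indep_rows R J M" "finite J"
  shows "\<exists>v. \<forall>r\<in>R. (\<Sum>c\<in>J. v c * M r c) = b r"
  using assms
proof (induction R arbitrary: M b rule: finite_induct)
  case (insert q R)
  obtain c where c: "c \<in> J" "M q c \<noteq> 0" using pivot_exists[OF insert.prems(1)] insert.hyps by auto
  have "indep_rows R J (pivot_step M q c)" using indep_rows_pivot[of q R c J] insert.hyps insert.prems(1) c by blast
  from insert.IH[OF this insert.prems(2), of "\<lambda>r. M q c * b r - M r c * b q"]
  obtain v where v: "\<And>r. r \<in> R \<Longrightarrow> (\<Sum>d\<in>J. v d * pivot_step M q c r d) = M q c * b r - M r c * b q"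
    by blast
  \<comment> \<open>Column \<open>c\<close> of the eliminated matrix is zero, so the solution may be
    changed at \<open>c\<close> freely; equation \<open>q\<close> fixes the amount.\<close>
  define t where "t = (b q - (\<Sum>d\<in>J. v d * M q d)) / M q c"
  define u where "u d = v d + (if d = c then t else 0)" for d
  have u: "(\<Sum>d\<in>J. u d * N d) = (\<Sum>d\<in>J. v d * N d) + t * N c" for N
  proof -
    have "(\<Sum>d\<in>J. u d * N d) = (\<Sum>d\<in>J. v d * N d + (if d = c then t * N c else 0))"
      by (intro sum.cong) (auto simp: u_def algebra_simps)
    then show ?thesis using c insert.prems(2) by (simp add: sum.distrib)
  qed
  have q: "(\<Sum>d\<in>J. u d * M q d) = b q" unfolding u using c by (simp add: t_def)
  have uR: "(\<Sum>d\<in>J. u d * M r d) = b r" if r: "r \<in> R" for r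
  proof -
    have "(\<Sum>d\<in>J. u d * pivot_step M q c r d) = M q c * b r - M r c * b q"
      unfolding u v[OF r] by (simp add: pivot_step_def)
    moreover have "(\<Sum>d\<in>J. u d * pivot_step M q c r d) = M q c * (\<Sum>d\<in>J. u d * M r d) - M r c * b q"
      unfolding sum_cols_pivot_step q ..
    ultimately show ?thesis using c by simp
  qed
  have "\<forall>r\<in>insert q R. (\<Sum>d\<in>J. u d * M r d) = b r" using q uR by simp
  then show ?case by (intro exI[of _ u])
qed simp

section \<open>Paths and loops in topological spaces\<close>

definition path_hom :: "'a topology \<Rightarrow> (real \<Rightarrow> 'a) \<Rightarrow> (real \<Rightarrow> 'a) \<Rightarrow> bool" where
  "path_hom X p q \<longleftrightarrow> homotopic_with (\<lambda>r. r 0 = p 0 \<and> r 1 = p 1) (top_of_set {0..1}) X p q"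

text \<open>Free homotopy: every stage is closed, but the base point may travel.\<close>

definition loop_hom :: "'a topology \<Rightarrow> (real \<Rightarrow> 'a) \<Rightarrow> (real \<Rightarrow> 'a) \<Rightarrow> bool" where
  "loop_hom X p q \<longleftrightarrow> homotopic_with (\<lambda>r. r 0 = r 1) (top_of_set {0..1}) X p q"

definition loop_null :: "'a topology \<Rightarrow> (real \<Rightarrow> 'a) \<Rightarrow> bool" where
  "loop_null X p \<longleftrightarrow> (\<exists>a. loop_hom X p (\<lambda>_. a))"

definition simply_connected_top :: "'a topology \<Rightarrow> bool" where
  "simply_connected_top X \<longleftrightarrow>
     path_connected_space X \<and> (\<forall>p. pathin X p \<and> p 0 = p 1 \<longrightarrow> loop_null X p)"

lemma path_homD:
  assumes "path_hom X p q" shows "pathin X p" "pathin X q" "q 0 = p 0" "q 1 = p 1"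
  using homotopic_with_imp_continuous_maps[OF assms[unfolded path_hom_def]]
    homotopic_with_imp_property[OF assms[unfolded path_hom_def]] by (auto simp: pathin_def)

lemma path_hom_sym: "path_hom X p q \<Longrightarrow> path_hom X q p"
  using path_homD[of X p q] by (simp add: path_hom_def homotopic_with_sym)

lemma path_hom_trans: "path_hom X p q \<Longrightarrow> path_hom X q r \<Longrightarrow> path_hom X p r"
  using path_homD[of X p q] by (auto simp: path_hom_def intro: homotopic_with_trans)

lemma path_hom_eq: "pathin X p \<Longrightarrow> (\<And>t. t \<in> {0..1} \<Longrightarrow> p t = q t) \<Longrightarrow> path_hom X p q"
  unfolding path_hom_def pathin_def by (rule homotopic_with_equal) auto

lemma path_hom_refl: "pathin X p \<Longrightarrow> path_hom X p p"
  by (rule path_hom_eq) auto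

lemma loop_hom_sym: "loop_hom X p q \<Longrightarrow> loop_hom X q p"
  by (simp add: loop_hom_def homotopic_with_sym)

lemma loop_hom_trans: "loop_hom X p q \<Longrightarrow> loop_hom X q r \<Longrightarrow> loop_hom X p r"
  by (auto simp: loop_hom_def intro: homotopic_with_trans)

lemma loop_hom_eq:
  "pathin X p \<Longrightarrow> p 0 = p 1 \<Longrightarrow> (\<And>t. t \<in> {0..1} \<Longrightarrow> p t = q t) \<Longrightarrow> loop_hom X p q"
  unfolding loop_hom_def pathin_def by (rule homotopic_with_equal) auto

lemma loop_hom_null: "loop_hom X p q \<Longrightarrow> loop_null X q \<Longrightarrow> loop_null X p"
  by (auto simp: loop_null_def intro: loop_hom_trans)

lemma loop_null_image:
  assumes "loop_null X p" "continuous_map X Y f" shows "loop_null Y (f \<circ> p)"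
proof -
  obtain a where "loop_hom X p (\<lambda>_. a)" using assms by (auto simp: loop_null_def)
  then have "loop_hom Y (f \<circ> p) (f \<circ> (\<lambda>_. a))"
    unfolding loop_hom_def
    by (rule homotopic_with_compose_continuous_map_left) (use assms in \<open>auto simp: o_def\<close>)
  then show ?thesis by (auto simp: loop_null_def o_def)
qed

lemma path_hom_imp_loop_hom: "path_hom X p q \<Longrightarrow> p 0 = p 1 \<Longrightarrow> loop_hom X p q"
  unfolding path_hom_def loop_hom_def by (erule homotopic_with_mono) auto

lemma unit_square_topology:
  "prod_topology (top_of_set {0..1}) (top_of_set {0..1}) = top_of_set ({0..1::real} \<times> {0..1::real})"
  by simp

lemma loop_homI:
  fixes h :: "real \<times> real \<Rightarrow> 'a"
  assumes "continuous_map (top_of_set ({0..1} \<times> {0..1})) X h"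
    "\<And>t. t \<in> {0..1} \<Longrightarrow> h (0, t) = p t" "\<And>t. t \<in> {0..1} \<Longrightarrow> h (1, t) = q t"
    "\<And>s. s \<in> {0..1} \<Longrightarrow> h (s, 0) = h (s, 1)"
  shows "loop_hom X p q"
proof -
  have "homotopic_with (\<lambda>r. r 0 = r 1) (top_of_set {0..1}) X p q"
  proof (subst homotopic_with)
    show "\<exists>h. continuous_map (prod_topology (top_of_set {0..1}) (top_of_set {0..1})) X h \<and>
        (\<forall>x\<in>topspace (top_of_set {0..1}). h (0::real, x::real) = p x) \<and>
        (\<forall>x\<in>topspace (top_of_set {0..1}). h (1, x) = q x) \<and> (\<forall>t\<in>{0..1}. h (t, 0) = h (t, 1))"
      unfolding unit_square_topology by (rule exI[of _ h]) (use assms in auto)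
  qed auto
  then show ?thesis by (simp add: loop_hom_def)
qed

text \<open>Reparametrisations are compared in a convex parameter domain and then transported by one
  continuous map.\<close>

lemma path_hom_push:
  assumes "continuous_map (top_of_set S) X f" "homotopic_paths S p q"
  shows "path_hom X (f \<circ> p) (f \<circ> q)"
  unfolding path_hom_def
  by (rule homotopic_with_compose_continuous_map_left[OF assms(2)[unfolded homotopic_paths_def] assms(1)])
     (auto simp: pathstart_def pathfinish_def)

lemma homotopic_paths_convex:
  fixes p q :: "real \<Rightarrow> 'a::real_normed_vector"
  assumes "convex S" "path p" "path q" "path_image p \<subseteq> S" "path_image q \<subseteq> S"
    "pathstart q = pathstart p" "pathfinish q = pathfinish p"
  shows "homotopic_paths S p q"
proof (rule homotopic_paths_linear)
  show "closed_segment (p t) (q t) \<subseteq> S" if "t \<in> {0..1}" for t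
    using assms that by (intro closed_segment_subset) (auto simp: path_image_def)
qed (use assms in auto)

section \<open>Concatenation of paths, change of base point and covers\<close>

lemma loop_join_apply [simp]:
  "loop_join p q 0 = p 0" "loop_join p q 1 = q 1"
  by (auto simp: loop_join_def)

lemma continuous_map_loop_join_square:
  fixes h1 h2 :: "real \<times> real \<Rightarrow> 'a"
  assumes h1: "continuous_map (top_of_set ({0..1} \<times> {0..1})) X h1"
    and h2: "continuous_map (top_of_set ({0..1} \<times> {0..1})) X h2"
    and j: "\<And>s. s \<in> {0..1} \<Longrightarrow> h1 (s, 1) = h2 (s, 0)"
  shows "continuous_map (top_of_set ({0..1} \<times> {0..1})) X
    (\<lambda>y::real \<times> real. if snd y \<le> 1/2 then (h1 \<circ> (\<lambda>y. (fst y, 2 * snd y))) y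
          else (h2 \<circ> (\<lambda>y. (fst y, 2 * snd y - 1))) y)"
proof (rule continuous_map_cases_le)
  let ?S = "top_of_set ({0..1::real} \<times> {0..1::real})"
  show "continuous_map ?S euclideanreal snd" by (simp add: continuous_on_snd)
  show "continuous_map (subtopology ?S {y \<in> topspace ?S. snd y \<le> 1/2}) X (h1 \<circ> (\<lambda>y. (fst y, 2 * snd y)))"
    by (rule continuous_map_compose[OF _ h1])
       (auto simp: subtopology_subtopology intro!: continuous_intros)
  show "continuous_map (subtopology ?S {y \<in> topspace ?S. 1/2 \<le> snd y}) X (h2 \<circ> (\<lambda>y. (fst y, 2 * snd y - 1)))"
    by (rule continuous_map_compose[OF _ h2])
       (auto simp: subtopology_subtopology intro!: continuous_intros)
  show "(h1 \<circ> (\<lambda>y. (fst y, 2 * snd y))) y = (h2 \<circ> (\<lambda>y. (fst y, 2 * snd y - 1))) y"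
    if "y \<in> topspace ?S" "snd y = 1/2" for y
  proof -
    have "2 * snd y = 1" using that by simp
    moreover have "fst y \<in> {0..1}" using that by (cases y) auto
    ultimately show ?thesis using j[of "fst y"] by (simp add: o_def del: atLeastAtMost_iff)
  qed
qed simp

lemma path_hom_join:
  assumes "path_hom X p p'" "path_hom X q q'" "p 1 = q 0"
  shows "path_hom X (loop_join p q) (loop_join p' q')"
proof -
  obtain h1 :: "real \<times> real \<Rightarrow> 'a" where h1: "continuous_map (top_of_set ({0..1} \<times> {0..1})) X h1"
    "\<forall>t. h1 (0, t) = p t" "\<forall>t. h1 (1, t) = p' t"
    "\<forall>s\<in>{0..1}. h1 (s, 0) = p 0 \<and> h1 (s, 1) = p 1"
    using assms(1) unfolding path_hom_def homotopic_with_def unit_square_topology by blast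
  obtain h2 :: "real \<times> real \<Rightarrow> 'a" where h2: "continuous_map (top_of_set ({0..1} \<times> {0..1})) X h2"
    "\<forall>t. h2 (0, t) = q t" "\<forall>t. h2 (1, t) = q' t"
    "\<forall>s\<in>{0..1}. h2 (s, 0) = q 0 \<and> h2 (s, 1) = q 1"
    using assms(2) unfolding path_hom_def homotopic_with_def unit_square_topology by blast
  have "continuous_map (top_of_set ({0..1} \<times> {0..1})) X
    (\<lambda>y::real \<times> real. if snd y \<le> 1/2 then (h1 \<circ> (\<lambda>y. (fst y, 2 * snd y))) y
          else (h2 \<circ> (\<lambda>y. (fst y, 2 * snd y - 1))) y)"
    using h1 h2 assms(3) by (intro continuous_map_loop_join_square) auto
  then show ?thesis
    unfolding path_hom_def homotopic_with_def unit_square_topology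
    by (intro exI conjI, assumption) (use h1 h2 assms(3) in \<open>auto simp: loop_join_def\<close>)
qed

lemma pathin_loop_join:
  assumes "pathin X p" "pathin X q" "p 1 = q 0"
  shows "pathin X (loop_join p q)"
  using path_homD(1)[OF path_hom_join[OF path_hom_refl path_hom_refl]] assms by blast

lemma pathin_compose_affine:
  assumes "pathin X p" "\<And>t. t \<in> {0..1} \<Longrightarrow> a + b * t \<in> {0..1}"
  shows "pathin X (\<lambda>t. p (a + b * t))"
proof -
  have "continuous_map (top_of_set {0..1}) X (p \<circ> (\<lambda>t. a + b * t))"
    by (rule continuous_map_compose[OF _ assms(1)[unfolded pathin_def]])
       (use assms(2) in \<open>auto intro!: continuous_intros\<close>)
  then show ?thesis by (simp add: pathin_def o_def)
qed

lemma pathin_reverse: "pathin X p \<Longrightarrow> pathin X (\<lambda>t. p (1 - t))"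
  using pathin_compose_affine[of X p 1 "-1"] by auto

text \<open>A null-homotopy \<open>G\<close> of the loop is a map of the unit square that is constant on the edge
  \<open>s = 1\<close> and agrees on the edges \<open>t = 0\<close> and \<open>t = 1\<close>. Both paths are images of segments of the
  edge \<open>s = 0\<close>; pushing these segments through the square to the edge \<open>s = 1\<close> turns them into the
  same path.\<close>

lemma path_hom_of_null_loop:
  assumes "loop_null X (loop_join p (\<lambda>t. q (1 - t)))" "pathin X p" "pathin X q" "p 1 = q 1"
  shows "path_hom X p q"
proof -
  obtain a and G :: "real \<times> real \<Rightarrow> 'a" where G: "continuous_map (top_of_set ({0..1} \<times> {0..1})) X G"
    "\<forall>t. G (0, t) = loop_join p (\<lambda>t. q (1 - t)) t" "\<forall>t. G (1, t) = a"
    "\<forall>s\<in>{0..1}. G (s, 0) = G (s, 1)"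
    using assms(1) unfolding loop_null_def loop_hom_def homotopic_with_def unit_square_topology by blast
  let ?S = "{0..1::real} \<times> {0..1::real}"
  have conv: "convex ?S" by (intro convex_Times) auto
  let ?A = "linepath (0,0) (0,1/2) :: real \<Rightarrow> real \<times> real"
  let ?B = "linepath (0,1) (0,1/2) :: real \<Rightarrow> real \<times> real"
  let ?A' = "linepath (0,0) (1,0) +++ linepath (1,0) (1,1/2) +++ linepath (1,1/2) (0,1/2)
     :: real \<Rightarrow> real \<times> real"
  let ?B' = "linepath (0,1) (1,1) +++ linepath (1,1) (1,1/2) +++ linepath (1,1/2) (0,1/2)
     :: real \<Rightarrow> real \<times> real"
  have seg: "closed_segment x y \<subseteq> ?S" if "x \<in> ?S" "y \<in> ?S" for x y
    by (rule closed_segment_subset[OF that conv])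
  have "homotopic_paths ?S ?A ?A'" "homotopic_paths ?S ?B ?B'"
    by (rule homotopic_paths_convex[OF conv]; simp add: path_image_join; use seg in auto)+
  then have AB: "path_hom X (G \<circ> ?A) (G \<circ> ?A')" "path_hom X (G \<circ> ?B) (G \<circ> ?B')"
    by (simp_all add: path_hom_push[OF G(1)])
  \<comment> \<open>The detours agree piece by piece: the first pieces by
    \<open>G (s, 0) = G (s, 1)\<close>, the second because \<open>G\<close> is constant for s = 1,
    the third literally.\<close>
  have "(G \<circ> ?A') t = (G \<circ> ?B') t" if "t \<in> {0..1}" for t
    using that G(3) bspec[OF G(4), of "2 * t"] by (auto simp: joinpaths_def linepath_def algebra_simps)
  then have "path_hom X (G \<circ> ?A') (G \<circ> ?B')"
    using path_homD[OF AB(1)] by (intro path_hom_eq)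
  then have "path_hom X (G \<circ> ?A) (G \<circ> ?B)"
    using AB by (blast intro: path_hom_trans path_hom_sym)
  moreover have "path_hom X p (G \<circ> ?A)"
    by (rule path_hom_eq[OF assms(2)]) (auto simp: linepath_def G(2) loop_join_def)
  moreover have "path_hom X q (G \<circ> ?B)"
    by (rule path_hom_eq[OF assms(3)]) (auto simp: linepath_def G(2) loop_join_def assms(4) algebra_simps)
  ultimately show ?thesis by (blast intro: path_hom_trans path_hom_sym)
qed

lemma path_hom_split:
  assumes "pathin X p" "0 \<le> a" "a \<le> b" "b \<le> 1"
  shows "path_hom X (\<lambda>u. p (b * u)) (loop_join (\<lambda>u. p (a * u)) (\<lambda>u. p (a + (b - a) * u)))"
proof -
  have "homotopic_paths {0..1} (linepath 0 b) (linepath 0 a +++ linepath a b)"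
    using assms by (intro homotopic_paths_convex) (auto simp: path_image_join closed_segment_eq_real_ivl)
  then have "path_hom X (p \<circ> linepath 0 b) (p \<circ> (linepath 0 a +++ linepath a b))"
    using assms by (intro path_hom_push) (auto simp: pathin_def)
  moreover have "p \<circ> linepath 0 b = (\<lambda>u. p (b * u))" by (auto simp: linepath_def mult.commute)
  moreover have "p \<circ> (linepath 0 a +++ linepath a b)
      = loop_join (\<lambda>u. p (a * u)) (\<lambda>u. p (a + (b - a) * u))"
    by (auto simp: fun_eq_iff linepath_def joinpaths_def loop_join_def algebra_simps)
  ultimately show ?thesis by simp
qed

text \<open>An arbitrary loop is freely homotopic to its conjugate by a path \<open>g\<close> from
  \<open>x0\<close>, which is a loop at \<open>x0\<close>.\<close>

lemma loops_null_change_base: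
  assumes "path_connected_space X" "x0 \<in> topspace X"
    "\<And>p. pathin X p \<Longrightarrow> p 0 = x0 \<Longrightarrow> p 1 = x0 \<Longrightarrow> loop_null X p"
  shows "simply_connected_top X"
  unfolding simply_connected_top_def
proof (intro conjI allI impI)
  fix p assume p: "pathin X p \<and> p 0 = p 1"
  then have "p 0 \<in> topspace X" by (auto simp: pathin_def continuous_map_def)
  then obtain g where g: "pathin X g" "g 0 = x0" "g 1 = p 0"
    using assms(1,2) by (auto simp: path_connected_space_def)
  let ?P = "loop_join (loop_join g p) (\<lambda>t. g (1 - t))"
  have P: "pathin X ?P"
    using p g by (intro pathin_loop_join pathin_reverse) auto
  then have null: "loop_null X ?P" using g by (intro assms(3)) auto
  have "loop_hom X ?P p"
  proof (rule loop_homI)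
    \<comment> \<open>At time s the conjugate is restricted to the parameters from s/4 to 1 - s/2.
      Both ends are then at \<open>g s\<close>, so each stage is a loop; at s = 1 the interval from
      1/4 to 1/2 remains, on which exactly \<open>p\<close> is run through.\<close>
    have "continuous_map (top_of_set ({0..1} \<times> {0..1})) X (?P \<circ> (\<lambda>y. fst y / 4 + snd y * (1 - 3 * fst y / 4)))"
      using P[unfolded pathin_def]
    proof (rule continuous_map_compose[rotated])
      have "s / 4 + t * (1 - 3 * s / 4) \<in> {0..1}" if "s \<in> {0..1}" "t \<in> {0..1}" for s t :: real
      proof -
        define w where "w = t * (1 - 3 * s / 4)"
        have "w \<le> 1 * (1 - 3 * s / 4)" unfolding w_def using that by (intro mult_right_mono) auto
        moreover have "0 \<le> w" unfolding w_def using that by (intro mult_nonneg_nonneg) auto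
        ultimately show ?thesis using that unfolding w_def[symmetric] by auto
      qed
      then show "continuous_map (top_of_set ({0..1} \<times> {0..1})) (top_of_set {0..1::real})
         (\<lambda>y. fst y / 4 + snd y * (1 - 3 * fst y / 4))"
        by (auto intro!: continuous_intros)
    qed
    then show "continuous_map (top_of_set ({0..1} \<times> {0..1})) X
        (\<lambda>y. ?P (fst y / 4 + snd y * (1 - 3 * fst y / 4)))"
      by (simp add: o_def)
  qed (use p g in \<open>auto simp: loop_join_def algebra_simps\<close>)
  then show "loop_null X p" using null loop_hom_null loop_hom_sym by blast
qed (fact assms(1))

text \<open>The part of \<open>p\<close> up to time \<open>t\<close> is compared with paths from
  \<open>x0\<close> to \<open>p t\<close> inside one member of the cover. As all members contain
  \<open>x0\<close> and two of them meet in a path-connected set, the comparison can pass from one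
  member to the next.\<close>

lemma simply_connected_from_cover:
  assumes x0: "x0 \<in> topspace X"
    and op: "\<And>U. U \<in> \<U> \<Longrightarrow> openin X U" and base: "\<And>U. U \<in> \<U> \<Longrightarrow> x0 \<in> U"
    and cov: "topspace X \<subseteq> \<Union>\<U>"
    and pc: "\<And>U V x y. U \<in> \<U> \<Longrightarrow> V \<in> \<U> \<Longrightarrow> x \<in> U \<inter> V \<Longrightarrow> y \<in> U \<inter> V \<Longrightarrow>
        \<exists>g. pathin X g \<and> g ` {0..1} \<subseteq> U \<inter> V \<and> g 0 = x \<and> g 1 = y"
    and null: "\<And>U p. U \<in> \<U> \<Longrightarrow> pathin X p \<Longrightarrow> p ` {0..1} \<subseteq> U \<Longrightarrow> p 0 = p 1 \<Longrightarrow> loop_null X p"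
  shows "simply_connected_top X"
proof (rule loops_null_change_base[OF _ x0])
  have toX: "\<exists>g. pathin X g \<and> g ` {0..1} \<subseteq> U \<and> g 0 = x0 \<and> g 1 = x" if "U \<in> \<U>" "x \<in> U" for U x
    using pc[of U U x0 x] that base by auto
  have "\<exists>g. pathin X g \<and> g 0 = x0 \<and> g 1 = x" if "x \<in> topspace X" for x
    using toX that cov by blast
  then have "path_component_of X x0 x" if "x \<in> topspace X" for x
    using that by (auto simp: path_component_of_def)
  then show "path_connected_space X"
    unfolding path_connected_space_iff_path_component
    by (meson path_component_of_sym path_component_of_trans)
  fix p assume p: "pathin X p" "p 0 = x0" "p 1 = x0"
  have same: "path_hom X s t"
    if "U \<in> \<U>" "pathin X s" "pathin X t" "s ` {0..1} \<subseteq> U" "t ` {0..1} \<subseteq> U" "s 0 = t 0" "s 1 = t 1" for U s t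
  proof (rule path_hom_of_null_loop)
    show "loop_null X (loop_join s (\<lambda>u. t (1 - u)))"
    proof (rule null[OF that(1)])
      show "pathin X (loop_join s (\<lambda>u. t (1 - u)))"
        using that by (intro pathin_loop_join pathin_reverse) auto
      show "loop_join s (\<lambda>u. t (1 - u)) ` {0..1} \<subseteq> U"
        using that(4,5) by (auto simp: loop_join_def image_subset_iff)
    qed (use that in auto)
  qed (use that in auto)
  \<comment> \<open>Quantifying over all members and all comparison paths makes the statement
    independent of choices, so that it can be propagated in \<open>t\<close>.\<close>
  define C where "C t \<longleftrightarrow> (\<forall>U\<in>\<U>. \<forall>s. pathin X s \<and> s ` {0..1} \<subseteq> U \<and> s 0 = x0 \<and> s 1 = p t
      \<longrightarrow> path_hom X (\<lambda>u. p (t * u)) s)" for t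
  have C0: "C 0"
    unfolding C_def
  proof (intro ballI allI impI)
    fix U s assume U: "U \<in> \<U>" and s: "pathin X s \<and> s ` {0..1} \<subseteq> U \<and> s 0 = x0 \<and> s 1 = p 0"
    then show "path_hom X (\<lambda>u. p (0 * u)) s"
      using p x0 base[OF U] by (intro same[OF U]) (auto simp: pathin_def)
  qed
  have step: "C b" if "C a" "0 \<le> a" "a \<le> b" "b \<le> 1" "U \<in> \<U>" "p ` {a..b} \<subseteq> U" for a b U
    unfolding C_def
  proof (intro ballI allI impI)
    fix V s assume V: "V \<in> \<U>" and s: "pathin X s \<and> s ` {0..1} \<subseteq> V \<and> s 0 = x0 \<and> s 1 = p b"
    have pb: "p b \<in> U" "p a \<in> U" using that by (auto simp: image_subset_iff)
    have "p b \<in> V" using s by (metis atLeastAtMost_iff image_subset_iff order_refl zero_le_one)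
    \<comment> \<open>The bridge between the two members: \<open>g\<close> runs in both, so it is
      comparable with the old path inside \<open>U\<close> and with \<open>s\<close> inside
      \<open>V\<close>.\<close>
    then obtain g where g: "pathin X g" "g ` {0..1} \<subseteq> U \<inter> V" "g 0 = x0" "g 1 = p b"
      using pc[OF \<open>U \<in> \<U>\<close> V, of x0 "p b"] base[OF V] base[OF \<open>U \<in> \<U>\<close>] pb by blast
    obtain f where f: "pathin X f" "f ` {0..1} \<subseteq> U" "f 0 = x0" "f 1 = p a"
      using toX[OF \<open>U \<in> \<U>\<close> pb(2)] by blast
    let ?r = "\<lambda>u. p (a + (b - a) * u)"
    have ab: "a + (b - a) * u \<in> {a..b}" if "u \<in> {0..1}" for u
    proof -
      have "(b - a) * u \<le> (b - a) * 1" using that \<open>a \<le> b\<close> by (intro mult_left_mono) auto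
      then show ?thesis using that \<open>a \<le> b\<close> by auto
    qed
    have r: "pathin X ?r"
    proof (rule pathin_compose_affine[OF p(1)])
      show "a + (b - a) * u \<in> {0..1}" if "u \<in> {0..1}" for u
        using ab[OF that] \<open>0 \<le> a\<close> \<open>b \<le> 1\<close> by auto
    qed
    have "path_hom X (\<lambda>u. p (b * u)) (loop_join (\<lambda>u. p (a * u)) ?r)"
      using p(1) that(2-4) by (rule path_hom_split)
    also have fa: "path_hom X (\<lambda>u. p (a * u)) f" using \<open>C a\<close> f that(5) by (auto simp: C_def)
    then have "path_hom X (loop_join (\<lambda>u. p (a * u)) ?r) (loop_join f ?r)"
      using r by (intro path_hom_join path_hom_refl) auto
    finally (path_hom_trans) have 1: "path_hom X (\<lambda>u. p (b * u)) (loop_join f ?r)" .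
    have 2: "path_hom X (loop_join f ?r) g"
    proof (rule same[OF \<open>U \<in> \<U>\<close>])
      show "loop_join f ?r ` {0..1} \<subseteq> U"
        using f(2) ab that(6) by (auto simp: loop_join_def image_subset_iff)
    qed (use f r g in \<open>auto intro!: pathin_loop_join\<close>)
    have 3: "path_hom X g s"
      by (rule same[OF V]) (use g s in auto)
    show "path_hom X (\<lambda>u. p (b * u)) s" using 1 2 3 path_hom_trans by blast
  qed
  \<comment> \<open>The guards restrict to subintervals of the unit interval, since
    \<open>Bolzano\<close> also tests intervals that stick out of it.\<close>
  define Q where "Q a b \<longleftrightarrow> (0 \<le> a \<longrightarrow> b \<le> 1 \<longrightarrow> C a \<longrightarrow> C b)" for a b
  have "Q 0 1"
  proof (rule Bolzano[of 0 1 Q])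
    fix x :: real assume local: "0 \<le> x" "x \<le> 1"
    then have "p x \<in> topspace X" using p(1) by (auto simp: pathin_def continuous_map_def)
    then obtain U where U: "U \<in> \<U>" "p x \<in> U" using cov by blast
    have "openin (top_of_set {0..1}) {t \<in> {0..1}. p t \<in> U}"
      using openin_continuous_map_preimage[OF p(1)[unfolded pathin_def] op[OF U(1)]] by simp
    then obtain d where d: "d > 0" "\<And>t. t \<in> {0..1} \<Longrightarrow> dist t x < d \<Longrightarrow> p t \<in> U"
      using local U(2) unfolding openin_euclidean_subtopology_iff by auto
    have "C b" if "a \<le> x" "x \<le> b" "b - a < d" "0 \<le> a" "b \<le> 1" "C a" for a b
      using that(6,4) _ that(5) U(1)
    proof (rule step)
      show "p ` {a..b} \<subseteq> U" using that by (auto intro!: d(2) simp: dist_real_def)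
    qed (use that in auto)
    then show "\<exists>d>0. \<forall>a b. a \<le> x \<and> x \<le> b \<and> b - a < d \<longrightarrow> Q a b" using d(1) by (auto simp: Q_def)
  qed (auto simp: Q_def)
  with C0 have "C 1" by (simp add: Q_def)
  moreover obtain U where "U \<in> \<U>" using cov x0 by blast
  ultimately have "path_hom X (\<lambda>u. p (1 * u)) (\<lambda>_. x0)"
    unfolding C_def using p x0 base by (auto simp: pathin_def image_subset_iff)
  then show "loop_null X p"
    using path_hom_imp_loop_hom[of X p "\<lambda>_. x0"] p by (auto simp: loop_null_def)
qed

section \<open>Quotients by free actions of finite groups\<close>

text \<open>The action is on the right because permutations act on tuples by precomposition. The
  orbit space enters abstractly, through a quotient map whose fibres are the orbits.\<close>

locale free_finite_action = group G for G :: "('g, 'm) monoid_scheme" (structure) +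
  fixes X :: "'a topology" and Y :: "'b topology" and q :: "'a \<Rightarrow> 'b" and act :: "'a \<Rightarrow> 'g \<Rightarrow> 'a"
  assumes fin: "finite (carrier G)"
    and act_cont: "g \<in> carrier G \<Longrightarrow> continuous_map X X (\<lambda>x. act x g)"
    and act_mult: "x \<in> topspace X \<Longrightarrow> g \<in> carrier G \<Longrightarrow> h \<in> carrier G \<Longrightarrow>
      act x (g \<otimes> h) = act (act x g) h"
    and act_one: "x \<in> topspace X \<Longrightarrow> act x \<one> = x"
    and free: "x \<in> topspace X \<Longrightarrow> g \<in> carrier G \<Longrightarrow> act x g = x \<Longrightarrow> g = \<one>"
    and quot: "quotient_map X Y q"
    and fibre: "x \<in> topspace X \<Longrightarrow> y \<in> topspace X \<Longrightarrow> q x = q y \<longleftrightarrow> (\<exists>g\<in>carrier G. y = act x g)"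
    and haus: "Hausdorff_space X"
begin

lemma act_in: "x \<in> topspace X \<Longrightarrow> g \<in> carrier G \<Longrightarrow> act x g \<in> topspace X"
  using act_cont by (fastforce simp: continuous_map_def)

lemma q_act: "x \<in> topspace X \<Longrightarrow> g \<in> carrier G \<Longrightarrow> q (act x g) = q x"
  using fibre act_in by metis

lemma act_inv: "x \<in> topspace X \<Longrightarrow> g \<in> carrier G \<Longrightarrow> act (act x g) (inv g) = x"
  by (simp flip: act_mult add: act_one)

lemma act_inj:
  assumes "x \<in> topspace X" "g \<in> carrier G" "h \<in> carrier G" "act x g = act x h"
  shows "g = h"
proof -
  have "act x (g \<otimes> inv h) = x" using assms act_mult act_inv by simp
  then have "g \<otimes> inv h = \<one>" using assms free by simp
  then show ?thesis using assms by (metis inv_equality inv_inv inv_closed)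
qed

lemma q_cont: "continuous_map X Y q"
  using quot by (rule quotient_imp_continuous_map)

lemma q_surj: "q ` topspace X = topspace Y"
  using quot by (rule quotient_imp_surjective_map)

text \<open>The saturation of an open set is the union of its preimages under the maps of the
  action.\<close>

lemma q_open: assumes "openin X U" shows "openin Y (q ` U)"
proof -
  have UX: "U \<subseteq> topspace X" using assms by (rule openin_subset)
  have "{x \<in> topspace X. q x \<in> q ` U} = (\<Union>g\<in>carrier G. {x \<in> topspace X. act x g \<in> U})"
  proof (intro equalityI subsetI)
    fix x assume x: "x \<in> {x \<in> topspace X. q x \<in> q ` U}"
    then obtain u where u: "u \<in> U" "q x = q u" by auto
    then show "x \<in> (\<Union>g\<in>carrier G. {x \<in> topspace X. act x g \<in> U})"
      using x UX fibre[of x u] by blast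
  next
    fix x assume "x \<in> (\<Union>g\<in>carrier G. {x \<in> topspace X. act x g \<in> U})"
    then show "x \<in> {x \<in> topspace X. q x \<in> q ` U}"
      using q_act by (metis (mono_tags, lifting) UN_E image_eqI mem_Collect_eq)
  qed
  moreover have "openin X (\<Union>g\<in>carrier G. {x \<in> topspace X. act x g \<in> U})"
    using openin_continuous_map_preimage[OF act_cont assms] by (intro openin_Union) auto
  ultimately show ?thesis
    using quot UX q_surj unfolding quotient_map_def by (metis image_mono)
qed

text \<open>The sheets of the covering \<open>q\<close>, which is injective on each of them.\<close>

definition slice :: "'a set \<Rightarrow> bool" where
  "slice S \<longleftrightarrow> openin X S \<and> (\<forall>g\<in>carrier G. \<forall>y\<in>S. act y g \<in> S \<longrightarrow> g = \<one>)"

text \<open>For each nontrivial \<open>g\<close> the Hausdorff property separates \<open>x\<close>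
  from its translate; the resulting neighbourhoods are finite in number and can be
  intersected.\<close>

lemma slice_exists: assumes x: "x \<in> topspace X" shows "\<exists>S. slice S \<and> x \<in> S"
proof -
  have "\<exists>S. openin X S \<and> x \<in> S \<and> (\<forall>y\<in>S. act y g \<notin> S)" if g: "g \<in> carrier G - {\<one>}" for g
  proof -
    have "act x g \<noteq> x" "act x g \<in> topspace X" using g x free act_in by auto
    then obtain A B where AB: "openin X A" "openin X B" "x \<in> A" "act x g \<in> B" "disjnt A B"
      using haus x unfolding Hausdorff_space_def by metis
    have "openin X (A \<inter> {y \<in> topspace X. act y g \<in> B})"
      using g AB act_cont by (intro openin_Int openin_continuous_map_preimage) auto
    then show ?thesis
      using AB x by (intro exI[of _ "A \<inter> {y \<in> topspace X. act y g \<in> B}"]) (auto simp: disjnt_def)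
  qed
  then obtain S where S: "\<And>g. g \<in> carrier G - {\<one>} \<Longrightarrow>
      openin X (S g) \<and> x \<in> S g \<and> (\<forall>y\<in>S g. act y g \<notin> S g)" by metis
  \<comment> \<open>The factor \<open>topspace X\<close> takes care of the trivial group, where the
    family to be intersected is empty.\<close>
  let ?T = "topspace X \<inter> (\<Inter>g\<in>carrier G - {\<one>}. S g)"
  have "openin X ?T"
  proof (cases "carrier G - {\<one>} = {}")
    case False
    then have "openin X (\<Inter>g\<in>carrier G - {\<one>}. S g)"
      using S fin by (intro openin_Inter) auto
    then show ?thesis by blast
  next
    case True
    then have "?T = topspace X" by auto
    then show ?thesis by simp
  qed
  moreover have "g = \<one>" if "g \<in> carrier G" "y \<in> ?T" "act y g \<in> ?T" for g y
    using S[of g] that by blast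
  ultimately have "slice ?T" by (auto simp: slice_def)
  then show ?thesis using x S by (intro exI[of _ ?T]) auto
qed

lemma slice_sub: "slice S \<Longrightarrow> S \<subseteq> topspace X"
  by (auto simp: slice_def dest: openin_subset)

lemma slice_inj: assumes "slice S" "x \<in> S" "y \<in> S" "q x = q y" shows "x = y"
proof -
  have "x \<in> topspace X" "y \<in> topspace X" using slice_sub assms by auto
  then obtain g where "g \<in> carrier G" "y = act x g" using fibre assms(4) by metis
  then show ?thesis using assms act_one[OF \<open>x \<in> topspace X\<close>] by (auto simp: slice_def)
qed

text \<open>Openness of \<open>q\<close> makes the inverse of its injective restriction
  continuous.\<close>

lemma slice_section:
  assumes "slice S"
  shows "\<exists>s. continuous_map (subtopology Y (q ` S)) X s \<and> (\<forall>x\<in>S. s (q x) = x)"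
proof -
  have inj: "inj_on q S" using slice_inj[OF assms] by (auto intro: inj_onI)
  let ?s = "inv_into S q"
  have s: "?s (q x) = x" if "x \<in> S" for x using inj that by simp
  have "continuous_map (subtopology Y (q ` S)) X ?s"
    unfolding continuous_map_def
  proof (intro conjI allI impI)
    show "?s \<in> topspace (subtopology Y (q ` S)) \<rightarrow> topspace X"
      using s slice_sub[OF assms] by auto
    fix U assume U: "openin X U"
    have "{y \<in> topspace (subtopology Y (q ` S)). ?s y \<in> U} = q ` (S \<inter> U) \<inter> topspace Y \<inter> q ` S"
      using s q_surj slice_sub[OF assms] by auto
    moreover have "openin Y (q ` (S \<inter> U))"
      using assms U by (intro q_open openin_Int) (auto simp: slice_def)
    ultimately show "openin (subtopology Y (q ` S)) {y \<in> topspace (subtopology Y (q ` S)). ?s y \<in> U}"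
      by (auto simp: openin_subtopology)
  qed
  then show ?thesis using s by blast
qed

text \<open>The times spent in \<open>S\<close> and the times spent in nontrivial translates of
  \<open>S\<close> are open, disjoint and cover the interval, which is connected.\<close>

lemma lift_stays_in_slice:
  fixes a b :: real
  assumes S: "slice S" and l: "continuous_map (top_of_set {a..b}) X l"
    and q: "\<And>t. t \<in> {a..b} \<Longrightarrow> q (l t) \<in> q ` S" and u: "u \<in> {a..b}" "l u \<in> S" and t: "t \<in> {a..b}"
  shows "l t \<in> S"
proof (rule ccontr)
  assume nt: "l t \<notin> S"
  have lX: "l t \<in> topspace X" if "t \<in> {a..b}" for t
    using l that by (auto simp: continuous_map_def)
  let ?A = "{t \<in> {a..b}. l t \<in> S}"
  let ?B = "\<Union>g\<in>carrier G - {\<one>}. {t \<in> {a..b}. act (l t) g \<in> S}"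
  have op: "openin X S" using S by (simp add: slice_def)
  have "openin (top_of_set {a..b}) ?A"
    using openin_continuous_map_preimage[OF l op] by simp
  moreover have "openin (top_of_set {a..b}) ?B"
  proof -
    have "openin (top_of_set {a..b}) {t \<in> {a..b}. act (l t) g \<in> S}" if "g \<in> carrier G" for g
      using openin_continuous_map_preimage[OF continuous_map_compose[OF l act_cont[OF that]] op] by simp
    then show ?thesis by (intro openin_Union) blast
  qed
  moreover have cov: "\<exists>g\<in>carrier G. act (l t) g \<in> S" if "t \<in> {a..b}" for t
  proof -
    obtain o' where "o' \<in> S" "q (l t) = q o'" using q[OF \<open>t \<in> {a..b}\<close>] by auto
    then show ?thesis using fibre[of "l t" o'] lX[OF that] slice_sub[OF S] by blast
  qed
  moreover have sub: "{a..b} \<subseteq> ?A \<union> ?B"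
  proof
    fix t assume t: "t \<in> {a..b}"
    then obtain g where g: "g \<in> carrier G" "act (l t) g \<in> S" using cov by blast
    then show "t \<in> ?A \<union> ?B" using t act_one[OF lX[OF t]] by (cases "g = \<one>") auto
  qed
  moreover have "?A \<inter> ?B = {}" using S by (auto simp: slice_def)
  moreover have "?A \<noteq> {}" using u by blast
  moreover have "?B \<noteq> {}" using sub t nt by blast
  ultimately show False
    using connected_openin[of "{a..b}"] connected_Icc[of a b] by blast
qed

section \<open>Lifting of paths and homotopies, and monodromy\<close>

lemma pathin_sub:
  assumes "pathin Z l" "0 \<le> a" "b \<le> 1"
  shows "continuous_map (top_of_set {a..b}) Z l"
  using assms unfolding pathin_def by (auto elim!: continuous_map_from_subtopology_mono)

lemma pathin_nbhd:
  fixes a b :: real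
  assumes "continuous_map (top_of_set {a..b}) Z l" "openin Z U" "t0 \<in> {a..b}" "l t0 \<in> U"
  shows "\<exists>d>0. \<forall>t\<in>{a..b}. \<bar>t - t0\<bar> < d \<longrightarrow> l t \<in> U"
proof -
  have "openin (top_of_set {a..b}) {t \<in> {a..b}. l t \<in> U}"
    using openin_continuous_map_preimage[OF assms(1,2)] by simp
  then obtain d where "d > 0" "\<And>t. t \<in> {a..b} \<Longrightarrow> dist t t0 < d \<Longrightarrow> l t \<in> U"
    using assms(3,4) unfolding openin_euclidean_subtopology_iff by auto
  then show ?thesis by (auto simp: dist_real_def)
qed

text \<open>On a short interval \<open>l\<close> stays in one slice. If \<open>l'\<close> agrees
  with \<open>l\<close> at the start, it is trapped in the same slice, and \<open>q\<close> is
  injective there.\<close>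

lemma lift_unique:
  assumes l: "pathin X l" "pathin X l'" "l 0 = l' 0"
    and q: "\<And>t. t \<in> {0..1} \<Longrightarrow> q (l t) = q (l' t)" and t: "t \<in> {0..1}"
  shows "l t = l' t"
proof -
  define Q where "Q a b \<longleftrightarrow> (0 \<le> a \<longrightarrow> b \<le> 1 \<longrightarrow> l a = l' a \<longrightarrow> l b = l' b)" for a b
  have "Q 0 t"
  proof (rule Bolzano[of 0 t Q])
    fix x assume "0 \<le> x" "x \<le> t"
    then have x: "x \<in> {0..1}" using t by auto
    then have "l x \<in> topspace X" using l by (auto simp: pathin_def continuous_map_def)
    then obtain S where S: "slice S" "l x \<in> S" using slice_exists by blast
    obtain d where d: "d > 0" "\<And>t. t \<in> {0..1} \<Longrightarrow> \<bar>t - x\<bar> < d \<Longrightarrow> l t \<in> S"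
      using pathin_nbhd[OF l(1)[unfolded pathin_def] _ x S(2)] S(1) by (auto simp: slice_def)
    have "l b = l' b" if h: "a \<le> x" "x \<le> b" "b - a < d" "0 \<le> a" "b \<le> 1" "l a = l' a" for a b
    proof -
      have S2: "l t \<in> S" if "t \<in> {a..b}" for t using that h by (intro d(2)) auto
      have "q (l' t) \<in> q ` S" if "t \<in> {a..b}" for t
        using q[of t] S2[OF that] that h by (auto intro: image_eqI[of _ _ "l t"])
      then have "l' b \<in> S"
        using lift_stays_in_slice[OF S(1) pathin_sub[OF l(2) h(4,5)], of a b] S2[of a] h by auto
      then show ?thesis using slice_inj[OF S(1) S2[of b]] q[of b] h by auto
    qed
    then show "\<exists>d>0. \<forall>a b. a \<le> x \<and> x \<le> b \<and> b - a < d \<longrightarrow> Q a b"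
      using d(1) by (auto simp: Q_def)
  qed (use t in \<open>auto simp: Q_def\<close>)
  then show ?thesis using l(3) t by (auto simp: Q_def)
qed

lemma lift_exists:
  assumes p: "pathin Y p" and x: "x \<in> topspace X" "q x = p 0"
  shows "\<exists>l. pathin X l \<and> l 0 = x \<and> (\<forall>t\<in>{0..1}. q (l t) = p t)"
proof -
  \<comment> \<open>Lifts are demanded from every point over \<open>p a\<close>, so that lifts over
    adjacent intervals can be glued.\<close>
  define Q where "Q a b \<longleftrightarrow> (0 \<le> a \<longrightarrow> b \<le> 1 \<longrightarrow> (\<forall>x\<in>topspace X. q x = p a \<longrightarrow>
      (\<exists>l. continuous_map (top_of_set {a..b}) X l \<and> l a = x \<and> (\<forall>t\<in>{a..b}. q (l t) = p t))))" for a b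
  have "Q 0 1"
  proof (rule Bolzano[of 0 1 Q])
    fix a b c :: real assume ab: "Q a b" and bc: "Q b c" and le: "a \<le> b" "b \<le> c"
    show "Q a c"
      unfolding Q_def
    proof (intro impI ballI)
      fix x assume h: "0 \<le> a" "c \<le> 1" "x \<in> topspace X" "q x = p a"
      then obtain l1 where l1: "continuous_map (top_of_set {a..b}) X l1" "l1 a = x"
        "\<forall>t\<in>{a..b}. q (l1 t) = p t" using ab le by (fastforce simp: Q_def)
      have "l1 b \<in> topspace X" using l1(1) le by (auto simp: continuous_map_def)
      then obtain l2 where l2: "continuous_map (top_of_set {b..c}) X l2" "l2 b = l1 b"
        "\<forall>t\<in>{b..c}. q (l2 t) = p t" using bc le h l1(3) by (fastforce simp: Q_def)
      let ?l = "\<lambda>t. if t \<le> b then l1 t else l2 t"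
      have "{a..c} \<inter> {t. a \<le> t \<and> t \<le> c \<and> t \<le> b} = {a..b}" "{a..c} \<inter> {t. a \<le> t \<and> t \<le> c \<and> b \<le> t} = {b..c}"
        using le by auto
      then have "continuous_map (top_of_set {a..c}) X ?l"
        by (intro continuous_map_cases_le) (use l1 l2 in \<open>auto simp: subtopology_subtopology\<close>)
      then show "\<exists>l. continuous_map (top_of_set {a..c}) X l \<and> l a = x \<and> (\<forall>t\<in>{a..c}. q (l t) = p t)"
        using l1 l2 le by (intro exI[of _ ?l]) auto
    qed
  next
    fix t0 :: real assume "0 \<le> t0" "t0 \<le> 1"
    then have t0: "t0 \<in> {0..1}" by auto
    then have "p t0 \<in> topspace Y" using p by (auto simp: pathin_def continuous_map_def)
    then obtain x0 where x0: "x0 \<in> topspace X" "q x0 = p t0" using q_surj by (metis imageE)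
    obtain S where S: "slice S" "x0 \<in> S" using slice_exists x0 by blast
    obtain s where s: "continuous_map (subtopology Y (q ` S)) X s" "\<And>x. x \<in> S \<Longrightarrow> s (q x) = x"
      using slice_section[OF S(1)] by blast
    have "openin Y (q ` S)" using S(1) q_open by (auto simp: slice_def)
    then obtain d where d: "d > 0" "\<And>t. t \<in> {0..1} \<Longrightarrow> \<bar>t - t0\<bar> < d \<Longrightarrow> p t \<in> q ` S"
      using pathin_nbhd[OF p[unfolded pathin_def] _ t0] S(2) x0(2) by (metis image_eqI)
    have "\<exists>l. continuous_map (top_of_set {a..b}) X l \<and> l a = x \<and> (\<forall>t\<in>{a..b}. q (l t) = p t)"
      if h: "a \<le> t0" "t0 \<le> b" "b - a < d" "0 \<le> a" "b \<le> 1" and x: "x \<in> topspace X" "q x = p a" for a b x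
    proof -
      have pS: "p t \<in> q ` S" if "t \<in> {a..b}" for t using that h by (intro d(2)) auto
      then obtain y where y: "y \<in> S" "q y = p a" using h by force
      then have yX: "y \<in> topspace X" using slice_sub[OF S(1)] by auto
      \<comment> \<open>The section lifts into \<open>S\<close> and starts at \<open>y\<close>;
        translating by \<open>g\<close> moves the start to the prescribed point.\<close>
      then obtain g where g: "g \<in> carrier G" "x = act y g" using fibre[of y x] x y by metis
      let ?l = "\<lambda>t. act (s (p t)) g"
      have pc: "continuous_map (top_of_set {a..b}) (subtopology Y (q ` S)) p"
      proof (rule continuous_map_into_subtopology)
        show "continuous_map (top_of_set {a..b}) Y p" using p h by (intro pathin_sub)
      qed (use pS in auto)
      have "continuous_map (top_of_set {a..b}) X ((\<lambda>x. act x g) \<circ> (s \<circ> p))"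
        by (intro continuous_map_compose[OF continuous_map_compose[OF pc s(1)] act_cont[OF g(1)]])
      then have "continuous_map (top_of_set {a..b}) X ?l" by (simp add: o_def)
      moreover have "?l a = x" using s(2)[OF y(1)] y(2) g(2) by simp
      moreover have "q (?l t) = p t" if "t \<in> {a..b}" for t
      proof -
        obtain z where "z \<in> S" "p t = q z" using pS[OF \<open>t \<in> {a..b}\<close>] by auto
        then show ?thesis using s(2) slice_sub[OF S(1)] g(1) q_act by auto
      qed
      ultimately show ?thesis by blast
    qed
    then show "\<exists>d>0. \<forall>a b. a \<le> t0 \<and> t0 \<le> b \<and> b - a < d \<longrightarrow> Q a b"
      using d(1) by (auto simp: Q_def)
  qed auto
  then show ?thesis using x by (simp add: Q_def pathin_def)
qed

text \<open>The paths of the homotopy are lifted one by one, with no continuity in \<open>s\<close>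
  at hand. It is enough that the endpoint \<open>L s 1\<close> is locally constant in
  \<open>s\<close>.\<close>

lemma lift_homotopic_endpoint:
  assumes hom: "path_hom Y p p'" and l: "pathin X l" "pathin X l'" "l 0 = l' 0"
    and q: "\<And>t. t \<in> {0..1} \<Longrightarrow> q (l t) = p t" "\<And>t. t \<in> {0..1} \<Longrightarrow> q (l' t) = p' t"
  shows "l 1 = l' 1"
proof -
  obtain h :: "real \<times> real \<Rightarrow> 'b" where h: "continuous_map (top_of_set ({0..1} \<times> {0..1})) Y h"
    "\<forall>t. h (0, t) = p t" "\<forall>t. h (1, t) = p' t"
    "\<forall>s\<in>{0..1}. h (s, 0) = p 0 \<and> h (s, 1) = p 1"
    using hom unfolding path_hom_def homotopic_with_def unit_square_topology by blast
  have x0: "l 0 \<in> topspace X" "q (l 0) = p 0"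
    using l(1) q(1)[of 0] by (auto simp: pathin_def continuous_map_def Pi_iff)
  have hs: "pathin Y (\<lambda>t. h (s, t))" if "s \<in> {0..1}" for s
  proof -
    have "continuous_map (top_of_set {0..1}) Y (h \<circ> (\<lambda>t. (s, t)))"
      by (rule continuous_map_compose[OF _ h(1)]) (use that in \<open>auto intro!: continuous_intros\<close>)
    then show ?thesis by (simp add: pathin_def o_def)
  qed
  have "\<exists>L. pathin X L \<and> L 0 = l 0 \<and> (\<forall>t\<in>{0..1}. q (L t) = h (s, t))" if "s \<in> {0..1}" for s
    using lift_exists[OF hs[OF that] x0(1)] x0(2) h(4) that by auto
  then obtain L where L: "\<And>s. s \<in> {0..1} \<Longrightarrow> pathin X (L s)" "\<And>s. s \<in> {0..1} \<Longrightarrow> L s 0 = l 0"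
    "\<And>s t. s \<in> {0..1} \<Longrightarrow> t \<in> {0..1} \<Longrightarrow> q (L s t) = h (s, t)" by metis
  have LX: "L s t \<in> topspace X" if "s \<in> {0..1}" "t \<in> {0..1}" for s t
    using L(1)[OF that(1)] that(2) by (auto simp: pathin_def continuous_map_def)
  have hnb: "\<exists>d>0. \<forall>s\<in>{0..1}. \<forall>t\<in>{0..1}. \<bar>s - s0\<bar> < d \<longrightarrow> \<bar>t - t0\<bar> < d \<longrightarrow> h (s, t) \<in> V"
    if V: "openin Y V" "s0 \<in> {0..1}" "t0 \<in> {0..1}" "h (s0, t0) \<in> V" for V s0 t0
  proof -
    have "openin (top_of_set ({0..1} \<times> {0..1})) {z \<in> {0..1} \<times> {0..1}. h z \<in> V}"
      using openin_continuous_map_preimage[OF h(1) that(1)] by simp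
    moreover have "(s0, t0) \<in> {z \<in> {0..1} \<times> {0..1}. h z \<in> V}" using V(2-4) by simp
    ultimately obtain d where d: "d > 0"
      "\<forall>z\<in>{0..1} \<times> {0..1}. dist z (s0, t0) < d \<longrightarrow> z \<in> {z \<in> {0..1} \<times> {0..1}. h z \<in> V}"
      unfolding openin_euclidean_subtopology_iff by meson
    have "h (s, t) \<in> V" if "s \<in> {0..1}" "t \<in> {0..1}" "\<bar>s - s0\<bar> < d / 2" "\<bar>t - t0\<bar> < d / 2" for s t
    proof -
      have "dist (s, t) (s0, t0) \<le> \<bar>s - s0\<bar> + \<bar>t - t0\<bar>"
        unfolding dist_prod_def by (simp add: dist_real_def sqrt_sum_squares_le_sum_abs)
      then have "dist (s, t) (s0, t0) < d" using that by linarith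
      then show ?thesis using d(2) that by blast
    qed
    then show ?thesis using d(1) by (intro exI[of _ "d/2"]) auto
  qed
  have loc: "\<exists>d>0. \<forall>s\<in>{0..1}. \<bar>s - s0\<bar> < d \<longrightarrow> L s 1 = L s0 1" if s0: "s0 \<in> {0..1}" for s0 :: real
  proof -
    \<comment> \<open>For \<open>s\<close> near \<open>s0\<close>, closeness of \<open>L s\<close>
      to \<open>L s0\<close> at time \<open>a\<close> enforces closeness at time \<open>b\<close>.
      In terms of neighbourhoods this composes over adjacent intervals.\<close>
    define Q where "Q a b \<longleftrightarrow> (0 \<le> a \<longrightarrow> b \<le> 1 \<longrightarrow> (\<forall>B. openin X B \<and> L s0 b \<in> B \<longrightarrow>
       (\<exists>A. openin X A \<and> L s0 a \<in> A \<and>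
         (\<exists>d>0. \<forall>s\<in>{0..1}. \<bar>s - s0\<bar> < d \<longrightarrow> L s a \<in> A \<longrightarrow> L s b \<in> B))))" for a b
    have "Q 0 1"
    proof (rule Bolzano[of 0 1 Q])
      fix a b c :: real assume ab: "Q a b" and bc: "Q b c" and le: "a \<le> b" "b \<le> c"
      show "Q a c"
        unfolding Q_def
      proof (intro impI allI)
        fix C assume ac: "0 \<le> a" "c \<le> 1" and C: "openin X C \<and> L s0 c \<in> C"
        then obtain B d where B: "openin X B" "L s0 b \<in> B" "d > 0"
          "\<forall>s\<in>{0..1}. \<bar>s - s0\<bar> < d \<longrightarrow> L s b \<in> B \<longrightarrow> L s c \<in> C"
          using bc le unfolding Q_def by (meson order_trans)
        then obtain A d' where A: "openin X A" "L s0 a \<in> A" "d' > 0"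
          "\<forall>s\<in>{0..1}. \<bar>s - s0\<bar> < d' \<longrightarrow> L s a \<in> A \<longrightarrow> L s b \<in> B"
          using ab le ac unfolding Q_def by (meson order_trans)
        have "\<forall>s\<in>{0..1}. \<bar>s - s0\<bar> < min d d' \<longrightarrow> L s a \<in> A \<longrightarrow> L s c \<in> C"
          using A B by auto
        then show "\<exists>A. openin X A \<and> L s0 a \<in> A \<and>
         (\<exists>d>0. \<forall>s\<in>{0..1}. \<bar>s - s0\<bar> < d \<longrightarrow> L s a \<in> A \<longrightarrow> L s c \<in> C)"
          using A B by (intro exI[of _ A] conjI exI[of _ "min d d'"]) auto
      qed
    next
      fix t0 :: real assume "0 \<le> t0" "t0 \<le> 1"
      then have t0: "t0 \<in> {0..1}" by auto
      obtain S where S: "slice S" "L s0 t0 \<in> S" using slice_exists LX s0 t0 by blast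
      have Sop: "openin X S" using S(1) by (simp add: slice_def)
      have "h (s0, t0) \<in> q ` S" using L(3)[OF s0 t0] S(2) by (metis image_eqI)
      then obtain d1 where d1: "d1 > 0"
        "\<And>s t. s \<in> {0..1} \<Longrightarrow> t \<in> {0..1} \<Longrightarrow> \<bar>s - s0\<bar> < d1 \<Longrightarrow> \<bar>t - t0\<bar> < d1 \<Longrightarrow> h (s, t) \<in> q ` S"
        using hnb[OF q_open[OF Sop] s0 t0] by blast
      obtain d2 where d2: "d2 > 0" "\<And>t. t \<in> {0..1} \<Longrightarrow> \<bar>t - t0\<bar> < d2 \<Longrightarrow> L s0 t \<in> S"
        using pathin_nbhd[OF L(1)[OF s0, unfolded pathin_def] Sop t0 S(2)] by blast
      have "Q a b" if hh: "a \<le> t0" "t0 \<le> b" "b - a < min d1 d2" for a b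
        unfolding Q_def
      proof (intro impI allI)
        fix B assume ab: "0 \<le> a" "b \<le> 1" and B: "openin X B \<and> L s0 b \<in> B"
        have ab': "a \<in> {0..1}" "b \<in> {0..1}" "a \<le> b" using ab hh t0 by auto
        have Lab: "L s0 a \<in> S" "L s0 b \<in> S"
          using d2(2)[OF ab'(1)] d2(2)[OF ab'(2)] hh by auto
        have "openin X (B \<inter> S)" using B Sop by auto
        moreover have "h (s0, b) \<in> q ` (B \<inter> S)" using L(3)[OF s0 ab'(2)] B Lab by (metis IntI image_eqI)
        ultimately obtain d3 where d3: "d3 > 0"
          "\<And>s t. s \<in> {0..1} \<Longrightarrow> t \<in> {0..1} \<Longrightarrow> \<bar>s - s0\<bar> < d3 \<Longrightarrow> \<bar>t - b\<bar> < d3 \<Longrightarrow> h (s, t) \<in> q ` (B \<inter> S)"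
          using hnb[OF q_open[of "B \<inter> S"] s0 ab'(2)] by auto
        have "L s b \<in> B" if s: "s \<in> {0..1}" "\<bar>s - s0\<bar> < min d1 d3" "L s a \<in> S" for s
        proof -
          have "q (L s t) \<in> q ` S" if "t \<in> {a..b}" for t
            using that s hh ab L(3)[OF s(1), of t] d1(2)[OF s(1), of t] by auto
          then have Lb: "L s b \<in> S"
            using lift_stays_in_slice[OF S(1) pathin_sub[OF L(1)[OF s(1)] ab], of a b] s(3) ab' by auto
          have "h (s, b) \<in> q ` (B \<inter> S)" using d3 s ab' by auto
          then obtain z where z: "z \<in> B" "z \<in> S" "q (L s b) = q z" using L(3)[OF s(1) ab'(2)] by auto
          then show ?thesis using slice_inj[OF S(1) Lb z(2,3)] by simp
        qed
        then show "\<exists>A. openin X A \<and> L s0 a \<in> A \<and>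
         (\<exists>d>0. \<forall>s\<in>{0..1}. \<bar>s - s0\<bar> < d \<longrightarrow> L s a \<in> A \<longrightarrow> L s b \<in> B)"
          using Sop Lab d1(1) d3(1) by (intro exI[of _ S] conjI exI[of _ "min d1 d3"]) auto
      qed
      then show "\<exists>d>0. \<forall>a b. a \<le> t0 \<and> t0 \<le> b \<and> b - a < d \<longrightarrow> Q a b"
        using d1(1) d2(1) by (intro exI[of _ "min d1 d2"]) auto
    qed auto
    moreover obtain S where S: "slice S" "L s0 1 \<in> S" using slice_exists LX[OF s0, of 1] by auto
    \<comment> \<open>All lifts start at \<open>l 0\<close>, so membership in \<open>A\<close> at
      time 0 is automatic, and \<open>L s 1\<close> lands in the slice around
      \<open>L s0 1\<close>.\<close>
    ultimately obtain A d where A: "L s0 0 \<in> A" "d > 0"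
      "\<forall>s\<in>{0..1}. \<bar>s - s0\<bar> < d \<longrightarrow> L s 0 \<in> A \<longrightarrow> L s 1 \<in> S"
      unfolding Q_def slice_def by auto
    have "L s 1 = L s0 1" if s: "s \<in> {0..1}" "\<bar>s - s0\<bar> < d" for s
    proof (rule slice_inj[OF S(1) _ S(2)])
      show "L s 1 \<in> S" using A(1) bspec[OF A(3) s(1)] s(2) L(2)[OF s(1)] L(2)[OF s0] by simp
      show "q (L s 1) = q (L s0 1)"
        using L(3)[OF s(1), of 1] L(3)[OF s0, of 1] bspec[OF h(4) s(1)] bspec[OF h(4) s0] by simp
    qed
    then show ?thesis using A(2) by blast
  qed
  define Q where "Q a b \<longleftrightarrow> (0 \<le> a \<longrightarrow> b \<le> 1 \<longrightarrow> L a 1 = L b 1)" for a b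
  have "Q 0 1"
  proof (rule Bolzano[of 0 1 Q])
    fix x :: real assume "0 \<le> x" "x \<le> 1"
    then have "x \<in> {0..1}" by simp
    from loc[OF this] obtain d
      where d: "d > 0" "\<And>s. s \<in> {0..1} \<Longrightarrow> \<bar>s - x\<bar> < d \<Longrightarrow> L s 1 = L x 1"
      by blast
    have "Q a b" if "a \<le> x" "x \<le> b" "b - a < d" for a b
      unfolding Q_def
    proof (intro impI)
      assume "0 \<le> a" "b \<le> 1"
      then have "L a 1 = L x 1" "L b 1 = L x 1" using that by (intro d(2); simp)+
      then show "L a 1 = L b 1" by simp
    qed
    then show "\<exists>d>0. \<forall>a b. a \<le> x \<and> x \<le> b \<and> b - a < d \<longrightarrow> Q a b" using d(1) by blast
  qed (auto simp: Q_def)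
  then have "L 0 1 = L 1 1" by (simp add: Q_def)
  moreover have "L 0 1 = l 1"
    by (rule lift_unique[OF L(1) l(1)]) (use L h q in auto)
  moreover have "L 1 1 = l' 1"
    by (rule lift_unique[OF L(1) l(2)]) (use L h q l(3) in auto)
  ultimately show ?thesis by simp
qed

text \<open>Monodromy at \<open>x\<close>, as a relation: existence and uniqueness of
  \<open>g\<close> are consequences of the lifting lemmas.\<close>

definition lifts_to :: "'a \<Rightarrow> (real \<Rightarrow> 'b) \<Rightarrow> 'g \<Rightarrow> bool" where
  "lifts_to x p g \<longleftrightarrow> g \<in> carrier G \<and>
     (\<exists>l. pathin X l \<and> l 0 = x \<and> l 1 = act x g \<and> (\<forall>t\<in>{0..1}. q (l t) = p t))"

lemma lifts_to_exists:
  assumes "x \<in> topspace X" "loop_at Y (q x) p"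
  shows "\<exists>g. lifts_to x p g"
proof -
  obtain l where l: "pathin X l" "l 0 = x" "\<forall>t\<in>{0..1}. q (l t) = p t"
    using lift_exists[of p x] assms by (auto simp: loop_at_def)
  have "l 1 \<in> topspace X" using l(1) by (auto simp: pathin_def continuous_map_def Pi_iff)
  moreover have "q x = q (l 1)" using l(3) assms by (auto simp: loop_at_def)
  ultimately show ?thesis using fibre assms(1) l unfolding lifts_to_def by metis
qed

lemma lifts_to_cong:
  assumes x: "x \<in> topspace X" and "path_hom Y p p'" "lifts_to x p g" "lifts_to x p' g'"
  shows "g = g'"
proof -
  obtain l l' where l: "pathin X l" "l 0 = x" "l 1 = act x g" "\<forall>t\<in>{0..1}. q (l t) = p t"
     "pathin X l'" "l' 0 = x" "l' 1 = act x g'" "\<forall>t\<in>{0..1}. q (l' t) = p' t"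
    using assms(3,4) unfolding lifts_to_def by blast
  have "l 1 = l' 1" by (rule lift_homotopic_endpoint[OF assms(2)]) (use l in auto)
  then show ?thesis using l act_inj x assms(3,4) unfolding lifts_to_def by metis
qed

text \<open>The second half of the lift has to start at \<open>act x g\<close>, so it is the lift of
  \<open>p'\<close> at \<open>x\<close> translated by \<open>g\<close>. This reverses the order of
  the factors.\<close>

lemma lifts_to_join:
  assumes x: "x \<in> topspace X" and "lifts_to x p g" "lifts_to x p' g'"
  shows "lifts_to x (loop_join p p') (g' \<otimes> g)"
proof -
  obtain l l' where l: "pathin X l" "l 0 = x" "l 1 = act x g" "\<forall>t\<in>{0..1}. q (l t) = p t"
     "pathin X l'" "l' 0 = x" "l' 1 = act x g'" "\<forall>t\<in>{0..1}. q (l' t) = p' t"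
    and g: "g \<in> carrier G" "g' \<in> carrier G"
    using assms(2,3) unfolding lifts_to_def by blast
  have l': "pathin X (\<lambda>t. act (l' t) g)"
    using continuous_map_compose[OF l(5)[unfolded pathin_def] act_cont[OF g(1)]]
    by (simp add: pathin_def o_def)
  have l'X: "l' t \<in> topspace X" if "t \<in> {0..1}" for t
    using l(5) that by (auto simp: pathin_def continuous_map_def Pi_iff)
  let ?l = "loop_join l (\<lambda>t. act (l' t) g)"
  have "pathin X ?l" using l l' by (intro pathin_loop_join) auto
  moreover have "?l 1 = act x (g' \<otimes> g)" using l g x by (simp add: act_mult)
  moreover have "q (?l t) = loop_join p p' t" if "t \<in> {0..1}" for t
    using that l(4) l(8) l'X q_act[OF _ g(1)] by (auto simp: loop_join_def)
  ultimately show ?thesis unfolding lifts_to_def using l(2) g by (intro conjI exI[of _ ?l]) auto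
qed

lemma lifts_to_path_hom:
  assumes sc: "simply_connected_top X" and "pathin Y p" "pathin Y p'" "lifts_to x p g" "lifts_to x p' g"
  shows "path_hom Y p p'"
proof -
  obtain l l' where l: "pathin X l" "l 0 = x" "l 1 = act x g" "\<forall>t\<in>{0..1}. q (l t) = p t"
     "pathin X l'" "l' 0 = x" "l' 1 = act x g" "\<forall>t\<in>{0..1}. q (l' t) = p' t"
    using assms(4,5) unfolding lifts_to_def by blast
  have "pathin X (loop_join l (\<lambda>t. l' (1 - t)))"
    using l by (intro pathin_loop_join pathin_reverse) auto
  then have "loop_null X (loop_join l (\<lambda>t. l' (1 - t)))"
    using sc l unfolding simply_connected_top_def by simp
  then have "path_hom X l l'" using l by (intro path_hom_of_null_loop) auto
  then have "path_hom Y (q \<circ> l) (q \<circ> l')"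
    unfolding path_hom_def
    by (rule homotopic_with_compose_continuous_map_left[OF _ q_cont]) (use l in auto)
  moreover have "path_hom Y p (q \<circ> l)" "path_hom Y p' (q \<circ> l')"
    using l assms(2,3) by (auto intro!: path_hom_eq)
  ultimately show ?thesis by (blast intro: path_hom_sym path_hom_trans)
qed

text \<open>Monodromy is injective because loops upstairs are null-homotopic, and surjective because
  a path from \<open>x\<close> to any of its translates projects to a loop.\<close>

theorem fundamental_group_quotient:
  assumes sc: "simply_connected_top X" and c: "c \<in> topspace Y"
  shows "fundamental_group Y c \<cong> G"
proof -
  obtain x where x: "x \<in> topspace X" "q x = c" using c q_surj by (metis imageE)
  have cls: "loop_class Y c p = {r. path_hom Y p r}" if "loop_at Y c p" for p
    using that by (auto simp: loop_class_def path_hom_def loop_at_def)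
  have cls_eq: "loop_class Y c r = loop_class Y c p" if "path_hom Y p r" "loop_at Y c p" for p r
  proof -
    have r: "loop_at Y c r" using path_homD[OF that(1)] that(2) by (auto simp: loop_at_def)
    show ?thesis unfolding cls[OF r] cls[OF that(2)]
      using that(1) by (auto intro: path_hom_trans path_hom_sym)
  qed
  have join_loop: "loop_at Y c (loop_join p r)" if "loop_at Y c p" "loop_at Y c r" for p r
    using that pathin_loop_join[of Y p r] by (auto simp: loop_at_def)
  \<comment> \<open>The lift of a product \<open>p p'\<close> ends at \<open>x\<close> moved by \<open>g' \<otimes> g\<close>; taking inverses restores the order.\<close>
  define \<phi> where "\<phi> A = inv (THE g. \<exists>p\<in>A. lifts_to x p g)" for A
  have phi: "\<phi> (loop_class Y c p) = inv g" if p: "loop_at Y c p" "lifts_to x p g" for p g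
  proof -
    have "(THE g. \<exists>p\<in>loop_class Y c p. lifts_to x p g) = g"
    proof (rule the_equality)
      have "p \<in> loop_class Y c p" using p by (simp add: cls loop_at_def path_hom_refl)
      then show "\<exists>p\<in>loop_class Y c p. lifts_to x p g" using p(2) by blast
      show "g' = g" if "\<exists>p\<in>loop_class Y c p. lifts_to x p g'" for g'
        using that p lifts_to_cong[OF x(1) _ p(2)] by (auto simp: cls)
    qed
    then show ?thesis by (simp add: \<phi>_def)
  qed
  have mult: "loop_class Y c p \<otimes>\<^bsub>fundamental_group Y c\<^esub> loop_class Y c r = loop_class Y c (loop_join p r)"
    if pr: "loop_at Y c p" "loop_at Y c r" for p r
  proof -
    have "loop_class Y c (loop_join p' r') = loop_class Y c (loop_join p r)"
      if "path_hom Y p p'" "path_hom Y r r'" for p' r'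
      using that pr by (intro cls_eq path_hom_join join_loop) (auto simp: loop_at_def)
    then have "(\<Union>p'\<in>loop_class Y c p. \<Union>r'\<in>loop_class Y c r. loop_class Y c (loop_join p' r'))
        = (\<Union>p'\<in>loop_class Y c p. \<Union>r'\<in>loop_class Y c r. loop_class Y c (loop_join p r))"
      unfolding cls[OF pr(1)] cls[OF pr(2)] by (intro SUP_cong refl) auto
    moreover have "p \<in> loop_class Y c p" "r \<in> loop_class Y c r"
      using pr by (auto simp: cls loop_at_def path_hom_refl)
    ultimately show ?thesis by (auto simp: fundamental_group_def)
  qed
  have carr: "carrier (fundamental_group Y c) = {loop_class Y c p | p. loop_at Y c p}"
    by (simp add: fundamental_group_def)
  have ex: "\<exists>g. lifts_to x p g" if "loop_at Y c p" for p
    using lifts_to_exists[OF x(1)] x(2) that by simp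
  have gc: "g \<in> carrier G" if "lifts_to x p g" for p g using that by (simp add: lifts_to_def)
  have "\<phi> \<in> hom (fundamental_group Y c) G"
  proof (rule homI)
    fix A assume "A \<in> carrier (fundamental_group Y c)"
    then obtain p where p: "loop_at Y c p" "A = loop_class Y c p" by (auto simp: carr)
    then show "\<phi> A \<in> carrier G" using ex[OF p(1)] phi[OF p(1)] gc by auto
  next
    fix A B assume "A \<in> carrier (fundamental_group Y c)" "B \<in> carrier (fundamental_group Y c)"
    then obtain p r where p: "loop_at Y c p" "A = loop_class Y c p" and r: "loop_at Y c r" "B = loop_class Y c r"
      by (auto simp: carr)
    obtain g where g: "lifts_to x p g" using ex[OF p(1)] by blast
    obtain h where h: "lifts_to x r h" using ex[OF r(1)] by blast
    have "\<phi> (A \<otimes>\<^bsub>fundamental_group Y c\<^esub> B) = inv (h \<otimes> g)"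
      unfolding p(2) r(2) mult[OF p(1) r(1)]
      by (rule phi[OF join_loop[OF p(1) r(1)] lifts_to_join[OF x(1) g h]])
    also have "\<dots> = \<phi> A \<otimes> \<phi> B"
      using p r g h phi gc[OF g] gc[OF h] by (simp add: inv_mult_group)
    finally show "\<phi> (A \<otimes>\<^bsub>fundamental_group Y c\<^esub> B) = \<phi> A \<otimes> \<phi> B" .
  qed
  moreover have "bij_betw \<phi> (carrier (fundamental_group Y c)) (carrier G)"
  proof (rule bij_betw_imageI)
    show "inj_on \<phi> (carrier (fundamental_group Y c))"
    proof (rule inj_onI)
      fix A B assume "A \<in> carrier (fundamental_group Y c)" "B \<in> carrier (fundamental_group Y c)"
        and eq: "\<phi> A = \<phi> B"
      then obtain p r where p: "loop_at Y c p" "A = loop_class Y c p" and r: "loop_at Y c r" "B = loop_class Y c r"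
        by (auto simp: carr)
      obtain g where g: "lifts_to x p g" using ex[OF p(1)] by blast
      obtain h where h: "lifts_to x r h" using ex[OF r(1)] by blast
      have "inv g = inv h" using eq p r phi g h by simp
      then have "g = h" using gc[OF g] gc[OF h] by (metis inv_inv)
      then have "path_hom Y p r"
        using p r g h by (intro lifts_to_path_hom[OF sc]) (auto simp: loop_at_def)
      then show "A = B" using cls_eq p r by metis
    qed
    show "\<phi> ` carrier (fundamental_group Y c) = carrier G"
    proof (intro equalityI subsetI)
      fix g assume "g \<in> \<phi> ` carrier (fundamental_group Y c)"
      then obtain p where p: "loop_at Y c p" "g = \<phi> (loop_class Y c p)" by (auto simp: carr)
      then show "g \<in> carrier G" using ex[OF p(1)] phi[OF p(1)] gc by auto
    next
      fix g assume g: "g \<in> carrier G"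
      then have "act x (inv g) \<in> topspace X" using x act_in by simp
      then obtain l where l: "pathin X l" "l 0 = x" "l 1 = act x (inv g)"
        using sc x unfolding simply_connected_top_def path_connected_space_def by metis
      have "pathin Y (q \<circ> l)"
        using l(1) q_cont unfolding pathin_def by (rule continuous_map_compose)
      then have lp: "loop_at Y c (q \<circ> l)" using l x g q_act by (simp add: loop_at_def)
      have "lifts_to x (q \<circ> l) (inv g)" using l g unfolding lifts_to_def by auto
      from phi[OF lp this] have "\<phi> (loop_class Y c (q \<circ> l)) = g" using g by simp
      then show "g \<in> \<phi> ` carrier (fundamental_group Y c)" using lp by (auto simp: carr)
    qed
  qed
  ultimately show ?thesis by (auto simp: is_iso_def iso_def)
qed

end

section \<open>Charts of Grassmannians\<close>

text \<open>Links the limit statements on independence, made for arbitrary filters, with openness in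
  an abstract topology.\<close>

lemma openin_by_atin:
  assumes "S \<subseteq> topspace T" "\<And>x. x \<in> S \<Longrightarrow> eventually (\<lambda>y. y \<in> S) (atin T x)"
  shows "openin T S"
proof (subst openin_subopen, intro ballI)
  fix x assume x: "x \<in> S"
  then have "x \<in> topspace T" using assms(1) by blast
  then obtain U where "openin T U" "x \<in> U" "\<forall>y\<in>U - {x}. y \<in> S"
    using assms(2)[OF x] unfolding eventually_atin by blast
  then show "\<exists>U. openin T U \<and> x \<in> U \<and> U \<subseteq> S" using x by blast
qed

lemma openin_indep_rows:
  assumes "finite R" "\<And>r c. r \<in> R \<Longrightarrow> c \<in> J \<Longrightarrow> continuous_map T euclidean (\<lambda>x. M x r c)"
  shows "openin T {x \<in> topspace T. indep_rows R J (M x)}"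
proof (rule openin_by_atin)
  fix x assume x: "x \<in> {x \<in> topspace T. indep_rows R J (M x)}"
  have "eventually (\<lambda>y. indep_rows R J (M y)) (atin T x)"
    using x assms by (intro indep_rows_eventually[where ?M0.0 = "M x"]) (auto simp: continuous_map_atin)
  moreover have "eventually (\<lambda>y. y \<in> topspace T) (atin T x)"
    using x by (auto simp: eventually_atin intro!: exI[of _ "topspace T"])
  ultimately show "eventually (\<lambda>y. y \<in> {x \<in> topspace T. indep_rows R J (M x)}) (atin T x)"
    by eventually_elim simp
qed auto

lemma continuous_map_indep_rows_solution:
  assumes "finite R" "\<And>r c. r \<in> R \<Longrightarrow> c \<in> J \<Longrightarrow> continuous_map T euclidean (\<lambda>x. M x r c)"
    "\<And>c. c \<in> J \<Longrightarrow> continuous_map T euclidean (\<lambda>x. b x c)"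
    "\<And>x. x \<in> topspace T \<Longrightarrow> indep_rows R J (M x)"
    "\<And>x c. x \<in> topspace T \<Longrightarrow> c \<in> J \<Longrightarrow> (\<Sum>r\<in>R. w x r * M x r c) = b x c" "r \<in> R"
  shows "continuous_map T euclidean (\<lambda>x. w x r)"
  unfolding continuous_map_atin limitin_canonical_iff
proof
  fix x assume x: "x \<in> topspace T"
  have top: "eventually (\<lambda>y. y \<in> topspace T) (atin T x)"
    using x by (auto simp: eventually_atin intro!: exI[of _ "topspace T"])
  show "((\<lambda>x. w x r) \<longlongrightarrow> w x r) (atin T x)"
  proof (rule indep_rows_solution_tendsto[where ?M0.0 = "M x" and M = M and b = b and ?b0.0 = "b x"])
    show "eventually (\<lambda>y. (\<Sum>r\<in>R. w y r * M y r c) = b y c) (atin T x)" if "c \<in> J" for c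
      using top by eventually_elim (use assms(5) that in auto)
  qed (use assms x in \<open>auto simp: continuous_map_atin\<close>)
qed

lemma continuous_map_vec_nth:
  assumes "continuous_map T euclidean (f :: 'a \<Rightarrow> complex^'n)"
  shows "continuous_map T euclidean (\<lambda>x. f x $ a)"
  using assms by (auto simp: continuous_map_atin intro: tendsto_vec_nth)

lemma continuous_map_vec_lambda:
  assumes "\<And>a. continuous_map T euclidean (\<lambda>x. f x a)"
  shows "continuous_map T euclidean (\<lambda>x. (\<chi> a. f x a) :: complex^'n)"
  using assms by (auto simp: continuous_map_atin intro!: vec_tendstoI)

lemma continuous_map_complex_mult:
  fixes f g :: "'a \<Rightarrow> complex"
  assumes "continuous_map T euclidean f" "continuous_map T euclidean g"
  shows "continuous_map T euclidean (\<lambda>x. f x * g x)"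
  using assms by (auto simp: continuous_map_atin intro!: tendsto_intros)

lemma continuous_map_vec_scale:
  assumes "continuous_map T euclidean f" "continuous_map T euclidean (v :: 'a \<Rightarrow> complex^'n)"
  shows "continuous_map T euclidean (\<lambda>x. f x *s v x)"
  unfolding vector_scalar_mult_def
  by (intro continuous_map_vec_lambda continuous_map_complex_mult assms continuous_map_vec_nth)

lemma continuous_map_matrix_vector:
  fixes g :: "complex^'n^'n"
  assumes "continuous_map T euclidean (v :: 'a \<Rightarrow> complex^'n)"
  shows "continuous_map T euclidean (\<lambda>x. g *v v x)"
  unfolding matrix_vector_mult_def
  by (intro continuous_map_vec_lambda continuous_map_sum continuous_map_complex_mult
      continuous_map_vec_nth assms) auto

text \<open>An arbitrary numbering of the index type, which gives a meaning to the first
  \<open>q\<close> coordinates.\<close>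

definition ix :: "nat \<Rightarrow> 'n::finite" where
  "ix = (SOME e. bij_betw e {..<CARD('n)} UNIV)"

lemma bij_ix: "bij_betw (ix :: nat \<Rightarrow> 'n::finite) {..<CARD('n)} UNIV"
proof -
  have "\<exists>e::nat \<Rightarrow> 'n. bij_betw e {..<CARD('n)} UNIV"
    using finite_same_card_bij[of "{..<CARD('n)}" "UNIV :: 'n set"] by simp
  then show ?thesis unfolding ix_def by (rule someI_ex)
qed

lemma ix_eq_iff:
  "r < CARD('n) \<Longrightarrow> s < CARD('n) \<Longrightarrow> (ix r :: 'n::finite) = ix s \<longleftrightarrow> r = s"
  using bij_ix[where 'n = 'n] by (auto simp: bij_betw_def inj_on_def)

lemma ix_surj: "\<exists>r<CARD('n). (a :: 'n::finite) = ix r"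
  using bij_ix[where 'n = 'n] unfolding bij_betw_def by (metis UNIV_I imageE lessThan_iff)

text \<open>The matrix \<open>g\<close> stands for a choice of linear coordinates. Its invertibility
  is demanded separately, where a dual basis is used.\<close>

definition coord :: "complex^'n^'n \<Rightarrow> nat \<Rightarrow> complex^'n \<Rightarrow> complex" where
  "coord g r x = (g *v x) $ ix r"

lemma coord_linear:
  "coord g r (x + y) = coord g r x + coord g r y" "coord g r (x - y) = coord g r x - coord g r y"
  "coord g r (c *s x) = c * coord g r x" "coord g r 0 = 0"
  by (simp_all add: coord_def matrix_vector_right_distrib matrix_vector_mult_diff_distrib vector_scalar_commute)

lemma coord_sum: "coord g r (sum f A) = (\<Sum>a\<in>A. coord g r (f a))"
  by (induction A rule: infinite_finite_induct) (simp_all add: coord_linear)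

lemma continuous_map_coord:
  "continuous_map T euclidean v \<Longrightarrow> continuous_map T euclidean (\<lambda>x. coord g r (v x))"
  unfolding coord_def by (intro continuous_map_vec_nth continuous_map_matrix_vector)

lemma combination_in_span: "(\<Sum>l<k. a l *s v l) \<in> vec.span (v ` {..<k})"
  for v :: "nat \<Rightarrow> complex^'n"
  by (intro vec.span_sum vec.span_scale vec.span_base imageI)

lemma span_image_lessThan:
  "vec.span (v ` {..<k}) = {\<Sum>l<k. a l *s v l | a. True}" for v :: "nat \<Rightarrow> complex^'n"
proof (intro equalityI subsetI)
  fix x assume "x \<in> vec.span (v ` {..<k})"
  then show "x \<in> {\<Sum>l<k. a l *s v l | a. True}"
  proof (induction rule: vec.span_induct_alt)
    case base
    show ?case by (rule CollectI, rule exI[of _ "\<lambda>_. 0"]) simp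
  next
    case (step c x y)
    then obtain l a where l: "l < k" "x = v l" and a: "y = (\<Sum>l<k. a l *s v l)" by auto
    have "(\<Sum>j<k. (a j + (if j = l then c else 0)) *s v j)
        = (\<Sum>j<k. a j *s v j + (if j = l then c *s v j else 0))"
      by (intro sum.cong) (auto simp: vec.scale_left_distrib)
    also have "\<dots> = c *s x + y" using l by (simp add: sum.distrib a)
    finally show ?case by (intro CollectI exI[of _ "\<lambda>j. a j + (if j = l then c else 0)"]) simp
  qed
next
  fix x assume "x \<in> {\<Sum>l<k. a l *s v l | a. True}"
  then show "x \<in> vec.span (v ` {..<k})"
    using combination_in_span by blast
qed

lemma coord_combination_vanishes_span:
  "(\<forall>x\<in>vec.span B. (\<Sum>r\<in>R. w r * coord g r x) = 0) \<longleftrightarrow> (\<forall>x\<in>B. (\<Sum>r\<in>R. w r * coord g r x) = 0)"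
proof -
  have "(\<Sum>r\<in>R. w r * coord g r x) = 0"
    if B: "\<And>x. x \<in> B \<Longrightarrow> (\<Sum>r\<in>R. w r * coord g r x) = 0" and "x \<in> vec.span B" for x
    using that(2)
  proof (induction rule: vec.span_induct_alt)
    case (step c x y)
    have "(\<Sum>r\<in>R. w r * coord g r (c *s x + y))
        = c * (\<Sum>r\<in>R. w r * coord g r x) + (\<Sum>r\<in>R. w r * coord g r y)"
      by (simp add: coord_linear sum.distrib sum_distrib_left algebra_simps)
    then show ?case using B step by simp
  qed (simp add: coord_linear)
  then show ?thesis using vec.span_base by metis
qed

lemma indep_rows_span:
  "indep_rows R (vec.span B) (coord g) \<longleftrightarrow> indep_rows R B (coord g)"
  unfolding indep_rows_def coord_combination_vanishes_span ..

text \<open>Passes from subspaces, all of whose vectors count as columns, to the finite matrix of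
  their frames.\<close>

lemma indep_rows_Union_span:
  "indep_rows R (\<Union>j\<in>J. vec.span ((\<lambda>l. v (j, l)) ` L)) (coord g)
     \<longleftrightarrow> indep_rows R (J \<times> L) (\<lambda>r c. coord g r (v c))"
proof -
  have "(\<forall>x\<in>\<Union>j\<in>J. vec.span ((\<lambda>l. v (j, l)) ` L). (\<Sum>r\<in>R. w r * coord g r x) = 0)
      \<longleftrightarrow> (\<forall>c\<in>J \<times> L. (\<Sum>r\<in>R. w r * coord g r (v c)) = 0)" for w
    by (simp only: ball_UN coord_combination_vanishes_span) auto
  then show ?thesis by (simp only: indep_rows_def)
qed

lemma indep_rows_image: "indep_rows R (f ` J) M \<longleftrightarrow> indep_rows R J (\<lambda>r c. M r (f c))"
  by (simp add: indep_rows_def)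

lemma indep_rows_dim_le:
  assumes "indep_rows R S (coord g)" "finite R"
  shows "card R \<le> vec.dim (S :: (complex^'n) set)"
proof -
  obtain B where B: "B \<subseteq> S" "vec.independent B" "S \<subseteq> vec.span B" "card B = vec.dim S"
    by (rule vec.basis_exists)
  have "finite B" using B(2) vec.independent_bound_general by blast
  have "indep_rows R B (coord g)"
    using indep_rows_mono_cols[OF assms(1) B(3)] by (simp add: indep_rows_span)
  then show ?thesis using indep_rows_card_le assms(2) \<open>finite B\<close> B(4) by metis
qed

section \<open>Frames, charts and generic coordinates on a single Grassmannian\<close>

lemma grassmannian_span:
  assumes "V \<in> (grassmannian k :: (complex^'n) set set)"
  shows "\<exists>v\<in>frames k. V = vec.span (v ` {..<k})"
proof -
  have "V \<in> topspace (grassmannian_topology k)" using assms by (simp add: topspace_grassmannian_topology)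
  then show ?thesis
    unfolding grassmannian_topology_def topspace_quotient_topology by auto
qed

lemma frames_restrict:
  assumes "vec.dim (vec.span (v ` {..<k}) :: (complex^'n) set) = k"
  shows "restrict v {..<k} \<in> frames k"
proof -
  have k: "vec.dim (v ` {..<k}) = k" using assms by (simp add: vec.dim_span)
  have "k \<le> card (v ` {..<k})"
    using vec.dim_le_card[of "v ` {..<k}" "v ` {..<k}"] k by (simp add: vec.span_superset)
  then have c: "card (v ` {..<k}) = card {..<k}" using card_image_le[of "{..<k}" v] by simp
  then have "inj_on v {..<k}" by (intro eq_card_imp_inj_on) auto
  moreover have "vec.independent (v ` {..<k})"
    using c k by (intro vec.card_le_dim_spanning[of _ "v ` {..<k}"]) (auto simp: vec.span_superset)
  moreover have "restrict v {..<k} ` {..<k} = v ` {..<k}" by auto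
  ultimately show ?thesis by (simp add: frames_def inj_on_def)
qed

abbreviation frame_topology :: "nat \<Rightarrow> (nat \<Rightarrow> complex^'n) topology" where
  "frame_topology k \<equiv> subtopology (product_topology (\<lambda>_. euclidean) {..<k}) (frames k)"

lemma quotient_map_frames:
  "quotient_map (frame_topology k) (grassmannian_topology k) (\<lambda>v. vec.span (v ` {..<k}) :: (complex^'n) set)"
  unfolding grassmannian_topology_def by (rule quotient_map_quotient_topology)

lemma continuous_map_span:
  fixes v :: "'a \<Rightarrow> nat \<Rightarrow> complex^'n"
  assumes "\<And>l. l < k \<Longrightarrow> continuous_map T euclidean (\<lambda>x. v x l)"
    "\<And>x. x \<in> topspace T \<Longrightarrow> vec.dim (vec.span (v x ` {..<k})) = k"
  shows "continuous_map T (grassmannian_topology k) (\<lambda>x. vec.span (v x ` {..<k}))"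
proof -
  have "continuous_map T (frame_topology k) (\<lambda>x. restrict (v x) {..<k})"
    using assms by (auto simp: continuous_map_in_subtopology continuous_map_componentwise frames_restrict)
  from continuous_map_compose[OF this quotient_imp_continuous_map[OF quotient_map_frames]]
  show ?thesis by (simp add: o_def)
qed

lemma frame_continuous: "l < k \<Longrightarrow> continuous_map (frame_topology k) euclidean (\<lambda>v. v l)"
  by (auto intro!: continuous_map_from_subtopology continuous_map_product_projection)

text \<open>The big cell of all subspaces on which the first \<open>k\<close> coordinates restrict
  to an isomorphism.\<close>

definition chart :: "complex^'n^'n \<Rightarrow> nat \<Rightarrow> (complex^'n) set set" where
  "chart g k = {V \<in> grassmannian k. indep_rows {..<k} V (coord g)}"

lemma openin_chart: "openin (grassmannian_topology k) (chart g k)" for g :: "complex^'n^'n"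
proof -
  let ?X = "frame_topology k :: (nat \<Rightarrow> complex^'n) topology"
  have 1: "openin ?X {v \<in> topspace ?X. indep_rows {..<k} {..<k} (\<lambda>r l. coord g r (v l))}"
    by (intro openin_indep_rows continuous_map_coord frame_continuous) auto
  have 2: "{v \<in> topspace ?X. indep_rows {..<k} {..<k} (\<lambda>r l. coord g r (v l))}
      = {v \<in> topspace ?X. vec.span (v ` {..<k}) \<in> chart g k}"
    using quotient_imp_surjective_map[OF quotient_map_frames, of k]
    by (auto simp: chart_def indep_rows_span indep_rows_image topspace_grassmannian_topology)
  have 3: "chart g k \<subseteq> topspace (grassmannian_topology k)"
    by (auto simp: chart_def topspace_grassmannian_topology)
  from quotient_map_frames[of k]
  have "\<forall>U\<subseteq>topspace (grassmannian_topology k).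
      openin ?X {v \<in> topspace ?X. vec.span (v ` {..<k}) \<in> U} = openin (grassmannian_topology k) U"
    unfolding quotient_map_def by (rule conjunct2)
  from spec[OF this, of "chart g k"] 3 1[unfolded 2] show ?thesis by blast
qed

text \<open>Column \<open>l\<close> of the matrix of \<open>V\<close> with identity upper block. The
  definite description makes it depend on \<open>V\<close> alone and not on a frame.\<close>

definition nframe :: "complex^'n^'n \<Rightarrow> nat \<Rightarrow> (complex^'n) set \<Rightarrow> nat \<Rightarrow> complex^'n" where
  "nframe g k V l = (THE u. u \<in> V \<and> (\<forall>r<k. coord g r u = (if r = l then 1 else 0)))"

lemma nframe_exists_unique:
  assumes "vec.span (v ` {..<k}) \<in> chart g k"
  shows "\<exists>a. (\<forall>r<k. (\<Sum>j<k. a j * coord g r (v j)) = (if r = l then 1 else 0))"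
    and "x \<in> vec.span (v ` {..<k}) \<Longrightarrow> y \<in> vec.span (v ` {..<k}) \<Longrightarrow>
      \<forall>r<k. coord g r x = coord g r y \<Longrightarrow> x = y"
    and "indep_rows {..<k} {..<k} (\<lambda>j r. coord g r (v j))"
proof -
  have i: "indep_rows {..<k} {..<k} (\<lambda>r l. coord g r (v l))"
    using assms by (simp add: chart_def indep_rows_span indep_rows_image)
  then show t: "indep_rows {..<k} {..<k} (\<lambda>j r. coord g r (v j))"
    by (rule indep_rows_transpose) auto
  show "\<exists>a. (\<forall>r<k. (\<Sum>j<k. a j * coord g r (v j)) = (if r = l then 1 else 0))"
    using indep_rows_solvable[OF _ i, of "\<lambda>r. if r = l then 1 else 0"] by (simp add: Ball_def)
  assume "x \<in> vec.span (v ` {..<k})" "y \<in> vec.span (v ` {..<k})" "\<forall>r<k. coord g r x = coord g r y"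
  then have d: "x - y \<in> vec.span (v ` {..<k})" "\<forall>r<k. coord g r (x - y) = 0"
    by (auto simp: vec.span_diff coord_linear)
  then obtain a where a: "x - y = (\<Sum>l<k. a l *s v l)" by (auto simp: span_image_lessThan)
  then have "a l = 0" if "l < k" for l
    using indep_rowsD[OF t, of a l] d(2) that by (simp add: coord_sum coord_linear)
  then show "x = y" using a by simp
qed

lemma nframe:
  assumes "V \<in> chart g k"
  shows "nframe g k V l \<in> V" "r < k \<Longrightarrow> coord g r (nframe g k V l) = (if r = l then 1 else 0)"
    and "x \<in> V \<Longrightarrow> y \<in> V \<Longrightarrow> (\<And>r. r < k \<Longrightarrow> coord g r x = coord g r y) \<Longrightarrow> x = y"
proof -
  obtain v where v: "V = vec.span (v ` {..<k})"
    using assms grassmannian_span by (auto simp: chart_def)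
  have ch: "vec.span (v ` {..<k}) \<in> chart g k" using assms v by simp
  show u: "x \<in> V \<Longrightarrow> y \<in> V \<Longrightarrow> (\<And>r. r < k \<Longrightarrow> coord g r x = coord g r y) \<Longrightarrow> x = y" for x y
    using nframe_exists_unique(2)[OF ch] v by blast
  obtain a where a: "\<forall>r<k. (\<Sum>j<k. a j * coord g r (v j)) = (if r = l then 1 else 0)"
    using nframe_exists_unique(1)[OF ch] by blast
  let ?u = "\<Sum>j<k. a j *s v j"
  have "?u \<in> V \<and> (\<forall>r<k. coord g r ?u = (if r = l then 1 else 0))"
    using a v combination_in_span[of a v k] by (simp add: coord_sum coord_linear)
  note P = this
  have "nframe g k V l \<in> V \<and> (\<forall>r<k. coord g r (nframe g k V l) = (if r = l then 1 else 0))"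
    unfolding nframe_def
  proof (rule theI[where P = "\<lambda>u. u \<in> V \<and> (\<forall>r<k. coord g r u = (if r = l then 1 else 0))", OF P])
    fix x assume "x \<in> V \<and> (\<forall>r<k. coord g r x = (if r = l then 1 else 0))"
    then show "x = ?u" using P by (intro u) auto
  qed
  then show "nframe g k V l \<in> V" "r < k \<Longrightarrow> coord g r (nframe g k V l) = (if r = l then 1 else 0)"
    by auto
qed

lemma span_nframe:
  assumes "V \<in> chart g k"
  shows "vec.span (nframe g k V ` {..<k}) = V"
proof
  have sub: "vec.subspace V" using assms by (simp add: chart_def grassmannian_def)
  show "vec.span (nframe g k V ` {..<k}) \<subseteq> V"
    using nframe(1)[OF assms] sub by (intro vec.span_minimal) auto
  show "V \<subseteq> vec.span (nframe g k V ` {..<k})"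
  proof
    fix x assume x: "x \<in> V"
    let ?y = "\<Sum>l<k. coord g l x *s nframe g k V l"
    have "?y \<in> V" using nframe(1)[OF assms] sub by (intro vec.subspace_sum vec.subspace_scale) auto
    moreover have "coord g r ?y = coord g r x" if "r < k" for r
    proof -
      have "coord g r ?y = (\<Sum>l<k. coord g l x * (if r = l then 1 else 0))"
        using that by (simp add: coord_sum coord_linear nframe(2)[OF assms])
      also have "\<dots> = (\<Sum>l<k. if l = r then coord g l x else 0)" by (intro sum.cong) auto
      finally show ?thesis using that by simp
    qed
    ultimately have "?y = x" using x by (intro nframe(3)[OF assms]) auto
    moreover have "?y \<in> vec.span (nframe g k V ` {..<k})" by (rule combination_in_span)
    ultimately show "x \<in> vec.span (nframe g k V ` {..<k})" by simp
  qed
qed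

text \<open>Continuity is tested on frames, as a quotient map restricted to the preimage of an open
  set is again one. There the normalised vector is a combination of the frame vectors with
  coefficients from a square linear system.\<close>

lemma continuous_map_nframe:
  "continuous_map (subtopology (grassmannian_topology k) (chart g k)) euclidean (\<lambda>V. nframe g k V l)"
proof -
  let ?sp = "\<lambda>v. vec.span (v ` {..<k}) :: (complex^'n) set"
  let ?U = "{v \<in> topspace (frame_topology k). ?sp v \<in> chart g k}"
  let ?T = "subtopology (frame_topology k) ?U"
  have qm: "quotient_map ?T (subtopology (grassmannian_topology k) (chart g k)) ?sp"
    by (rule quotient_map_restriction[OF quotient_map_frames refl]) (use openin_chart in blast)
  have UT: "v \<in> ?U" if "v \<in> topspace ?T" for v using that by auto
  \<comment> \<open>Any choice of a solution will do: its entries below \<open>k\<close> are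
    determined on the chart and hence continuous.\<close>
  define a where "a v = (SOME a. \<forall>r<k. (\<Sum>j<k. a j * coord g r (v j)) = (if r = l then 1 else 0))" for v
  have a: "(\<Sum>j<k. a v j * coord g r (v j)) = (if r = l then 1 else 0)" if "v \<in> ?U" "r < k" for v r
  proof -
    have "?sp v \<in> chart g k" using that(1) by simp
    from someI_ex[OF nframe_exists_unique(1)[OF this, of l]] that(2) show ?thesis
      unfolding a_def by simp
  qed
  have vcont: "continuous_map ?T euclidean (\<lambda>v. v j)" if "j < k" for j
    using frame_continuous[OF that] by (rule continuous_map_from_subtopology)
  have "continuous_map ?T euclidean (\<lambda>v. a v j)" if "j < k" for j
  proof (rule continuous_map_indep_rows_solution[where R = "{..<k}" and J = "{..<k}" and M = "\<lambda>v j r. coord g r (v j)"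
        and b = "\<lambda>v r. if r = l then 1 else 0"])
    show "indep_rows {..<k} {..<k} (\<lambda>j r. coord g r (v j))" if "v \<in> topspace ?T" for v
      using UT[OF that] nframe_exists_unique(3) by blast
    show "(\<Sum>j<k. a v j * coord g r (v j)) = (if r = l then 1 else 0)"
      if "v \<in> topspace ?T" "r \<in> {..<k}" for v r using a[OF UT[OF that(1)]] that(2) by simp
  qed (use that vcont in \<open>auto intro!: continuous_map_coord\<close>)
  then have c: "continuous_map ?T euclidean (\<lambda>v. \<Sum>j<k. a v j *s v j)"
    using vcont by (intro continuous_map_sum continuous_map_vec_scale) auto
  have eq: "(\<Sum>j<k. a v j *s v j) = nframe g k (?sp v) l" if "v \<in> topspace ?T" for v
  proof -
    have ch: "?sp v \<in> chart g k" using UT[OF that] by simp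
    show ?thesis
    proof (rule nframe(3)[OF ch _ nframe(1)[OF ch]])
      show "coord g r (\<Sum>j<k. a v j *s v j) = coord g r (nframe g k (?sp v) l)" if "r < k" for r
        using a[OF UT[OF \<open>v \<in> topspace ?T\<close>] that] nframe(2)[OF ch that]
        by (simp add: coord_sum coord_linear)
    qed (rule combination_in_span)
  qed
  have "continuous_map ?T euclidean ((\<lambda>V. nframe g k V l) \<circ> ?sp)"
    using continuous_map_eq[OF c, of "(\<lambda>V. nframe g k V l) \<circ> ?sp"] eq by simp
  then show ?thesis by (rule continuous_compose_quotient_map[OF qm])
qed

definition matrix_line :: "complex^'n^'n \<Rightarrow> complex^'n^'n \<Rightarrow> complex \<Rightarrow> complex^'n^'n" where
  "matrix_line g g' t = (\<chi> a b. g$a$b + t * (g'$a$b - g$a$b))"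

lemma coord_matrix_line:
  "coord (matrix_line g g' t) r x = coord g r x + t * (coord g' r x - coord g r x)"
proof -
  have "coord (matrix_line g g' t) r x
      = (\<Sum>j\<in>UNIV. g$ix r$j * x$j + t * (g'$ix r$j * x$j - g$ix r$j * x$j))"
    by (simp add: coord_def matrix_vector_mult_def matrix_line_def algebra_simps)
  then show ?thesis
    by (simp add: coord_def matrix_vector_mult_def sum.distrib sum_subtractf flip: sum_distrib_left)
qed

text \<open>Some linear map sends \<open>q\<close> independent vectors of \<open>S\<close> to the
  first \<open>q\<close> unit vectors.\<close>

lemma indep_rows_matrix_exists:
  assumes "q \<le> vec.dim (S :: (complex^'n) set)"
  shows "\<exists>g. indep_rows {..<q} S (coord g)"
proof -
  obtain B where B: "B \<subseteq> S" "vec.independent B" "S \<subseteq> vec.span B" "card B = vec.dim S"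
    by (rule vec.basis_exists)
  then obtain B' where B': "B' \<subseteq> B" "card B' = q" "finite B'"
    using obtain_subset_with_card_n[of q B] assms by metis
  have qn: "q \<le> CARD('n)" using assms vec.dim_subset[of S UNIV] vec_dim_card[where 'n = 'n and 'a = complex] by simp
  have indB: "vec.independent B'" using B(2) B'(1) vec.independent_mono by blast
  obtain f where f: "bij_betw f {..<q} B'"
    using B' by (metis bij_betw_from_nat_into_finite)
  have "\<exists>g. Vector_Spaces.linear (*s) (*s) g \<and> (\<forall>x\<in>B'. g x = axis (ix (inv_into {..<q} f x)) (1::complex))"
    by (rule vec.linear_independent_extend[OF indB])
  then obtain G :: "complex^'n \<Rightarrow> complex^'n" where G: "Vector_Spaces.linear (*s) (*s) G"
    "\<And>x. x \<in> B' \<Longrightarrow> G x = axis (ix (inv_into {..<q} f x)) 1" by blast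
  have c: "coord (matrix G) r (f s) = (if r = s then 1 else 0)" if "r < q" "s < q" for r s
  proof -
    have "f s \<in> B'" using f that by (auto simp: bij_betw_def)
    moreover have "inv_into {..<q} f (f s) = s" using f that by (auto simp: bij_betw_def)
    ultimately show ?thesis using that qn G(2)[of "f s"] ix_eq_iff[where 'n = 'n, of r s]
      by (simp add: coord_def matrix_works[OF G(1)] axis_def)
  qed
  have "indep_rows {..<q} S (coord (matrix G))"
    unfolding indep_rows_def
  proof (intro allI impI ballI)
    fix w r assume w: "\<forall>c\<in>S. (\<Sum>r<q. w r * coord (matrix G) r c) = 0" and r: "r \<in> {..<q}"
    have "f r \<in> S" using f r B' B(1) by (auto simp: bij_betw_def)
    then have "(\<Sum>s<q. w s * coord (matrix G) s (f r)) = 0" using w by blast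
    moreover have "(\<Sum>s<q. w s * coord (matrix G) s (f r)) = (\<Sum>s<q. if s = r then w s else 0)"
      using c r by (intro sum.cong) auto
    ultimately show "w r = 0" using r by simp
  qed
  then show ?thesis by blast
qed

text \<open>Let \<open>z\<close> serve the indices treated so far and \<open>z'\<close> the new one.
  On the line through them each condition fails finitely often, so some parameter serves all. Only
  affine dependence on the parameter is used, which covers both changes of coordinates and choices
  of replacement rows.\<close>

lemma indep_rows_simultaneous:
  fixes line :: "'z \<Rightarrow> 'z \<Rightarrow> complex \<Rightarrow> 'z" and N :: "'i \<Rightarrow> 'z \<Rightarrow> 'r \<Rightarrow> 'c \<Rightarrow> complex"
  assumes "finite I" "\<And>i. i \<in> I \<Longrightarrow> \<exists>z. indep_rows (R i) (J i) (N i z)" "\<And>i. i \<in> I \<Longrightarrow> finite (R i)"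
    and line: "\<And>i z z' t r c. N i (line z z' t) r c = N i z r c + t * (N i z' r c - N i z r c)"
  shows "\<exists>z. \<forall>i\<in>I. indep_rows (R i) (J i) (N i z)"
  using assms(1-3)
proof (induction I rule: finite_induct)
  case (insert i I)
  obtain z where z: "\<And>i. i \<in> I \<Longrightarrow> indep_rows (R i) (J i) (N i z)" using insert by auto
  obtain z' where z': "indep_rows (R i) (J i) (N i z')" using insert.prems by blast
  have fin: "finite {t. \<not> indep_rows (R j) (J j) (N j (line z z' t))}"
    if "indep_rows (R j) (J j) (N j (line z z' a))" "j \<in> insert i I" for j a
    using insert.prems(2)[OF that(2)] that(1) by (rule indep_rows_polyfun) (auto simp: line)
  have 0: "N j (line z z' 0) = N j z" "N j (line z z' 1) = N j z'" for j
    by (simp_all add: fun_eq_iff line)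
  have "finite (\<Union>j\<in>insert i I. {t. \<not> indep_rows (R j) (J j) (N j (line z z' t))})"
  proof (rule finite_UN_I)
    fix j assume j: "j \<in> insert i I"
    show "finite {t. \<not> indep_rows (R j) (J j) (N j (line z z' t))}"
    proof (cases "j = i")
      case True
      then show ?thesis using fin[OF _ j, of 1] z' by (simp add: 0)
    next
      case False
      then show ?thesis using fin[OF _ j, of 0] z j by (simp add: 0)
    qed
  qed (use insert in auto)
  then obtain t where "t \<notin> (\<Union>j\<in>insert i I. {t. \<not> indep_rows (R j) (J j) (N j (line z z' t))})"
    using ex_new_if_finite infinite_UNIV_char_0 by blast
  then show ?case by blast
qed simp

lemma indep_rows_matrix_simultaneous:
  assumes "finite I" "\<And>i. i \<in> I \<Longrightarrow> q i \<le> vec.dim (S i :: (complex^'n) set)"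
  shows "\<exists>g. \<forall>i\<in>I. indep_rows {..<q i} (S i) (coord g)"
  using assms indep_rows_matrix_exists
  by (intro indep_rows_simultaneous[where line = matrix_line]) (auto simp: coord_matrix_line)

text \<open>Two subspaces lie in a common chart, where some vector of the normalised frame, a
  continuous function, distinguishes them.\<close>

lemma Hausdorff_grassmannian: "Hausdorff_space (grassmannian_topology k :: (complex^'n) set topology)"
  unfolding Hausdorff_space_def topspace_grassmannian_topology
proof (intro allI impI, elim conjE)
  fix V W :: "(complex^'n) set" assume V: "V \<in> grassmannian k" and W: "W \<in> grassmannian k" and ne: "V \<noteq> W"
  have "\<exists>g. \<forall>S\<in>{V, W}. indep_rows {..<k} S (coord g)"
    using V W by (intro indep_rows_matrix_simultaneous) (auto simp: grassmannian_def)
  then obtain g where "V \<in> chart g k" "W \<in> chart g k" using V W by (auto simp: chart_def)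
  note ch = this
  then obtain l where "l < k" "nframe g k V l \<noteq> nframe g k W l"
    using span_nframe ne by (metis image_cong lessThan_iff)
  then obtain A B where AB: "open A" "open B" "nframe g k V l \<in> A" "nframe g k W l \<in> B" "A \<inter> B = {}"
    using hausdorff by metis
  let ?P = "\<lambda>A. {V \<in> chart g k. nframe g k V l \<in> A}"
  have op: "openin (grassmannian_topology k) (?P A)" if "open A" for A
  proof -
    have "openin (subtopology (grassmannian_topology k) (chart g k))
       {V \<in> topspace (subtopology (grassmannian_topology k) (chart g k)). nframe g k V l \<in> A}"
      using openin_continuous_map_preimage[OF continuous_map_nframe] that by auto
    moreover have "topspace (subtopology (grassmannian_topology k) (chart g k)) = chart g k"
      by (auto simp: topspace_grassmannian_topology chart_def)
    ultimately show ?thesis using openin_chart openin_trans_full by fastforce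
  qed
  show "\<exists>U Va. openin (grassmannian_topology k) U \<and> openin (grassmannian_topology k) Va \<and>
     V \<in> U \<and> W \<in> Va \<and> disjnt U Va"
    using op AB ch by (intro exI[of _ "?P A"] exI[of _ "?P B"]) (auto simp: disjnt_def)
qed

section \<open>Configurations in matrix form\<close>

lemma path_avoiding_finite:
  assumes "finite {t::complex. \<not> P t}" "P 0" "P 1"
  shows "\<exists>\<gamma>. path \<gamma> \<and> \<gamma> 0 = 0 \<and> \<gamma> 1 = 1 \<and> (\<forall>t\<in>{0..1}. P (\<gamma> t))"
proof -
  have "path_connected (- {t::complex. \<not> P t})"
    using assms(1) by (intro path_connected_complement_countable) (auto intro: countable_finite)
  then obtain g where "path g" "path_image g \<subseteq> - {t. \<not> P t}" "pathstart g = 0" "pathfinish g = 1"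
    using assms(2,3) unfolding path_connected_def by fastforce
  then show ?thesis by (intro exI[of _ g]) (auto simp: path_image_def pathstart_def pathfinish_def)
qed

text \<open>All rows annihilate some \<open>v\<close> with \<open>v c\<close> nonzero. The unit row
  at \<open>c\<close> does not, so it lies outside their span.\<close>

lemma indep_rows_extend:
  assumes "indep_rows R J M" "finite R" "finite J" "card R < card J" "q \<notin> R"
  shows "\<exists>z. indep_rows (insert q R) J (M(q := z))"
proof -
  obtain v c where v: "\<And>r. r \<in> R \<Longrightarrow> (\<Sum>c\<in>J. v c * M r c) = 0" and c: "c \<in> J" "v c \<noteq> 0"
    using underdetermined_kernel[OF assms(2-4), of M] by blast
  define z where "z d = (if d = c then 1 else 0 :: complex)" for d
  have "indep_rows (insert q R) J (M(q := z))"
    unfolding indep_rows_def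
  proof (intro allI impI)
    fix w assume w: "\<forall>d\<in>J. (\<Sum>r\<in>insert q R. w r * (M(q := z)) r d) = 0"
    have s: "(\<Sum>r\<in>insert q R. w r * (M(q := z)) r d) = w q * z d + (\<Sum>r\<in>R. w r * M r d)" for d
      using assms(2,5) by (subst sum.insert) (auto intro!: sum.cong)
    have "0 = (\<Sum>d\<in>J. v d * (w q * z d + (\<Sum>r\<in>R. w r * M r d)))" using w s by simp
    also have "\<dots> = w q * (\<Sum>d\<in>J. v d * z d) + (\<Sum>d\<in>J. \<Sum>r\<in>R. w r * (v d * M r d))"
      by (simp add: algebra_simps sum.distrib sum_distrib_left)
    also have "(\<Sum>d\<in>J. \<Sum>r\<in>R. w r * (v d * M r d)) = (\<Sum>r\<in>R. w r * (\<Sum>d\<in>J. v d * M r d))"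
      by (subst sum.swap) (simp add: sum_distrib_left)
    also have "\<dots> = 0" using v by simp
    also have "(\<Sum>d\<in>J. v d * z d) = (\<Sum>d\<in>J. if d = c then v d else 0)"
      by (intro sum.cong) (auto simp: z_def)
    finally have q: "w q = 0" using c assms(3) by simp
    then have "\<forall>d\<in>J. (\<Sum>r\<in>R. w r * M r d) = 0" using w s by simp
    then show "\<forall>r\<in>insert q R. w r = 0" using q assms(1) by (auto simp: indep_rows_def)
  qed
  then show ?thesis by blast
qed

text \<open>Rows \<open>0, \<dots>, r\<close> of \<open>M\<close> followed by rows \<open>r, r + 1, \<dots>\<close> of \<open>z\<close>. Both versions of row \<open>r\<close> occur, so
  that independence makes every convex combination of them admissible.\<close>

definition mixed_rows :: "nat \<Rightarrow> (nat \<Rightarrow> 'c \<Rightarrow> complex) \<Rightarrow> (nat \<Rightarrow> 'c \<Rightarrow> complex) \<Rightarrow> nat \<Rightarrow> 'c \<Rightarrow> complex" where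
  "mixed_rows r M z = (\<lambda>x. if x \<le> r then M x else z (x - 1))"

lemma mixed_rows_exists:
  assumes "indep_rows {..<Suc r} J M" "finite J" "r < q" "q < card J"
  shows "\<exists>z. indep_rows {..<Suc q} J (mixed_rows r M z)"
proof -
  have "\<exists>N. (\<forall>x\<le>r. N x = M x) \<and> indep_rows {..<Suc (r + d)} J N" if "r + d \<le> q" for d
    using that
  proof (induction d)
    case 0
    then show ?case using assms(1) by auto
  next
    case (Suc d)
    then obtain N where N: "\<forall>x\<le>r. N x = M x" "indep_rows {..<Suc (r + d)} J N" by auto
    have "\<exists>z. indep_rows (insert (Suc (r + d)) {..<Suc (r + d)}) J (N(Suc (r + d) := z))"
      using assms Suc.prems by (intro indep_rows_extend N(2)) auto
    then obtain z where z: "indep_rows {..<Suc (r + Suc d)} J (N(Suc (r + d) := z))"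
      by (auto simp: lessThan_Suc)
    moreover have "\<forall>x\<le>r. (N(Suc (r + d) := z)) x = M x" using N(1) by simp
    ultimately show ?case by blast
  qed
  from this[of "q - r"] assms(3)
  obtain N where N: "\<forall>x\<le>r. N x = M x" "indep_rows {..<Suc q} J N" by auto
  \<comment> \<open>Shift by one: behind position \<open>r\<close>, position \<open>x\<close> of
    \<open>mixed_rows\<close> shows row \<open>x - 1\<close> of its second argument.\<close>
  then have "mixed_rows r M (\<lambda>x. N (Suc x)) = N" by (auto simp: mixed_rows_def fun_eq_iff)
  then show ?thesis using N(2) by metis
qed

text \<open>A relation \<open>w\<close> between the rows of \<open>N\<close> becomes one between the
  mixed rows when the coefficient of row \<open>r\<close> is split into \<open>(1 - s) * w r\<close>
  and \<open>s * w r\<close>. Both parts vanish, and they add up to \<open>w r\<close>.\<close>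

lemma indep_rows_interpolate:
  assumes ind: "indep_rows {..<Suc q} J (mixed_rows r M z)" and "r < q"
    and N: "\<And>x c. x < q \<Longrightarrow> N x c =
      (if x < r then M x c else if x = r then (1 - s) * M r c + s * z r c else z x c)"
  shows "indep_rows {..<q} J N"
  unfolding indep_rows_def
proof (intro allI impI ballI)
  fix w x assume w: "\<forall>c\<in>J. (\<Sum>r<q. w r * N r c) = 0" and x: "x \<in> {..<q}"
  \<comment> \<open>The omitted position \<open>Suc r\<close> is the one that holds row
    \<open>r\<close> of \<open>z\<close>.\<close>
  define skip where "skip x = (if x \<le> r then x else Suc x)" for x
  define v where "v x = (if x < r then w x else if x = r then (1 - s) * w r
      else if x = Suc r then s * w r else w (x - 1))" for x
  have inj: "inj_on skip {..<q}" by (auto simp: inj_on_def skip_def split: if_splits)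
  have set: "{..<Suc q} = insert (Suc r) (skip ` {..<q})"
  proof (intro equalityI subsetI)
    fix y assume y: "y \<in> {..<Suc q}"
    show "y \<in> insert (Suc r) (skip ` {..<q})"
    proof (cases "y = Suc r")
      case False
      then have "skip (if y \<le> r then y else y - 1) = y" "(if y \<le> r then y else y - 1) < q"
        using y \<open>r < q\<close> by (auto simp: skip_def)
      then show ?thesis by (metis imageI insertI2 lessThan_iff)
    qed simp
  qed (use \<open>r < q\<close> in \<open>auto simp: skip_def split: if_splits\<close>)
  have nin: "Suc r \<notin> skip ` {..<q}" by (auto simp: skip_def split: if_splits)
  have "(\<Sum>y<Suc q. v y * mixed_rows r M z y c) = 0" if c: "c \<in> J" for c
  proof -
    have "(\<Sum>y<Suc q. v y * mixed_rows r M z y c)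
        = v (Suc r) * mixed_rows r M z (Suc r) c + (\<Sum>x<q. v (skip x) * mixed_rows r M z (skip x) c)"
      unfolding set using nin by (simp add: sum.reindex[OF inj])
    also have "\<dots> = (\<Sum>x<q. (if x = r then s * w r * z r c else 0) + v (skip x) * mixed_rows r M z (skip x) c)"
      using \<open>r < q\<close> by (simp add: sum.distrib v_def mixed_rows_def)
    also have "\<dots> = (\<Sum>x<q. w x * N x c)"
      by (intro sum.cong) (auto simp: N v_def skip_def mixed_rows_def algebra_simps)
    finally show ?thesis using w c by simp
  qed
  then have v0: "v y = 0" if "y < Suc q" for y using indep_rowsD[OF ind] that by blast
  show "w x = 0"
  proof (cases "x = r")
    case True
    have "(1 - s) * w r = 0" "s * w r = 0" using v0[of r] v0[of "Suc r"] \<open>r < q\<close> by (auto simp: v_def)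
    then show ?thesis using True by (auto simp: algebra_simps)
  next
    case False
    have "skip x < Suc q" using x by (auto simp: skip_def)
    then have "v (skip x) = 0" by (rule v0)
    moreover have "v (skip x) = w x" using False by (cases "x < r") (auto simp: v_def skip_def)
    ultimately show ?thesis by simp
  qed
qed

text \<open>Frames of configurations in C^i with identity upper blocks; column \<open>(j, l)\<close>
  is vector \<open>l\<close> of block \<open>j\<close>. As the first \<open>k\<close> rows agree in
  all blocks, the condition on a pair says that the two blocks differ in row
  \<open>k\<close>.\<close>

definition conf_matrices :: "nat \<Rightarrow> nat \<Rightarrow> nat \<Rightarrow> (nat \<Rightarrow> nat \<times> nat \<Rightarrow> complex) set" where
  "conf_matrices h i k = {M. (\<forall>r<k. \<forall>j l. M r (j, l) = (if l = r then 1 else 0)) \<and>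
     indep_rows {..<i} ({1..h} \<times> {..<k}) M \<and>
     (\<forall>j\<in>{1..h}. \<forall>j'\<in>{1..h}. j \<noteq> j' \<longrightarrow> indep_rows {..<Suc k} ({j, j'} \<times> {..<k}) M)}"

lemma conf_matricesD:
  assumes "M \<in> conf_matrices h i k"
  shows "r < k \<Longrightarrow> M r (j, l) = (if l = r then 1 else 0)"
    "indep_rows {..<i} ({1..h} \<times> {..<k}) M"
    "j \<in> {1..h} \<Longrightarrow> j' \<in> {1..h} \<Longrightarrow> j \<noteq> j' \<Longrightarrow> indep_rows {..<Suc k} ({j, j'} \<times> {..<k}) M"
  using assms unfolding conf_matrices_def by blast+

text \<open>The rows of \<open>z\<close> are the constant ones to which a loop will be deformed.
  Beyond the identity block a pair condition sees row \<open>k\<close> only, so it concerns only the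
  stage at which this row is replaced.\<close>

definition target_chart ::
    "nat \<Rightarrow> nat \<Rightarrow> nat \<Rightarrow> (nat \<Rightarrow> nat \<times> nat \<Rightarrow> complex) \<Rightarrow> (nat \<Rightarrow> nat \<times> nat \<Rightarrow> complex) set" where
  "target_chart h i k z = {M \<in> conf_matrices h i k.
     (\<forall>r\<in>{k..<i}. indep_rows {..<Suc i} ({1..h} \<times> {..<k}) (mixed_rows r M z)) \<and>
     (\<forall>j\<in>{1..h}. \<forall>j'\<in>{1..h}. j \<noteq> j' \<longrightarrow>
        indep_rows {..<Suc (Suc k)} ({j, j'} \<times> {..<k}) (mixed_rows k M z))}"

definition fun_line :: "(nat \<Rightarrow> 'c \<Rightarrow> complex) \<Rightarrow> (nat \<Rightarrow> 'c \<Rightarrow> complex) \<Rightarrow> complex \<Rightarrow> nat \<Rightarrow> 'c \<Rightarrow> complex" where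
  "fun_line M N t = (\<lambda>r c. M r c + t * (N r c - M r c))"

lemma continuous_on_entries:
  fixes f :: "'a::topological_space \<Rightarrow> nat \<Rightarrow> 'c \<Rightarrow> complex"
  shows "continuous_on S f \<longleftrightarrow> (\<forall>r c. continuous_on S (\<lambda>x. f x r c))"
proof
  assume "continuous_on S f"
  then have "continuous_on S (\<lambda>x. f x r)" for r by (rule continuous_on_product_then_coordinatewise)
  then have "continuous_on S (\<lambda>x. f x r c)" for r c
    by (rule continuous_on_product_then_coordinatewise)
  then show "\<forall>r c. continuous_on S (\<lambda>x. f x r c)" by blast
next
  assume "\<forall>r c. continuous_on S (\<lambda>x. f x r c)"
  then have "continuous_on S (\<lambda>x. f x r)" for r
    by (intro continuous_on_coordinatewise_then_product) blast
  then show "continuous_on S f" by (rule continuous_on_coordinatewise_then_product)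
qed

lemma target_chartD:
  assumes "M \<in> target_chart h i k z"
  shows "M \<in> conf_matrices h i k"
    "r \<in> {k..<i} \<Longrightarrow> indep_rows {..<Suc i} ({1..h} \<times> {..<k}) (mixed_rows r M z)"
    "j \<in> {1..h} \<Longrightarrow> j' \<in> {1..h} \<Longrightarrow> j \<noteq> j' \<Longrightarrow>
        indep_rows {..<Suc (Suc k)} ({j, j'} \<times> {..<k}) (mixed_rows k M z)"
  using assms unfolding target_chart_def by blast+

text \<open>There is room for \<open>i + 1\<close> rows in \<open>h * k\<close> columns and for
  \<open>k + 2\<close> rows in the \<open>2 * k\<close> columns of a pair. So each condition can be
  met separately, and genericity meets all of them for both matrices.\<close>

lemma target_chart_exists:
  assumes "M \<in> conf_matrices h i k" "M' \<in> conf_matrices h i k" "2 \<le> k" "k < i" "i < h * k"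
  shows "\<exists>z. M \<in> target_chart h i k z \<and> M' \<in> target_chart h i k z"
proof -
  let ?P = "{(j, j'). j \<in> {1..h} \<and> j' \<in> {1..h} \<and> j \<noteq> j'}"
  \<comment> \<open>The tag \<open>None\<close> marks the condition on all columns at stage
    \<open>r\<close>, and \<open>Some (j, j')\<close> the pair condition at stage
    \<open>k\<close>.\<close>
  let ?I = "{M, M'} \<times> ({k..<i} \<times> {None} \<union> {k} \<times> Some ` ?P)"
  define R where "R = (\<lambda>(N::nat \<Rightarrow> nat \<times> nat \<Rightarrow> complex, r::nat, p::(nat\<times>nat) option).
     case p of None \<Rightarrow> {..<Suc i} | Some _ \<Rightarrow> {..<Suc (Suc k)})"
  define J where "J = (\<lambda>(N::nat \<Rightarrow> nat \<times> nat \<Rightarrow> complex, r::nat, p).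
     case p of None \<Rightarrow> {1..h} \<times> {..<k} | Some (j, j') \<Rightarrow> {j, j'} \<times> {..<k})"
  have "finite ?P" by (rule finite_subset[of _ "{1..h} \<times> {1..h}"]) auto
  then have fin: "finite ?I" by auto
  have "\<exists>z. \<forall>x\<in>?I. indep_rows (R x) (J x) (mixed_rows (fst (snd x)) (fst x) z)"
  proof (rule indep_rows_simultaneous[OF fin, where line = fun_line and N = "\<lambda>x z. mixed_rows (fst (snd x)) (fst x) z"])
    fix x assume x: "x \<in> ?I"
    obtain N r p where xe: "x = (N, r, p)" by (cases x)
    have N: "N \<in> conf_matrices h i k" using x xe assms(1,2) by auto
    show "finite (R x)" by (auto simp: R_def split: option.split prod.split)
    show "\<exists>z. indep_rows (R x) (J x) (mixed_rows (fst (snd x)) (fst x) z)"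
    proof (cases p)
      case None
      then have r: "k \<le> r" "r < i" using x xe by auto
      have "indep_rows {..<Suc r} ({1..h} \<times> {..<k}) N"
        using r by (intro indep_rows_subset_rows[OF conf_matricesD(2)[OF N]]) auto
      then have "\<exists>z. indep_rows {..<Suc i} ({1..h} \<times> {..<k}) (mixed_rows r N z)"
        using r assms(5) by (intro mixed_rows_exists) (auto simp: card_cartesian_product)
      then show ?thesis by (simp add: xe R_def J_def None)
    next
      case (Some jj)
      then obtain j j' where p: "p = Some (j, j')" "j \<in> {1..h}" "j' \<in> {1..h}" "j \<noteq> j'" and r: "r = k"
        using x xe by auto
      have "indep_rows {..<Suc k} ({j, j'} \<times> {..<k}) N" using conf_matricesD(3)[OF N p(2-4)] .
      then have "\<exists>z. indep_rows {..<Suc (Suc k)} ({j, j'} \<times> {..<k}) (mixed_rows k N z)"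
        using p(4) assms(3) by (intro mixed_rows_exists) (auto simp: card_cartesian_product)
      then show ?thesis by (simp add: xe R_def J_def p r)
    qed
  qed (auto simp: mixed_rows_def fun_line_def)
  then obtain z where z: "\<And>x. x \<in> ?I \<Longrightarrow> indep_rows (R x) (J x) (mixed_rows (fst (snd x)) (fst x) z)" by blast
  have "N \<in> target_chart h i k z" if "N \<in> {M, M'}" for N
    unfolding target_chart_def
  proof (intro CollectI conjI ballI impI)
    show "N \<in> conf_matrices h i k" using that assms by auto
    show "indep_rows {..<Suc i} ({1..h} \<times> {..<k}) (mixed_rows r N z)" if "r \<in> {k..<i}" for r
      using z[of "(N, r, None)"] that \<open>N \<in> {M, M'}\<close> by (simp add: R_def J_def)
    show "indep_rows {..<Suc (Suc k)} ({j, j'} \<times> {..<k}) (mixed_rows k N z)"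
      if "j \<in> {1..h}" "j' \<in> {1..h}" "j \<noteq> j'" for j j'
      using z[of "(N, k, Some (j, j'))"] that \<open>N \<in> {M, M'}\<close> by (simp add: R_def J_def)
  qed
  then show ?thesis by blast
qed

lemma openin_target_chart:
  "openin (top_of_set (conf_matrices h i k)) (target_chart h i k z)"
proof -
  let ?T = "top_of_set (conf_matrices h i k)"
  have entry: "continuous_map ?T euclidean (\<lambda>M. mixed_rows r M z x c)" for r x c
  proof -
    have "continuous_on (conf_matrices h i k) (\<lambda>M. M x c)"
      using continuous_on_entries[of "conf_matrices h i k" "\<lambda>M. M"] continuous_on_id by blast
    then show ?thesis by (cases "x \<le> r") (simp_all add: mixed_rows_def)
  qed
  have op: "openin ?T {M \<in> topspace ?T. indep_rows {..<q} J (mixed_rows r M z)}" for q J r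
    by (intro openin_indep_rows entry) auto
  let ?P = "{(j, j'). j \<in> {1..h} \<and> j' \<in> {1..h} \<and> j \<noteq> j'}"
  have finP: "finite ?P" by (rule finite_subset[of _ "{1..h} \<times> {1..h}"]) auto
  let ?A = "topspace ?T \<inter> (\<Inter>r\<in>{k..<i}. {M \<in> topspace ?T. indep_rows {..<Suc i} ({1..h} \<times> {..<k}) (mixed_rows r M z)})"
  let ?B = "topspace ?T \<inter> (\<Inter>(j,j')\<in>?P. {M \<in> topspace ?T. indep_rows {..<Suc (Suc k)} ({j,j'} \<times> {..<k}) (mixed_rows k M z)})"
  have "openin ?T ?A" using op by (intro openin_Int_Inter) auto
  moreover have "openin ?T ?B" using op finP by (intro openin_Int_Inter) auto
  ultimately have "openin ?T (?A \<inter> ?B)" by (rule openin_Int)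
  moreover have "target_chart h i k z = ?A \<inter> ?B"
    unfolding target_chart_def by auto
  ultimately show ?thesis by (simp only:)
qed

lemma loop_hom_linear:
  assumes "pathin (top_of_set S) p" "pathin (top_of_set S) q" "p 0 = p 1" "q 0 = q 1"
    and seg: "\<And>s t. s \<in> {0..1::real} \<Longrightarrow> t \<in> {0..1::real} \<Longrightarrow>
      fun_line (p t) (q t) (of_real s) \<in> S"
  shows "loop_hom (top_of_set S) p q"
proof (rule loop_homI)
  let ?h = "\<lambda>y::real \<times> real. fun_line (p (snd y)) (q (snd y)) (of_real (fst y))"
  have "continuous_on ({0..1} \<times> {0..1}) ?h"
    unfolding continuous_on_entries fun_line_def
  proof (intro allI continuous_intros)
    fix r c
    have *: "continuous_on ({0..1} \<times> {0..1}) (\<lambda>y::real \<times> real. f (snd y) r c)"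
      if "pathin (top_of_set S) f" for f
    proof (rule continuous_on_compose2[of "{0..1}" "\<lambda>t. f t r c"])
      show "continuous_on {0..1} (\<lambda>t. f t r c)"
        using that continuous_on_entries[of "{0..1}" f] by (auto simp: pathin_def)
    qed (auto intro!: continuous_intros)
    show "continuous_on ({0..1} \<times> {0..1}) (\<lambda>y::real \<times> real. p (snd y) r c)"
      "continuous_on ({0..1} \<times> {0..1}) (\<lambda>y::real \<times> real. q (snd y) r c)"
      "continuous_on ({0..1} \<times> {0..1}) (\<lambda>y::real \<times> real. p (snd y) r c)"
      using * assms(1,2) by blast+
  qed
  then show "continuous_map (top_of_set ({0..1} \<times> {0..1})) (top_of_set S) ?h"
    using seg by auto
qed (use assms(3,4) in \<open>auto simp: fun_line_def\<close>)

lemma fun_line_0_1: "fun_line M N 0 = M" "fun_line M N 1 = N"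
  by (simp_all add: fun_line_def fun_eq_iff)

lemma path_on_line:
  assumes "path \<gamma>" "\<And>t. t \<in> {0..1} \<Longrightarrow> fun_line M N (\<gamma> t) \<in> S"
  shows "pathin (top_of_set S) (\<lambda>t. fun_line M N (\<gamma> t))"
proof -
  have "continuous_on {0..1} (\<lambda>t. fun_line M N (\<gamma> t))"
    unfolding continuous_on_entries fun_line_def using assms(1) unfolding path_def
    by (intro allI continuous_intros)
  then show ?thesis using assms(2) by (auto simp: pathin_def)
qed

lemma target_chart_stage:
  assumes M: "M \<in> target_chart h i k z" and r: "k \<le> r" "r < i"
  shows "(\<lambda>x c. if x < r then M x c else if x = r then (1 - s) * M r c + s * z r c else z x c)
    \<in> conf_matrices h i k" (is "?N \<in> _")
  unfolding conf_matrices_def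
proof (intro CollectI conjI allI impI ballI)
  have Mc: "M \<in> conf_matrices h i k" using M by (simp add: target_chart_def)
  show "?N x (j, l) = (if l = x then 1 else 0)" if "x < k" for x j l
    using conf_matricesD(1)[OF Mc that] that r by simp
  show "indep_rows {..<i} ({1..h} \<times> {..<k}) ?N"
    by (rule indep_rows_interpolate[OF target_chartD(2)[OF M, of r], where s = s]) (use r in simp_all)
  show "indep_rows {..<Suc k} ({j, j'} \<times> {..<k}) ?N"
    if j: "j \<in> {1..h}" "j' \<in> {1..h}" "j \<noteq> j'" for j j'
  proof (cases "r = k")
    case True
    show ?thesis unfolding True
      by (rule indep_rows_interpolate[OF target_chartD(3)[OF M j], where s = s]) simp_all
  next
    \<comment> \<open>Pair conditions look at rows up to \<open>k < r\<close> only, and these are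
      still the rows of \<open>M\<close>.\<close>
    case False
    then have "indep_rows {..<Suc k} ({j, j'} \<times> {..<k}) ?N = indep_rows {..<Suc k} ({j, j'} \<times> {..<k}) M"
      using r by (intro indep_rows_cong) auto
    then show ?thesis using conf_matricesD(3)[OF Mc j] by simp
  qed
qed

lemma target_chart_loop_null:
  assumes p: "pathin (top_of_set (conf_matrices h i k)) p" "p ` {0..1} \<subseteq> target_chart h i k z"
    and p01: "p 0 = p 1" and "k < i"
  shows "loop_null (top_of_set (conf_matrices h i k)) p"
proof -
  let ?T = "top_of_set (conf_matrices h i k)"
  \<comment> \<open>Rows are replaced from the last one downwards; in \<open>L m\<close> those from
    \<open>m\<close> on have become constant.\<close>
  define L where "L m t = (\<lambda>x c. if x < m then p t x c else z x c)" for m :: nat and t :: real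
  have pt: "p t \<in> target_chart h i k z" if "t \<in> {0..1}" for t using p(2) that by auto
  have pc: "p t \<in> conf_matrices h i k" if "t \<in> {0..1}" for t
    using pt[OF that] by (simp add: target_chart_def)
  have Lc: "L m t \<in> conf_matrices h i k" if m: "k \<le> m" "m \<le> i" and t: "t \<in> {0..1}" for m t
  proof (cases "m = i")
    case True
    have "indep_rows {..<i} ({1..h} \<times> {..<k}) (L m t) = indep_rows {..<i} ({1..h} \<times> {..<k}) (p t)"
      "indep_rows {..<Suc k} ({j, j'} \<times> {..<k}) (L m t) = indep_rows {..<Suc k} ({j, j'} \<times> {..<k}) (p t)" for j j'
      using True \<open>k < i\<close> by (auto simp: L_def intro!: indep_rows_cong)
    moreover have "L m t x (j, l) = (if l = x then 1 else 0)" if "x < k" for x j l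
      using conf_matricesD(1)[OF pc[OF t] that] that True \<open>k < i\<close> by (simp add: L_def)
    ultimately show ?thesis
      using conf_matricesD(2,3)[OF pc[OF t]] unfolding conf_matrices_def by simp
  next
    case False
    have "(\<lambda>x c. if x < m then p t x c else if x = m then (1 - 1) * p t m c + 1 * z m c else z x c) = L m t"
      by (auto simp: L_def fun_eq_iff)
    then show ?thesis using target_chart_stage[OF pt[OF t], of m 1] m False by auto
  qed
  have entry: "continuous_on {0..1} (\<lambda>t. p t x c)" for x c
  proof -
    have "continuous_on {0..1} p" using p(1) by (auto simp: pathin_def)
    then show ?thesis using continuous_on_entries[of "{0..1}" p] by blast
  qed
  have Lp: "pathin ?T (L m)" if "k \<le> m" "m \<le> i" for m
  proof -
    have "continuous_on {0..1} (L m)"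
      unfolding continuous_on_entries
    proof (intro allI)
      fix x c show "continuous_on {0..1} (\<lambda>t. L m t x c)"
        using entry by (cases "x < m") (simp_all add: L_def)
    qed
    then show ?thesis using Lc[OF that] by (auto simp: pathin_def)
  qed
  have L01: "L m 0 = L m 1" for m unfolding L_def p01 ..
  \<comment> \<open>The conditions constrain rows below \<open>i\<close>, so all rows beyond can be
    moved at once.\<close>
  have pL: "loop_hom ?T p (L i)"
  proof (rule loop_hom_linear[OF p(1) Lp p01 L01])
    fix s t :: real assume t: "t \<in> {0..1}"
    let ?N = "fun_line (p t) (L i t) (of_real s)"
    have eq: "?N x c = p t x c" if "x < i" for x c using that by (simp add: fun_line_def L_def)
    have "indep_rows {..<i} ({1..h} \<times> {..<k}) ?N = indep_rows {..<i} ({1..h} \<times> {..<k}) (p t)"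
      "indep_rows {..<Suc k} ({j, j'} \<times> {..<k}) ?N = indep_rows {..<Suc k} ({j, j'} \<times> {..<k}) (p t)" for j j'
      using \<open>k < i\<close> by (auto simp: eq intro!: indep_rows_cong)
    moreover have "?N x (j, l) = (if l = x then 1 else 0)" if "x < k" for x j l
      using conf_matricesD(1)[OF pc[OF t] that] eq[of x] that \<open>k < i\<close> by simp
    ultimately show "?N \<in> conf_matrices h i k"
      using conf_matricesD(2,3)[OF pc[OF t]] unfolding conf_matrices_def by simp
  qed (use \<open>k < i\<close> in auto)
  have step: "loop_hom ?T (L (Suc r)) (L r)" if r: "k \<le> r" "r < i" for r
  proof (rule loop_hom_linear[OF Lp Lp L01 L01])
    fix s t :: real assume t: "t \<in> {0..1}"
    have "fun_line (L (Suc r) t) (L r t) (of_real s) = (\<lambda>x c. if x < r then p t x c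
        else if x = r then (1 - of_real s) * p t r c + of_real s * z r c else z x c)"
      by (auto simp: L_def fun_line_def fun_eq_iff algebra_simps)
    then show "fun_line (L (Suc r) t) (L r t) (of_real s) \<in> conf_matrices h i k"
      using target_chart_stage[OF pt[OF t] r] by simp
  qed (use r in auto)
  have down: "loop_hom ?T p (L (i - d))" if "d \<le> i - k" for d
    using that
  proof (induction d)
    case (Suc d)
    have "Suc (i - Suc d) = i - d" using Suc.prems by linarith
    moreover have "loop_hom ?T (L (Suc (i - Suc d))) (L (i - Suc d))"
      using Suc.prems by (intro step) linarith+
    ultimately have "loop_hom ?T (L (i - d)) (L (i - Suc d))" by simp
    moreover have "loop_hom ?T p (L (i - d))" using Suc.IH Suc.prems by simp
    ultimately show ?case by (rule loop_hom_trans[rotated])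
  qed (use pL in simp)
  have "loop_hom ?T p (L k)" using down[of "i - k"] \<open>k < i\<close> by simp
  \<comment> \<open>What is left of the loop are the \<open>k\<close> normalised rows, which are the
    same in all matrices.\<close>
  moreover have "loop_hom ?T (L k) (\<lambda>_. L k 0)"
  proof (rule loop_hom_eq)
    have "p t x (j, l) = p 0 x (j, l)" if "t \<in> {0..1}" "x < k" for t x j l
      using conf_matricesD(1)[OF pc[OF that(1)] that(2)] conf_matricesD(1)[OF pc[of 0] that(2)] by simp
    note pk = this
    show "L k t = L k 0" if "t \<in> {0..1}" for t
    proof (intro ext)
      fix x c show "L k t x c = L k 0 x c"
        using pk[OF that, of x "fst c" "snd c"] by (simp add: L_def)
    qed
    show "L k 0 = L k 1" by (rule L01)
    show "pathin ?T (L k)" using \<open>k < i\<close> by (intro Lp) simp_all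
  qed
  ultimately have "loop_hom ?T p (\<lambda>_. L k 0)" by (rule loop_hom_trans)
  then show ?thesis unfolding loop_null_def by blast
qed

text \<open>The cover consists of the target charts around \<open>M0\<close>. A complex line through
  two matrices keeps the identity blocks, and a path in it can avoid the finitely many parameters
  that violate a condition of either chart.\<close>

theorem simply_connected_conf_matrices:
  assumes ne: "M0 \<in> conf_matrices h i k" and k: "2 \<le> k" "k < i" "i < h * k"
  shows "simply_connected_top (top_of_set (conf_matrices h i k))"
proof (rule simply_connected_from_cover[where ?x0.0 = M0 and
      \<U> = "{target_chart h i k z | z. M0 \<in> target_chart h i k z}"])
  let ?T = "top_of_set (conf_matrices h i k)"
  show "topspace ?T \<subseteq> \<Union> {target_chart h i k z | z. M0 \<in> target_chart h i k z}"
  proof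
    fix M assume "M \<in> topspace ?T"
    then obtain z where "M0 \<in> target_chart h i k z" "M \<in> target_chart h i k z"
      using target_chart_exists[OF ne _ k] by auto
    then show "M \<in> \<Union> {target_chart h i k z | z. M0 \<in> target_chart h i k z}" by blast
  qed
  show "loop_null ?T p" if "U \<in> {target_chart h i k z | z. M0 \<in> target_chart h i k z}"
    "pathin ?T p" "p ` {0..1} \<subseteq> U" "p 0 = p 1" for U p
    using that target_chart_loop_null k(2) by auto
  fix U V M N assume "U \<in> {target_chart h i k z | z. M0 \<in> target_chart h i k z}"
    "V \<in> {target_chart h i k z | z. M0 \<in> target_chart h i k z}" and MN: "M \<in> U \<inter> V" "N \<in> U \<inter> V"
  then obtain z z' where UV: "U = target_chart h i k z" "V = target_chart h i k z'" by auto
  let ?L = "fun_line M N"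
  have MN': "M \<in> conf_matrices h i k" "N \<in> conf_matrices h i k"
    using MN UV by (auto simp: target_chart_def)
  have fin: "finite {t. \<not> indep_rows {..<q} J (mixed_rows r (?L t) u)}"
    if "indep_rows {..<q} J (mixed_rows r M u)" for q J r u
  proof -
    have "is_polyfun (\<lambda>t. mixed_rows r (?L t) u x c)" for x c
      by (cases "x \<le> r") (auto simp: mixed_rows_def fun_line_def)
    then show ?thesis
      using that fun_line_0_1(1)[of M N]
      by (intro indep_rows_polyfun[where a = 0]) auto
  qed
  let ?P = "{(j, j'). j \<in> {1..h} \<and> j' \<in> {1..h} \<and> j \<noteq> j'}"
  let ?C = "{1..h} \<times> {..<k}"
  define bad where "bad u = (\<Union>r\<in>{k..<i}. {t. \<not> indep_rows {..<Suc i} ?C (mixed_rows r (?L t) u)}) \<union>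
     (\<Union>(j,j')\<in>?P. {t. \<not> indep_rows {..<Suc (Suc k)} ({j,j'} \<times> {..<k}) (mixed_rows k (?L t) u)})" for u
  have finP: "finite ?P" by (rule finite_subset[of _ "{1..h} \<times> {1..h}"]) auto
  have finbad: "finite (bad u)" if "M \<in> target_chart h i k u" for u
    unfolding bad_def using finP
    by (intro finite_UnI finite_UN_I) (auto intro!: fin target_chartD(2,3)[OF that] simp del: One_nat_def)
  have good: "?L t \<in> target_chart h i k u" if t: "t \<notin> bad u" for t u
  proof -
    have 1: "indep_rows {..<Suc i} ?C (mixed_rows r (?L t) u)" if "r \<in> {k..<i}" for r
      using t that by (auto simp: bad_def)
    have 2: "indep_rows {..<Suc (Suc k)} ({j,j'} \<times> {..<k}) (mixed_rows k (?L t) u)"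
      if "j \<in> {1..h}" "j' \<in> {1..h}" "j \<noteq> j'" for j j'
      using t that by (auto simp: bad_def)
    \<comment> \<open>The end \<open>s = 0\<close> of an interpolation forgets the replacement rows,
      so the mixed conditions imply the original ones. Stage \<open>i - 1\<close> is the one that
      keeps all rows below \<open>i\<close>.\<close>
    have "indep_rows {..<i} ?C (?L t)"
      by (rule indep_rows_interpolate[OF 1[of "i - 1"], where s = 0]) (use k in \<open>auto dest: less_antisym\<close>)
    moreover have "indep_rows {..<Suc k} ({j,j'} \<times> {..<k}) (?L t)"
      if "j \<in> {1..h}" "j' \<in> {1..h}" "j \<noteq> j'" for j j'
      by (rule indep_rows_interpolate[OF 2[OF that], where s = 0]) (auto simp: less_Suc_eq)
    moreover have "?L t x (j, l) = (if l = x then 1 else 0)" if "x < k" for x j l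
      using conf_matricesD(1)[OF MN'(1) that] conf_matricesD(1)[OF MN'(2) that] by (simp add: fun_line_def)
    ultimately have "?L t \<in> conf_matrices h i k" unfolding conf_matrices_def by blast
    then show ?thesis using 1 2 unfolding target_chart_def by blast
  qed
  let ?G = "\<lambda>t. ?L t \<in> target_chart h i k z \<inter> target_chart h i k z'"
  have "finite (bad z \<union> bad z')" using finbad MN UV by auto
  then have "finite {t. \<not> ?G t}" by (rule rev_finite_subset) (use good in auto)
  moreover have "?G 0" "?G 1" using MN UV by (simp_all only: fun_line_0_1)
  ultimately obtain \<gamma> where \<gamma>: "path \<gamma>" "\<gamma> 0 = 0" "\<gamma> 1 = 1" "\<forall>t\<in>{0..1}. ?G (\<gamma> t)"
    using path_avoiding_finite[of ?G] by blast
  have "pathin ?T (\<lambda>t. ?L (\<gamma> t))"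
    using \<gamma>(4) by (intro path_on_line \<gamma>(1)) (auto simp: target_chart_def)
  then show "\<exists>g. pathin ?T g \<and> g ` {0..1} \<subseteq> U \<inter> V \<and> g 0 = M \<and> g 1 = N"
    using \<gamma> UV by (intro exI[of _ "\<lambda>t. ?L (\<gamma> t)"]) (auto simp: fun_line_0_1)
qed (use ne openin_target_chart in auto)

section \<open>Charts of configuration spaces\<close>

lemma sum_subspaces_eq_span:
  fixes H :: "nat \<Rightarrow> (complex^'n) set"
  assumes "finite J" "\<And>j. j \<in> J \<Longrightarrow> vec.subspace (H j)"
  shows "(\<Sum>j\<in>J. H j) = vec.span (\<Union>j\<in>J. H j)"
proof
  have eq: "(\<Sum>j\<in>J. H j) = {sum s J | s. \<forall>j\<in>J. s j \<in> H j}"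
    using assms(1) by (rule set_sum_alt)
  show "(\<Sum>j\<in>J. H j) \<subseteq> vec.span (\<Union>j\<in>J. H j)"
  proof
    fix x assume "x \<in> (\<Sum>j\<in>J. H j)"
    then obtain s where "x = sum s J" "\<forall>j\<in>J. s j \<in> H j" unfolding eq by blast
    then show "x \<in> vec.span (\<Union>j\<in>J. H j)" by (auto intro: vec.span_sum vec.span_base)
  qed
  show "vec.span (\<Union>j\<in>J. H j) \<subseteq> (\<Sum>j\<in>J. H j)"
  proof (rule vec.span_minimal)
    show "(\<Union>j\<in>J. H j) \<subseteq> (\<Sum>j\<in>J. H j)"
    proof
      fix x assume "x \<in> (\<Union>j\<in>J. H j)"
      then obtain j where j: "j \<in> J" "x \<in> H j" by blast
      have "x = (\<Sum>a\<in>J. if a = j then x else 0)" using assms(1) j by simp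
      then show "x \<in> (\<Sum>j\<in>J. H j)"
        unfolding eq using j assms(2) by (intro CollectI exI[of _ "\<lambda>a. if a = j then x else 0"]) (auto simp: vec.subspace_0)
    qed
    show "vec.subspace (\<Sum>j\<in>J. H j)"
      unfolding eq
    proof (rule vec.subspaceI)
      show "0 \<in> {sum s J | s. \<forall>j\<in>J. s j \<in> H j}"
        using assms(2) by (intro CollectI exI[of _ "\<lambda>_. 0"]) (auto simp: vec.subspace_0)
      fix x y assume "x \<in> {sum s J | s. \<forall>j\<in>J. s j \<in> H j}" "y \<in> {sum s J | s. \<forall>j\<in>J. s j \<in> H j}"
      then obtain s s' where "x = sum s J" "y = sum s' J" "\<forall>j\<in>J. s j \<in> H j" "\<forall>j\<in>J. s' j \<in> H j" by auto
      then show "x + y \<in> {sum s J | s. \<forall>j\<in>J. s j \<in> H j}"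
        using assms(2) by (intro CollectI exI[of _ "\<lambda>j. s j + s' j"]) (auto simp: sum.distrib vec.subspace_add)
    next
      fix a x assume "x \<in> {sum s J | s. \<forall>j\<in>J. s j \<in> H j}"
      then obtain s where "x = sum s J" "\<forall>j\<in>J. s j \<in> H j" by auto
      then show "a *s x \<in> {sum s J | s. \<forall>j\<in>J. s j \<in> H j}"
        using assms(2) by (intro CollectI exI[of _ "\<lambda>j. a *s s j"]) (auto simp: vec.scale_sum_right vec.subspace_scale)
    qed
  qed
qed

text \<open>The sum of the subspaces is the span of their union, and \<open>vec.dim\<close> of a set
  is the dimension of its span.\<close>

lemma ordered_conf_iff:
  "(H :: nat \<Rightarrow> (complex^'n) set) \<in> ordered_conf h i k \<longleftrightarrow>
     H \<in> {1..h} \<rightarrow>\<^sub>E grassmannian k \<and> inj_on H {1..h} \<and> vec.dim (\<Union>j\<in>{1..h}. H j) = i"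
proof -
  have "vec.dim (\<Sum>j\<in>{1..h}. H j) = vec.dim (\<Union>j\<in>{1..h}. H j)" if "H \<in> {1..h} \<rightarrow>\<^sub>E grassmannian k"
  proof -
    have "\<And>j. j \<in> {1..h} \<Longrightarrow> vec.subspace (H j)" using that by (auto simp: grassmannian_def PiE_def Pi_def)
    then show ?thesis by (simp add: sum_subspaces_eq_span vec.dim_span del: atLeastAtMost_iff)
  qed
  then show ?thesis unfolding ordered_conf_def by (smt (verit) mem_Collect_eq)
qed

lemma topspace_ordered_conf_topology:
  "topspace (ordered_conf_topology h i k) = (ordered_conf h i k :: (nat \<Rightarrow> (complex^'n) set) set)"
  by (auto simp: ordered_conf_topology_def topspace_grassmannian_topology ordered_conf_def)

lemma ordered_conf_component:
  assumes "H \<in> ordered_conf h i k" "j \<in> {1..h}"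
  shows "H j \<in> grassmannian k"
  using assms by (auto simp: ordered_conf_def)

lemma continuous_map_component:
  assumes "j \<in> {1..h}"
  shows "continuous_map (ordered_conf_topology h i k) (grassmannian_topology k) (\<lambda>H. H j)"
  unfolding ordered_conf_topology_def
  using assms by (intro continuous_map_from_subtopology continuous_map_product_projection)

definition conf_of :: "nat \<Rightarrow> nat \<Rightarrow> (nat \<times> nat \<Rightarrow> complex^'n) \<Rightarrow> nat \<Rightarrow> (complex^'n) set" where
  "conf_of h k v = (\<lambda>j\<in>{1..h}. vec.span ((\<lambda>l. v (j, l)) ` {..<k}))"

lemma conf_of_apply: "j \<in> {1..h} \<Longrightarrow> conf_of h k v j = vec.span ((\<lambda>l. v (j, l)) ` {..<k})"
  by (simp add: conf_of_def)

lemma conf_of_cong: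
  assumes "\<And>j. j \<in> {1..h} \<Longrightarrow> vec.span ((\<lambda>l. v (j, l)) ` {..<k}) = vec.span ((\<lambda>l. w (j, l)) ` {..<k})"
  shows "conf_of h k v = conf_of h k w"
  unfolding conf_of_def by (intro restrict_ext assms)

lemma continuous_map_conf_of:
  fixes v :: "'a \<Rightarrow> nat \<times> nat \<Rightarrow> complex^'n"
  assumes "\<And>c. c \<in> {1..h} \<times> {..<k} \<Longrightarrow> continuous_map T euclidean (\<lambda>x. v x c)"
    and mem: "\<And>x. x \<in> topspace T \<Longrightarrow> conf_of h k (v x) \<in> ordered_conf h i k"
  shows "continuous_map T (ordered_conf_topology h i k) (\<lambda>x. conf_of h k (v x))"
proof -
  have "continuous_map T (grassmannian_topology k) (\<lambda>x. conf_of h k (v x) j)" if j: "j \<in> {1..h}" for j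
  proof -
    have "continuous_map T (grassmannian_topology k) (\<lambda>x. vec.span ((\<lambda>l. v x (j, l)) ` {..<k}))"
    proof (rule continuous_map_span)
      show "vec.dim (vec.span ((\<lambda>l. v x (j, l)) ` {..<k})) = k" if "x \<in> topspace T" for x
        using ordered_conf_component[OF mem[OF that] j] by (simp only: conf_of_apply[OF j] grassmannian_def mem_Collect_eq)
    qed (use assms(1) j in auto)
    then show ?thesis by (simp only: conf_of_apply[OF j])
  qed
  then show ?thesis
    unfolding ordered_conf_topology_def continuous_map_in_subtopology continuous_map_componentwise
    using mem by (auto simp: conf_of_def)
qed

text \<open>A pair \<open>(q, J)\<close> requires that the first \<open>q\<close> coordinates map \<open>\<Sum>j\<in>J. H j\<close> onto \<open>\<complex>\<^sup>q\<close>. The four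
  families give normalised frames, distinctness, the right dimension of the total sum, and (only for
  direct sums) transversality of the flag of partial sums to a fixed flag.\<close>

definition conds :: "nat \<Rightarrow> nat \<Rightarrow> nat \<Rightarrow> (nat \<times> nat set) set" where
  "conds h i k = {(k, {j}) | j. j \<in> {1..h}}
     \<union> {(Suc k, {j, j'}) | j j'. j \<in> {1..h} \<and> j' \<in> {1..h} \<and> j \<noteq> j'}
     \<union> {(i, {1..h})} \<union> {(m * k, {1..m}) | m. m \<in> {1..h} \<and> h * k = i}"

lemma conds_cases:
  assumes "(q, J) \<in> conds h i k"
  obtains (one) j where "j \<in> {1..h}" "q = k" "J = {j}"
    | (two) j j' where "j \<in> {1..h}" "j' \<in> {1..h}" "j \<noteq> j'" "q = Suc k" "J = {j, j'}"
    | (all) "q = i" "J = {1..h}"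
    | (flag) m where "m \<in> {1..h}" "h * k = i" "q = m * k" "J = {1..m}"
  using assms unfolding conds_def by blast

lemma condsI:
  "j \<in> {1..h} \<Longrightarrow> (k, {j}) \<in> conds h i k"
  "j \<in> {1..h} \<Longrightarrow> j' \<in> {1..h} \<Longrightarrow> j \<noteq> j' \<Longrightarrow> (Suc k, {j, j'}) \<in> conds h i k"
  "(i, {1..h}) \<in> conds h i k"
  "m \<in> {1..h} \<Longrightarrow> h * k = i \<Longrightarrow> (m * k, {1..m}) \<in> conds h i k"
  unfolding conds_def by blast+

lemma finite_conds: "finite (conds h i k)"
proof -
  have "conds h i k \<subseteq> ({k, Suc k, i} \<union> (\<lambda>m. m * k) ` {1..h}) \<times> Pow {1..h}"
  proof
    fix x assume "x \<in> conds h i k"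
    then obtain q J where x: "x = (q, J)" "(q, J) \<in> conds h i k" by (cases x) auto
    then show "x \<in> ({k, Suc k, i} \<union> (\<lambda>m. m * k) ` {1..h}) \<times> Pow {1..h}"
      by (cases rule: conds_cases[OF x(2)]) auto
  qed
  then show ?thesis by (rule finite_subset) auto
qed

lemma conds_subset: "(q, J) \<in> conds h i k \<Longrightarrow> J \<subseteq> {1..h}"
  by (cases rule: conds_cases) auto

lemma dim_Un_le:
  "vec.dim (A \<union> B :: (complex^'n) set) \<le> vec.dim A + vec.dim B"
proof -
  obtain A' where A': "A' \<subseteq> A" "vec.independent A'" "A \<subseteq> vec.span A'" "card A' = vec.dim A"
    by (rule vec.basis_exists)
  obtain B' where B': "B' \<subseteq> B" "vec.independent B'" "B \<subseteq> vec.span B'" "card B' = vec.dim B"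
    by (rule vec.basis_exists)
  have "A \<union> B \<subseteq> vec.span (A' \<union> B')"
    using A'(3) B'(3) vec.span_mono[of A' "A' \<union> B'"] vec.span_mono[of B' "A' \<union> B'"] by auto
  moreover have "finite (A' \<union> B')" using A'(2) B'(2) vec.independent_bound_general by blast
  ultimately have "vec.dim (A \<union> B) \<le> card (A' \<union> B')" by (rule vec.dim_le_card)
  also have "\<dots> \<le> vec.dim A + vec.dim B" using A'(4) B'(4) card_Un_le by metis
  finally show ?thesis .
qed

text \<open>These inequalities are what lets generic coordinates satisfy all conditions of
  \<open>conds\<close>.\<close>

lemma dim_le_conds:
  fixes H :: "nat \<Rightarrow> (complex^'n) set"
  assumes H: "H \<in> ordered_conf h i k" and qJ: "(q, J) \<in> conds h i k"
  shows "q \<le> vec.dim (\<Union>j\<in>J. H j)"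
  using qJ
proof (cases rule: conds_cases)
  case (one j)
  then show ?thesis using ordered_conf_component[OF H] by (simp add: grassmannian_def)
next
  case (two j j')
  have g: "H j \<in> grassmannian k" "H j' \<in> grassmannian k" using ordered_conf_component[OF H] two by auto
  show ?thesis
  proof (rule ccontr)
    assume "\<not> ?thesis"
    then have d: "vec.dim (vec.span (H j \<union> H j')) \<le> k" using two by (simp add: vec.dim_span)
    have sup: "H j \<union> H j' \<subseteq> vec.span (H j \<union> H j')" by (rule vec.span_superset)
    \<comment> \<open>A sum of dimension at most \<open>k\<close> coincides with each of the two
      summands.\<close>
    have "V = vec.span (H j \<union> H j')" if "V \<in> {H j, H j'}" for V
    proof (rule vec.subspace_dim_equal)
      show "vec.subspace V" using that g by (auto simp: grassmannian_def)
      show "V \<subseteq> vec.span (H j \<union> H j')" using that sup by blast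
      have "vec.dim V = k" using that g by (auto simp: grassmannian_def)
      then show "vec.dim (vec.span (H j \<union> H j')) \<le> vec.dim V" using d by simp
    qed (rule vec.subspace_span)
    from trans[OF this[of "H j"] this[of "H j'", symmetric]]
    have "H j = H j'" by simp
    then show False using H two(1-3) unfolding ordered_conf_def inj_on_def by blast
  qed
next
  case all
  then show ?thesis using H by (simp add: ordered_conf_iff)
next
  case (flag m)
  \<comment> \<open>The remaining \<open>h - m\<close> subspaces add at most \<open>k\<close>
    dimensions each. As the total is \<open>h * k\<close>, the first \<open>m\<close> must already
    have dimension \<open>m * k\<close>.\<close>
  have "vec.dim (\<Union>j\<in>{1..m+d}. H j) \<le> vec.dim (\<Union>j\<in>{1..m}. H j) + d * k" if "m + d \<le> h" for d
    using that
  proof (induction d)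
    case (Suc d)
    have "(\<Union>j\<in>{1..m + Suc d}. H j) = (\<Union>j\<in>{1..m+d}. H j) \<union> H (m + Suc d)"
      by (auto simp: atLeastAtMostSuc_conv)
    moreover have "vec.dim (H (m + Suc d)) = k"
      using ordered_conf_component[OF H, of "m + Suc d"] Suc.prems by (simp add: grassmannian_def)
    ultimately show ?case
      using dim_Un_le[of "\<Union>j\<in>{1..m+d}. H j" "H (m + Suc d)"] Suc by simp
  qed simp
  from this[of "h - m"] have "i \<le> vec.dim (\<Union>j\<in>{1..m}. H j) + (h - m) * k"
    using flag H by (simp add: ordered_conf_iff)
  moreover have "i = m * k + (h - m) * k" using flag by (simp flip: add_mult_distrib)
  ultimately show ?thesis using flag by simp
qed

lemma conds_le:
  fixes H :: "nat \<Rightarrow> (complex^'n) set"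
  assumes "H \<in> ordered_conf h i k" "(q, J) \<in> conds h i k"
  shows "q \<le> i"
proof -
  have "q \<le> vec.dim (\<Union>j\<in>J. H j)" by (rule dim_le_conds[OF assms])
  also have "\<dots> \<le> vec.dim (\<Union>j\<in>{1..h}. H j)"
    by (rule vec.dim_subset) (use conds_subset[OF assms(2)] in auto)
  finally show ?thesis using assms(1) by (simp add: ordered_conf_iff)
qed

definition conf_chart :: "nat \<Rightarrow> nat \<Rightarrow> nat \<Rightarrow> complex^'n^'n \<Rightarrow> (nat \<Rightarrow> (complex^'n) set) set" where
  "conf_chart h i k g = {H \<in> ordered_conf h i k.
     \<forall>(q, J)\<in>conds h i k. indep_rows {..<q} (\<Union>j\<in>J. H j) (coord g)}"

lemma conf_chartD:
  assumes "H \<in> conf_chart h i k g"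
  shows "H \<in> ordered_conf h i k" "(q, J) \<in> conds h i k \<Longrightarrow> indep_rows {..<q} (\<Union>j\<in>J. H j) (coord g)"
    "j \<in> {1..h} \<Longrightarrow> H j \<in> chart g k"
proof -
  show H: "H \<in> ordered_conf h i k" using assms by (simp add: conf_chart_def)
  show c: "indep_rows {..<q} (\<Union>j\<in>J. H j) (coord g)" if "(q, J) \<in> conds h i k" for q J
    using assms that unfolding conf_chart_def by blast
  show "H j \<in> chart g k" if "j \<in> {1..h}"
    using c[OF condsI(1)[OF that]] ordered_conf_component[OF H that] by (simp add: chart_def)
qed

lemma conf_of_frames:
  assumes "H \<in> ordered_conf h i k" "\<And>j. j \<in> {1..h} \<Longrightarrow> H j = vec.span ((\<lambda>l. v (j, l)) ` {..<k})"
  shows "conf_of h k v = H"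
proof
  fix j show "conf_of h k v j = H j"
    using assms by (cases "j \<in> {1..h}") (auto simp: conf_of_def ordered_conf_def PiE_def extensional_def)
qed

lemma conf_chart_frames:
  assumes "H \<in> conf_chart h i k g"
  shows "conf_of h k (\<lambda>(j, l). nframe g k (H j) l) = H"
proof (rule conf_of_frames[OF conf_chartD(1)[OF assms]])
  show "H j = vec.span ((\<lambda>l. case (j, l) of (j, l) \<Rightarrow> nframe g k (H j) l) ` {..<k})" if "j \<in> {1..h}" for j
    using span_nframe[OF conf_chartD(3)[OF assms that]] by simp
qed

lemma indep_rows_conf_of:
  assumes "J \<subseteq> {1..h}"
  shows "indep_rows R (\<Union>j\<in>J. conf_of h k v j) (coord g)
     \<longleftrightarrow> indep_rows R (J \<times> {..<k}) (\<lambda>r c. coord g r (v c))"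
proof -
  have "(\<Union>j\<in>J. conf_of h k v j) = (\<Union>j\<in>J. vec.span ((\<lambda>l. v (j, l)) ` {..<k}))"
    using assms by (intro SUP_cong) (auto simp: conf_of_def)
  then show ?thesis by (simp only: indep_rows_Union_span)
qed

text \<open>Surjectivity onto coordinates bounds dimensions from below: \<open>k\<close> for one
  block, \<open>k + 1\<close> for a pair, which gives distinctness, and \<open>i\<close> for all.
  The upper bounds come from counting the \<open>k\<close> generators of a block, and from
  \<open>S\<close> for the total sum.\<close>

lemma conf_of_in_conf_chart:
  fixes v :: "nat \<times> nat \<Rightarrow> complex^'n"
  assumes "\<And>q J. (q, J) \<in> conds h i k \<Longrightarrow> indep_rows {..<q} (J \<times> {..<k}) (\<lambda>r c. coord g r (v c))"
    and S: "vec.dim S \<le> i" "v ` ({1..h} \<times> {..<k}) \<subseteq> vec.span S"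
  shows "conf_of h k v \<in> conf_chart h i k g"
proof -
  have ind: "indep_rows {..<q} (\<Union>j\<in>J. conf_of h k v j) (coord g)" if "(q, J) \<in> conds h i k" for q J
    using assms(1)[OF that] indep_rows_conf_of[OF conds_subset[OF that]] by blast
  have dim: "q \<le> vec.dim (\<Union>j\<in>J. conf_of h k v j)" if "(q, J) \<in> conds h i k" for q J
    using indep_rows_dim_le[OF ind[OF that]] by simp
  have "conf_of h k v j \<in> grassmannian k" if j: "j \<in> {1..h}" for j
  proof -
    have "vec.dim (conf_of h k v j) \<le> card ((\<lambda>l. v (j, l)) ` {..<k})"
      unfolding conf_of_apply[OF j] by (rule vec.dim_le_card) auto
    also have "\<dots> \<le> k" using card_image_le[of "{..<k}"] by simp
    finally have "vec.dim (conf_of h k v j) = k" using dim[OF condsI(1)[OF j]] by simp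
    moreover have "vec.subspace (conf_of h k v j)" unfolding conf_of_apply[OF j] by simp
    ultimately show ?thesis by (simp add: grassmannian_def)
  qed
  note gr = this
  have "inj_on (conf_of h k v) {1..h}"
  proof (rule inj_onI, rule ccontr)
    fix j j' assume j: "j \<in> {1..h}" "j' \<in> {1..h}" and eq: "conf_of h k v j = conf_of h k v j'" and "j \<noteq> j'"
    from dim[OF condsI(2)[OF j \<open>j \<noteq> j'\<close>]] have "Suc k \<le> vec.dim (conf_of h k v j)" using eq by simp
    then show False using gr[OF j(1)] by (simp add: grassmannian_def)
  qed
  moreover have "vec.dim (\<Union>j\<in>{1..h}. conf_of h k v j) = i"
  proof -
    have "(\<Union>j\<in>{1..h}. conf_of h k v j) \<subseteq> vec.span S"
    proof (rule UN_least)
      fix j assume j: "j \<in> {1..h}"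
      show "conf_of h k v j \<subseteq> vec.span S"
        unfolding conf_of_apply[OF j] using S(2) j by (intro vec.span_minimal) (auto simp: image_subset_iff)
    qed
    then have "vec.dim (\<Union>j\<in>{1..h}. conf_of h k v j) \<le> i"
      using vec.dim_mono S(1) by (meson order_trans)
    then show ?thesis using dim[OF condsI(3)] by simp
  qed
  ultimately have "conf_of h k v \<in> ordered_conf h i k"
    unfolding ordered_conf_iff using gr by (auto simp: conf_of_def)
  then show ?thesis using ind unfolding conf_chart_def by blast
qed

lemma openin_conf_chart:
  fixes g :: "complex^'n^'n"
  shows "openin (ordered_conf_topology h i k) (conf_chart h i k g)"
proof -
  let ?F = "ordered_conf_topology h i k :: (nat \<Rightarrow> (complex^'n) set) topology"
  \<comment> \<open>On the open set \<open>A\<close> normalised frames exist and vary continuously,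
    so the other conditions become open conditions on matrix entries.\<close>
  define A where "A = topspace ?F \<inter> (\<Inter>j\<in>{1..h}. {H \<in> topspace ?F. H j \<in> chart g k})"
  have A: "openin ?F A"
    unfolding A_def
    by (intro openin_Int_Inter) (auto intro!: openin_continuous_map_preimage[OF continuous_map_component openin_chart])
  let ?T = "subtopology ?F A"
  have topT: "topspace ?T = A" using openin_subset[OF A] by auto
  have frame: "continuous_map ?T euclidean (\<lambda>H. nframe g k (H j) l)" if j: "j \<in> {1..h}" for j l
  proof -
    have "continuous_map ?T (subtopology (grassmannian_topology k) (chart g k)) (\<lambda>H. H j)"
      using continuous_map_component[OF j] j
      by (intro continuous_map_into_subtopology continuous_map_from_subtopology) (auto simp: A_def)
    from continuous_map_compose[OF this continuous_map_nframe, of l] show ?thesis by (simp add: o_def)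
  qed
  let ?v = "\<lambda>H. \<lambda>(j, l). nframe g k (H j) l"
  let ?B = "\<lambda>(q, J). {H \<in> topspace ?T. indep_rows {..<q} (J \<times> {..<k}) (\<lambda>r c. coord g r (?v H c))}"
  have opB: "openin ?T (?B c)" if "c \<in> conds h i k" for c
  proof -
    obtain q J where c: "c = (q, J)" by (cases c)
    have "continuous_map ?T euclidean (\<lambda>H. coord g r (?v H x))" if "x \<in> J \<times> {..<k}" for r x
    proof -
      obtain j l where x: "x = (j, l)" by (cases x)
      then have "j \<in> {1..h}" using conds_subset \<open>c \<in> conds h i k\<close> that c by blast
      from continuous_map_coord[OF frame[OF this]] show ?thesis by (simp add: x)
    qed
    then show ?thesis unfolding c prod.case by (intro openin_indep_rows) simp_all
  qed
  have "openin ?T (topspace ?T \<inter> (\<Inter>c\<in>conds h i k. ?B c))"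
  proof (rule openin_Int_Inter)
    show "openin ?T X" if "X \<in> ?B ` conds h i k" for X using that opB by blast
  qed (auto intro: finite_conds simp del: topspace_subtopology)
  moreover have "topspace ?T \<inter> (\<Inter>c\<in>conds h i k. ?B c) = conf_chart h i k g"
  proof -
    have eq: "indep_rows {..<q} (J \<times> {..<k}) (\<lambda>r c. coord g r (?v H c)) \<longleftrightarrow> indep_rows {..<q} (\<Union>j\<in>J. H j) (coord g)"
      if "(q, J) \<in> conds h i k" "H \<in> A" for q J H
    proof -
      have "(\<Union>j\<in>J. vec.span ((\<lambda>l. ?v H (j, l)) ` {..<k})) = (\<Union>j\<in>J. H j)"
        using conds_subset[OF that(1)] that(2) by (intro SUP_cong) (auto simp: A_def span_nframe)
      then show ?thesis by (metis indep_rows_Union_span)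
    qed
    have sub: "conf_chart h i k g \<subseteq> A"
    proof
      fix H assume H: "H \<in> conf_chart h i k g"
      show "H \<in> A"
        using conf_chartD(1)[OF H] conf_chartD(3)[OF H] by (simp add: A_def topspace_ordered_conf_topology)
    qed
    have "A \<subseteq> ordered_conf h i k" by (auto simp: A_def topspace_ordered_conf_topology)
    show ?thesis
    proof (intro equalityI subsetI)
      fix H assume "H \<in> topspace ?T \<inter> (\<Inter>c\<in>conds h i k. ?B c)"
      then have "H \<in> A" "\<forall>(q, J)\<in>conds h i k. indep_rows {..<q} (J \<times> {..<k}) (\<lambda>r c. coord g r (?v H c))"
        unfolding topT by blast+
      then show "H \<in> conf_chart h i k g"
        using eq \<open>A \<subseteq> ordered_conf h i k\<close> unfolding conf_chart_def by blast
    next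
      fix H assume H: "H \<in> conf_chart h i k g"
      then have "H \<in> A" using sub by blast
      then show "H \<in> topspace ?T \<inter> (\<Inter>c\<in>conds h i k. ?B c)"
        using eq conf_chartD(2)[OF H] unfolding topT by blast
    qed
  qed
  ultimately have "openin ?T (conf_chart h i k g)" by (simp only:)
  then show ?thesis using A openin_trans_full by blast
qed

lemma invertible_if_indep_rows:
  fixes g :: "complex^'n^'n"
  assumes "indep_rows {..<CARD('n)} UNIV (coord g)"
  shows "invertible g"
proof -
  have "c a = 0" if c: "(\<Sum>b\<in>UNIV. c b *s row b g) = 0" for c :: "'n \<Rightarrow> complex" and a
  proof -
    have "(\<Sum>r<CARD('n). c (ix r) * coord g r x) = 0" for x
    proof -
      have "(\<Sum>r<CARD('n). c (ix r) * coord g r x) = (\<Sum>b\<in>UNIV. c b * (g *v x) $ b)"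
        unfolding coord_def by (rule sum.reindex_bij_betw[OF bij_ix, of "\<lambda>b. c b * (g *v x) $ b"])
      also have "\<dots> = (\<Sum>b\<in>UNIV. \<Sum>a\<in>UNIV. x $ a * (c b * g $ b $ a))"
        by (simp add: matrix_vector_mult_def sum_distrib_left algebra_simps)
      also have "\<dots> = (\<Sum>a\<in>UNIV. x $ a * (\<Sum>b\<in>UNIV. c b *s row b g) $ a)"
        by (subst sum.swap) (simp add: sum_component row_def sum_distrib_left)
      finally show ?thesis using c by simp
    qed
    then have "\<forall>r<CARD('n). c (ix r) = 0"
      using indep_rowsD[OF assms, of "\<lambda>r. c (ix r)"] by simp
    then show ?thesis using ix_surj[of a] by auto
  qed
  then show ?thesis
    unfolding invertible_right_inverse matrix_right_invertible_independent_rows by blast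
qed

lemma conf_chart_common:
  fixes H H' :: "nat \<Rightarrow> (complex^'n) set"
  assumes "H \<in> ordered_conf h i k" "H' \<in> ordered_conf h i k"
  shows "\<exists>g. invertible g \<and> H \<in> conf_chart h i k g \<and> H' \<in> conf_chart h i k g"
proof -
  \<comment> \<open>The index \<open>None\<close> asks for all coordinates on the whole space, which
    makes \<open>g\<close> invertible.\<close>
  let ?I = "insert None (Some ` ({H, H'} \<times> conds h i k))"
  define q where "q = (\<lambda>c::((nat \<Rightarrow> (complex^'n) set) \<times> nat \<times> nat set) option.
     case c of None \<Rightarrow> CARD('n) | Some (G, q, J) \<Rightarrow> q)"
  define S where "S = (\<lambda>c::((nat \<Rightarrow> (complex^'n) set) \<times> nat \<times> nat set) option.
     case c of None \<Rightarrow> UNIV | Some (G, q, J) \<Rightarrow> (\<Union>j\<in>J. G j))"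
  have "\<exists>g. \<forall>c\<in>?I. indep_rows {..<q c} (S c) (coord g)"
  proof (rule indep_rows_matrix_simultaneous)
    show "finite ?I" using finite_conds by auto
    fix c assume "c \<in> ?I"
    then show "q c \<le> vec.dim (S c)"
      using dim_le_conds[OF assms(1)] dim_le_conds[OF assms(2)]
      by (auto simp: q_def S_def card_cart_basis)
  qed
  then obtain g where g: "\<And>c. c \<in> ?I \<Longrightarrow> indep_rows {..<q c} (S c) (coord g)" by blast
  have "invertible g" using g[of None] by (intro invertible_if_indep_rows) (simp add: q_def S_def)
  moreover have "G \<in> conf_chart h i k g" if "G \<in> {H, H'}" for G
    using that assms g[of "Some (G, _, _)"] by (auto simp: conf_chart_def q_def S_def)
  ultimately show ?thesis by blast
qed

text \<open>A factorisation of the frames: \<open>a\<close> is a basis of the sum, \<open>B\<close>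
  the coefficients. Only \<open>i\<close> vectors occur in \<open>a\<close>, so any other
  \<open>a\<close> and \<open>B\<close> also give a sum of dimension at most
  \<open>i\<close>.\<close>

lemma conf_frames_exist:
  fixes H :: "nat \<Rightarrow> (complex^'n) set"
  assumes H: "H \<in> ordered_conf h i k"
  shows "\<exists>(a :: nat \<Rightarrow> complex^'n) B. H = conf_of h k (\<lambda>c. \<Sum>r<i. B r c *s a r)"
proof -
  obtain A where A: "A \<subseteq> (\<Union>j\<in>{1..h}. H j)" "vec.independent A" "(\<Union>j\<in>{1..h}. H j) \<subseteq> vec.span A"
    "card A = vec.dim (\<Union>j\<in>{1..h}. H j)"
    by (rule vec.basis_exists)
  have "finite A" using A(2) vec.independent_bound_general by blast
  moreover have "card A = i" using A(4) H by (simp add: ordered_conf_iff)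
  ultimately obtain a where "bij_betw a {..<i} A" by (metis bij_betw_from_nat_into_finite)
  then have a: "a ` {..<i} = A" by (simp add: bij_betw_def)
  have "\<forall>j\<in>{1..h}. \<exists>v. H j = vec.span (v ` {..<k})"
    using grassmannian_span ordered_conf_component[OF H] by blast
  then obtain v where v: "\<And>j. j \<in> {1..h} \<Longrightarrow> H j = vec.span (v j ` {..<k})" by metis
  have "\<exists>b. v j l = (\<Sum>r<i. b r *s a r)" if "j \<in> {1..h}" "l < k" for j l
  proof -
    have "v j l \<in> H j" using v[OF that(1)] that(2) by (auto intro: vec.span_base)
    then have "v j l \<in> vec.span (a ` {..<i})" using A(3) that(1) a by blast
    then show ?thesis by (auto simp: span_image_lessThan)
  qed
  then obtain b where b: "\<And>j l. j \<in> {1..h} \<Longrightarrow> l < k \<Longrightarrow> v j l = (\<Sum>r<i. b j l r *s a r)" by metis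
  have "conf_of h k (\<lambda>c. \<Sum>r<i. b (fst c) (snd c) r *s a r) = H"
  proof (rule conf_of_frames[OF H])
    fix j assume j: "j \<in> {1..h}"
    have "(\<lambda>l. \<Sum>r<i. b (fst (j, l)) (snd (j, l)) r *s a r) ` {..<k} = v j ` {..<k}"
      using b[OF j] by (intro image_cong) auto
    then show "H j = vec.span ((\<lambda>l. \<Sum>r<i. b (fst (j, l)) (snd (j, l)) r *s a r) ` {..<k})"
      using v[OF j] by simp
  qed
  then show ?thesis
    by (intro exI[of _ a] exI[of _ "\<lambda>r c. b (fst c) (snd c) r"]) simp
qed

text \<open>A straight line between frames could raise the dimension of the sum. Moving the
  \<open>i\<close> spanning vectors and the coefficients simultaneously keeps it at most
  \<open>i\<close>; the frames become quadratic in the parameter, and each chart condition still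
  fails only finitely often.\<close>

lemma conf_charts_Int_path:
  fixes H H' :: "nat \<Rightarrow> (complex^'n) set"
  assumes "H \<in> conf_chart h i k g \<inter> conf_chart h i k g'" "H' \<in> conf_chart h i k g \<inter> conf_chart h i k g'"
  shows "\<exists>p. pathin (ordered_conf_topology h i k) p \<and>
    p ` {0..1} \<subseteq> conf_chart h i k g \<inter> conf_chart h i k g' \<and> p 0 = H \<and> p 1 = H'"
proof -
  obtain a :: "nat \<Rightarrow> complex^'n" and B where aB: "H = conf_of h k (\<lambda>c. \<Sum>r<i. B r c *s a r)"
    using conf_frames_exist[of H h i k] assms(1) conf_chartD(1)[of H] by blast
  obtain a' :: "nat \<Rightarrow> complex^'n" and B' where aB': "H' = conf_of h k (\<lambda>c. \<Sum>r<i. B' r c *s a' r)"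
    using conf_frames_exist[of H' h i k] assms(2) conf_chartD(1)[of H'] by blast
  let ?B = "\<lambda>t r c. B r c + t * (B' r c - B r c)"
  let ?a = "\<lambda>t r. a r + t *s (a' r - a r)"
  define W where "W t c = (\<Sum>r<i. ?B t r c *s ?a t r)" for t c
  have W01: "H = conf_of h k (W 0)" "H' = conf_of h k (W 1)"
    by (simp_all add: W_def[abs_def] aB aB')
  let ?bad = "\<lambda>f t. \<exists>(q, J)\<in>conds h i k. \<not> indep_rows {..<q} (J \<times> {..<k}) (\<lambda>r c. coord f r (W t c))"
  have finbad: "finite {t. ?bad f t}" if "H \<in> conf_chart h i k f" for f
  proof -
    have "finite {t. \<not> indep_rows {..<q} (J \<times> {..<k}) (\<lambda>r c. coord f r (W t c))}"
      if qJ: "(q, J) \<in> conds h i k" for q J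
    proof (rule indep_rows_polyfun[where a = 0])
      show "indep_rows {..<q} (J \<times> {..<k}) (\<lambda>r c. coord f r (W 0 c))"
        using conf_chartD(2)[OF \<open>H \<in> conf_chart h i k f\<close> qJ] indep_rows_conf_of[OF conds_subset[OF qJ]]
        unfolding W01(1) by blast
      show "is_polyfun (\<lambda>t. coord f r (W t c))" for r c
        by (auto simp: W_def coord_sum coord_linear intro!: is_polyfun_sum is_polyfun_intros)
    qed simp
    then have "finite (\<Union>(q, J)\<in>conds h i k. {t. \<not> indep_rows {..<q} (J \<times> {..<k}) (\<lambda>r c. coord f r (W t c))})"
      using finite_conds by (intro finite_UN_I) auto
    then show ?thesis by (rule rev_finite_subset) auto
  qed
  have good: "conf_of h k (W t) \<in> conf_chart h i k f" if "\<not> ?bad f t" for f t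
  proof (rule conf_of_in_conf_chart)
    show "indep_rows {..<q} (J \<times> {..<k}) (\<lambda>r c. coord f r (W t c))" if "(q, J) \<in> conds h i k" for q J
      using that \<open>\<not> ?bad f t\<close> by blast
    have "vec.dim (?a t ` {..<i}) \<le> card (?a t ` {..<i})"
      by (rule vec.dim_le_card) (auto intro: vec.span_base)
    also have "\<dots> \<le> i" using card_image_le[of "{..<i}"] by simp
    finally show "vec.dim (?a t ` {..<i}) \<le> i" .
    show "W t ` ({1..h} \<times> {..<k}) \<subseteq> vec.span (?a t ` {..<i})"
      unfolding W_def using combination_in_span by (intro image_subsetI)
  qed
  let ?G = "\<lambda>t. conf_of h k (W t) \<in> conf_chart h i k g \<inter> conf_chart h i k g'"
  have "finite ({t. ?bad g t} \<union> {t. ?bad g' t})" using finbad assms(1) by auto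
  then have "finite {t. \<not> ?G t}" by (rule rev_finite_subset) (use good in blast)
  moreover have "?G 0" "?G 1" using assms W01 by auto
  ultimately obtain \<gamma> where \<gamma>: "path \<gamma>" "\<gamma> 0 = 0" "\<gamma> 1 = 1" "\<forall>t\<in>{0..1}. ?G (\<gamma> t)"
    using path_avoiding_finite[of ?G] by blast
  have "pathin (ordered_conf_topology h i k) (\<lambda>t. conf_of h k (W (\<gamma> t)))"
    unfolding pathin_def
  proof (rule continuous_map_conf_of)
    have g: "continuous_map (top_of_set {0..1}) euclidean \<gamma>" using \<gamma>(1) by (simp add: path_def)
    show "continuous_map (top_of_set {0..1}) euclidean (\<lambda>t. W (\<gamma> t) c)" for c
      unfolding W_def
      by (intro continuous_map_sum continuous_map_vec_scale continuous_map_add continuous_map_complex_mult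
          continuous_map_canonical_const g) auto
    show "conf_of h k (W (\<gamma> t)) \<in> ordered_conf h i k" if "t \<in> topspace (top_of_set {0..1})" for t
      using \<gamma>(4) that conf_chartD(1)[of _ h i k g] by simp
  qed
  then show ?thesis using \<gamma> W01 by (intro exI[of _ "\<lambda>t. conf_of h k (W (\<gamma> t))"]) auto
qed

section \<open>Contracting loops of configurations\<close>

lemma dual_basis_exists:
  fixes g :: "complex^'n^'n"
  assumes "invertible g"
  shows "\<exists>b. (\<forall>r<CARD('n). \<forall>s<CARD('n). coord g r (b s) = (if r = s then 1 else 0)) \<and>
    (\<forall>x. x = (\<Sum>r<CARD('n). coord g r x *s b r))"
proof -
  obtain g' where g': "g ** g' = mat 1" "g' ** g = mat 1" using assms by (auto simp: invertible_def)
  define b where "b r = g' *v axis (ix r) (1::complex)" for r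
  have "coord g r (b s) = (if r = s then 1 else 0)" if "r < CARD('n)" "s < CARD('n)" for r s
    using that ix_eq_iff[where 'n = 'n, of r s] by (simp add: coord_def b_def matrix_vector_mul_assoc g' axis_def)
  moreover have "x = (\<Sum>r<CARD('n). coord g r x *s b r)" for x
  proof -
    have "(\<Sum>r<CARD('n). coord g r x *s b r) = g' *v (\<Sum>r<CARD('n). coord g r x *s axis (ix r) 1)"
      by (simp add: b_def vec.linear_sum[OF matrix_vector_mul_linear_gen] vector_scalar_commute)
    also have "(\<Sum>r<CARD('n). coord g r x *s axis (ix r) 1) = (\<Sum>a\<in>UNIV. (g *v x) $ a *s axis a 1)"
      unfolding coord_def by (rule sum.reindex_bij_betw[OF bij_ix, of "\<lambda>a. (g *v x) $ a *s axis a 1"])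
    also have "\<dots> = g *v x" by (rule basis_expansion)
    finally show ?thesis by (simp add: matrix_vector_mul_assoc g')
  qed
  ultimately show ?thesis by blast
qed

lemma loop_hom_conf_of:
  fixes W :: "real \<times> real \<Rightarrow> nat \<times> nat \<Rightarrow> complex^'n"
  assumes "\<And>c. c \<in> {1..h} \<times> {..<k} \<Longrightarrow> continuous_map (top_of_set ({0..1} \<times> {0..1})) euclidean (\<lambda>y. W y c)"
    and "\<And>s t. s \<in> {0..1} \<Longrightarrow> t \<in> {0..1} \<Longrightarrow> conf_of h k (W (s, t)) \<in> ordered_conf h i k"
    and "\<And>s. s \<in> {0..1} \<Longrightarrow> W (s, 0) = W (s, 1)"
    and "\<And>t. t \<in> {0..1} \<Longrightarrow> p t = conf_of h k (W (0, t))" "\<And>t. t \<in> {0..1} \<Longrightarrow> q t = conf_of h k (W (1, t))"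
  shows "loop_hom (ordered_conf_topology h i k) p q"
proof (rule loop_homI)
  show "continuous_map (top_of_set ({0..1} \<times> {0..1})) (ordered_conf_topology h i k) (\<lambda>y. conf_of h k (W y))"
    using assms(1,2) by (intro continuous_map_conf_of) auto
qed (use assms(3-5) in auto)

lemma continuous_map_snd_square:
  assumes "continuous_map (top_of_set {0..1}) X f"
  shows "continuous_map (top_of_set ({0..1::real} \<times> {0..1::real})) X (\<lambda>y. f (snd y))"
proof -
  have "continuous_map (top_of_set ({0..1::real} \<times> {0..1::real})) X (f \<circ> snd)"
    by (rule continuous_map_compose[OF _ assms]) (auto intro!: continuous_intros)
  then show ?thesis by (simp add: o_def)
qed

lemma continuous_map_fst_square:
  "continuous_map (top_of_set ({0..1::real} \<times> {0..1::real})) euclidean (\<lambda>y. complex_of_real (fst y))"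
  by (auto intro!: continuous_intros)

lemma continuous_map_complex_diff:
  fixes f g :: "'a \<Rightarrow> 'b::real_normed_vector"
  assumes "continuous_map T euclidean f" "continuous_map T euclidean g"
  shows "continuous_map T euclidean (\<lambda>x. f x - g x)"
  using assms by (auto simp: continuous_map_atin intro!: tendsto_intros)

lemma continuous_map_nframe_path:
  fixes p :: "real \<Rightarrow> nat \<Rightarrow> (complex^'n) set"
  assumes "pathin (ordered_conf_topology h i k) p" "p ` {0..1} \<subseteq> conf_chart h i k g" "j \<in> {1..h}"
  shows "continuous_map (top_of_set {0..1}) euclidean (\<lambda>t. nframe g k (p t j) l)"
proof -
  have "continuous_map (top_of_set {0..1}) (grassmannian_topology k) (\<lambda>t. p t j)"
    using continuous_map_compose[OF assms(1)[unfolded pathin_def] continuous_map_component[OF assms(3)]]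
    by (simp add: o_def)
  moreover have "p t j \<in> chart g k" if "t \<in> {0..1}" for t
    using conf_chartD(3)[of "p t" h i k g j] assms(2,3) that by blast
  ultimately have "continuous_map (top_of_set {0..1}) (subtopology (grassmannian_topology k) (chart g k)) (\<lambda>t. p t j)"
    by (intro continuous_map_into_subtopology) auto
  from continuous_map_compose[OF this continuous_map_nframe, of l] show ?thesis by (simp add: o_def)
qed

lemma conf_chart_frames_indep:
  fixes H :: "nat \<Rightarrow> (complex^'n) set"
  assumes "H \<in> conf_chart h i k g" "(q, J) \<in> conds h i k"
  shows "indep_rows {..<q} (J \<times> {..<k}) (\<lambda>r c. coord g r (case c of (j, l) \<Rightarrow> nframe g k (H j) l))"
  using conf_chartD(2)[OF assms] indep_rows_conf_of[OF conds_subset[OF assms(2)]]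
    conf_chart_frames[OF assms(1)] by metis

lemma ordered_conf_dim_le:
  fixes H :: "nat \<Rightarrow> (complex^'n) set"
  assumes "H \<in> ordered_conf h i k"
  shows "i \<le> CARD('n)" "i \<le> h * k"
proof -
  have i: "i = vec.dim (\<Union>j\<in>{1..h}. H j)" using assms by (simp add: ordered_conf_iff)
  then show "i \<le> CARD('n)"
    using vec.dim_subset[of "\<Union>j\<in>{1..h}. H j" UNIV] by (simp add: card_cart_basis)
  obtain g where g: "H \<in> conf_chart h i k g" using conf_chart_common[OF assms assms] by blast
  let ?u = "\<lambda>(j, l). nframe g k (H j) l"
  have "(\<Union>j\<in>{1..h}. H j) \<subseteq> vec.span (?u ` ({1..h} \<times> {..<k}))"
  proof (rule UN_least)
    fix j assume j: "j \<in> {1..h}"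
    have "vec.span (nframe g k (H j) ` {..<k}) \<subseteq> vec.span (?u ` ({1..h} \<times> {..<k}))"
      using j by (intro vec.span_mono) force
    then show "H j \<subseteq> vec.span (?u ` ({1..h} \<times> {..<k}))" using span_nframe[OF conf_chartD(3)[OF g j]] by simp
  qed
  then have "i \<le> card (?u ` ({1..h} \<times> {..<k}))" unfolding i by (intro vec.dim_le_card) auto
  also have "\<dots> \<le> h * k"
    using card_image_le[of "{1..h} \<times> {..<k}" ?u] by (simp add: card_cartesian_product)
  finally show "i \<le> h * k" .
qed

section \<open>Sums that are not direct: compression to \<open>i\<close> coordinates\<close>

lemma coord_dual_combination:
  assumes b: "\<forall>r<CARD('n). \<forall>s<CARD('n). coord g r (b s) = (if r = s then 1 else 0)"
    and "m \<le> CARD('n)" "r < CARD('n)"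
  shows "coord g r (\<Sum>s<m. a s *s b s :: complex^'n) = (if r < m then a r else 0)"
proof -
  have "coord g r (\<Sum>s<m. a s *s b s) = (\<Sum>s<m. if s = r then a s else 0)"
    unfolding coord_sum coord_linear using b assms(2,3) by (intro sum.cong) auto
  then show ?thesis by simp
qed

text \<open>Columns become vectors in the span of the first \<open>i\<close> dual basis vectors,
  where the coordinates of \<open>g\<close> give back the matrix entries. Flag conditions do not
  arise, as \<open>i < h * k\<close>.\<close>

lemma continuous_map_conf_matrices:
  fixes g :: "complex^'n^'n"
  assumes b: "\<forall>r<CARD('n). \<forall>s<CARD('n). coord g r (b s) = (if r = s then 1 else 0)"
    and i: "i \<le> CARD('n)" "i < h * k" "k < i"
  shows "continuous_map (top_of_set (conf_matrices h i k)) (ordered_conf_topology h i k)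
    (\<lambda>M. conf_of h k (\<lambda>c. \<Sum>r<i. M r c *s b r))"
proof (rule continuous_map_conf_of)
  show "continuous_map (top_of_set (conf_matrices h i k)) euclidean (\<lambda>M. \<Sum>r<i. M r c *s b r)" for c
  proof (intro continuous_map_sum continuous_map_vec_scale continuous_map_canonical_const)
    show "continuous_map (top_of_set (conf_matrices h i k)) euclidean (\<lambda>M. M r c)" for r
    proof -
      have "continuous_on (conf_matrices h i k) (\<lambda>M. M r c)"
        using continuous_on_entries[of "conf_matrices h i k" "\<lambda>M. M"] continuous_on_id by blast
      then show ?thesis by simp
    qed
  qed auto
  fix M assume "M \<in> topspace (top_of_set (conf_matrices h i k))"
  then have M: "M \<in> conf_matrices h i k" by simp
  have "conf_of h k (\<lambda>c. \<Sum>r<i. M r c *s b r) \<in> conf_chart h i k g"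
  proof (rule conf_of_in_conf_chart)
    fix q J assume qJ: "(q, J) \<in> conds h i k"
    have "q \<le> i \<and> indep_rows {..<q} (J \<times> {..<k}) M"
      using qJ
    proof (cases rule: conds_cases)
      case (one j)
      have "w r = 0" if w: "\<forall>c\<in>{j} \<times> {..<k}. (\<Sum>r<k. w r * M r c) = 0" and r: "r < k" for w r
      proof -
        have "(\<Sum>s<k. w s * M s (j, r)) = (\<Sum>s<k. if s = r then w s else 0)"
          using conf_matricesD(1)[OF M] by (intro sum.cong) auto
        then show ?thesis using w r by simp
      qed
      then show ?thesis using one i by (simp add: indep_rows_def)
    next
      case (two j j')
      then show ?thesis using conf_matricesD(3)[OF M two(1-3)] i by simp
    next
      case all
      then show ?thesis using conf_matricesD(2)[OF M] by simp
    next
      case (flag m)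
      then show ?thesis using i by simp
    qed
    then have q: "q \<le> i" and ind: "indep_rows {..<q} (J \<times> {..<k}) M" by auto
    have "indep_rows {..<q} (J \<times> {..<k}) (\<lambda>r c. coord g r (\<Sum>r<i. M r c *s b r)) = indep_rows {..<q} (J \<times> {..<k}) M"
      using q i(1) by (intro indep_rows_cong) (simp add: coord_dual_combination[OF b])
    then show "indep_rows {..<q} (J \<times> {..<k}) (\<lambda>r c. coord g r (\<Sum>r<i. M r c *s b r))" using ind by simp
  next
    have "vec.dim (b ` {..<i}) \<le> card (b ` {..<i})" by (rule vec.dim_le_card) (auto intro: vec.span_base)
    also have "\<dots> \<le> i" using card_image_le[of "{..<i}" b] by simp
    finally show "vec.dim (b ` {..<i}) \<le> i" .
    show "(\<lambda>c. \<Sum>r<i. M r c *s b r) ` ({1..h} \<times> {..<k}) \<subseteq> vec.span (b ` {..<i})"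
      using combination_in_span by (intro image_subsetI)
  qed
  then show "conf_of h k (\<lambda>c. \<Sum>r<i. M r c *s b r) \<in> ordered_conf h i k" by (rule conf_chartD(1))
qed

text \<open>Scaling the coordinates from \<open>i\<close> on down to zero is linear, so it cannot
  raise the dimension of the sum, and all conditions involve lower coordinates only. At the end the
  loop comes from a loop of matrices.\<close>

lemma conf_chart_loop_null:
  fixes g :: "complex^'n^'n"
  assumes p: "pathin (ordered_conf_topology h i k) p" "p ` {0..1} \<subseteq> conf_chart h i k g"
    and p01: "p 0 = p 1" and g: "invertible g" and k: "2 \<le> k" "k < i" "i < h * k"
  shows "loop_null (ordered_conf_topology h i k) p"
proof -
  let ?F = "ordered_conf_topology h i k :: (nat \<Rightarrow> (complex^'n) set) topology"
  let ?n = "CARD('n)"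
  let ?C = "{1..h} \<times> {..<k}"
  obtain b where b: "\<forall>r<?n. \<forall>s<?n. coord g r (b s) = (if r = s then 1 else 0)"
    "\<And>x. x = (\<Sum>r<?n. coord g r x *s b r)"
    using dual_basis_exists[OF g] by blast
  have pt: "p t \<in> conf_chart h i k g" if "t \<in> {0..1}" for t using p(2) that by blast
  have i: "i \<le> ?n" using ordered_conf_dim_le(1)[OF conf_chartD(1)[OF pt[of 0]]] by simp
  define u where "u t = (\<lambda>(j, l). nframe g k (p t j) l)" for t
  have ucont: "continuous_map (top_of_set {0..1}) euclidean (\<lambda>t. u t c)" if "c \<in> ?C" for c
    using continuous_map_nframe_path[OF p] that by (cases c) (auto simp: u_def)
  have uind: "indep_rows {..<q} (J \<times> {..<k}) (\<lambda>r c. coord g r (u t c))"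
    if "(q, J) \<in> conds h i k" "t \<in> {0..1}" for q J t
    using conf_chart_frames_indep[OF pt[OF that(2)] that(1)] by (simp add: u_def)
  have u1: "coord g r (u t (j, l)) = (if r = l then 1 else 0)" if "t \<in> {0..1}" "j \<in> {1..h}" "r < k" for t j l r
    using nframe(2)[OF conf_chartD(3)[OF pt[OF that(1)] that(2)] that(3)] by (simp add: u_def)
  have uH: "u t (j, l) \<in> p t j" if "t \<in> {0..1}" "j \<in> {1..h}" for t j l
    using nframe(1)[OF conf_chartD(3)[OF pt[OF that(1)] that(2)]] by (simp add: u_def)
  define d where "d s r = (if r < i then 1 else 1 - complex_of_real s)" for s r
  define D where "D s x = (\<Sum>r<?n. (d s r * coord g r x) *s b r)" for s x
  have lin: "Vector_Spaces.linear (*s) (*s) (D s)" for s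
    by unfold_locales
      (simp_all add: D_def coord_linear algebra_simps sum.distrib vec.scale_left_distrib vec.scale_sum_right)
  have coordD: "coord g r (D s x) = d s r * coord g r x" if "r < ?n" for r s x
    unfolding D_def using coord_dual_combination[OF b(1) order_refl that] that by simp
  define W where "W y c = D (fst y) (u (snd y) c)" for y c
  \<comment> \<open>Columns outside the configuration are filled with the identity pattern and
    zeros, as \<open>conf_matrices\<close> fixes the first \<open>k\<close> rows in every
    column.\<close>
  define M where "M t r = (\<lambda>(j, l). if r < k then (if l = r then 1 else 0)
      else if (j, l) \<in> ?C then coord g r (u t (j, l)) else 0)" for t r
  have Mu: "M t r c = coord g r (u t c)" if "c \<in> ?C" "t \<in> {0..1}" for t r c
    using that u1[OF that(2)] by (cases c) (auto simp: M_def)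
  have hom: "loop_hom ?F p (\<lambda>t. conf_of h k (\<lambda>c. \<Sum>r<i. M t r c *s b r))"
  proof (rule loop_hom_conf_of[where W = W])
    show "continuous_map (top_of_set ({0..1} \<times> {0..1})) euclidean (\<lambda>y. W y c)" if "c \<in> ?C" for c
    proof -
      have "continuous_map (top_of_set ({0..1} \<times> {0..1})) euclidean (\<lambda>y. d (fst y) r)" for r
        unfolding d_def by (cases "r < i") (auto intro!: continuous_intros)
      then show ?thesis
        unfolding W_def D_def
        by (intro continuous_map_sum continuous_map_vec_scale continuous_map_complex_mult
            continuous_map_coord continuous_map_canonical_const continuous_map_snd_square[OF ucont[OF that]]) auto
    qed
    show "conf_of h k (W (s, t)) \<in> ordered_conf h i k" if st: "s \<in> {0..1}" "t \<in> {0..1}" for s t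
    proof (rule conf_chartD(1)[OF conf_of_in_conf_chart])
      fix q J assume qJ: "(q, J) \<in> conds h i k"
      have "q \<le> i" using conds_le[OF conf_chartD(1)[OF pt[OF st(2)]] qJ] .
      then have "indep_rows {..<q} (J \<times> {..<k}) (\<lambda>r c. coord g r (W (s, t) c))
          = indep_rows {..<q} (J \<times> {..<k}) (\<lambda>r c. coord g r (u t c))"
        using i by (intro indep_rows_cong) (simp add: W_def coordD d_def)
      then show "indep_rows {..<q} (J \<times> {..<k}) (\<lambda>r c. coord g r (W (s, t) c))"
        using uind[OF qJ st(2)] by simp
    next
      let ?S = "\<Union>j\<in>{1..h}. p t j"
      have "vec.dim (D s ` ?S) \<le> vec.dim ?S" by (rule vec.dim_image_le[OF lin])
      also have "\<dots> = i" using conf_chartD(1)[OF pt[OF st(2)]] by (simp add: ordered_conf_iff)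
      finally show "vec.dim (D s ` ?S) \<le> i" .
      show "W (s, t) ` ?C \<subseteq> vec.span (D s ` ?S)"
      proof (intro image_subsetI vec.span_base)
        fix c assume "c \<in> ?C"
        then show "W (s, t) c \<in> D s ` ?S" using uH[OF st(2)] by (cases c) (force simp: W_def)
      qed
    qed
    show "W (s, 0) = W (s, 1)" for s using p01 by (simp add: W_def[abs_def] u_def)
    have D0: "D 0 x = x" for x 
    proof -
      have "d 0 r = 1" for r by (simp add: d_def)
      then show ?thesis unfolding D_def using b(2)[of x] by simp
    qed
    show "p t = conf_of h k (W (0, t))" if "t \<in> {0..1}" for t
      using conf_chart_frames[OF pt[OF that]] by (simp add: W_def[abs_def] D0 u_def)
    show "conf_of h k (\<lambda>c. \<Sum>r<i. M t r c *s b r) = conf_of h k (W (1, t))" if t: "t \<in> {0..1}" for t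
    proof (rule conf_of_cong)
      fix j assume j: "j \<in> {1..h}"
      have "(\<Sum>r<i. M t r (j, l) *s b r) = W (1, t) (j, l)" if "l < k" for l
      proof -
        have "W (1, t) (j, l) = (\<Sum>r<?n. (d 1 r * M t r (j, l)) *s b r)"
          using Mu[of "(j, l)", OF _ t] j that by (simp add: W_def D_def)
        also have "\<dots> = (\<Sum>r<i. M t r (j, l) *s b r)"
          using i by (intro sum.mono_neutral_cong_right) (auto simp: d_def)
        finally show ?thesis by simp
      qed
      then show "vec.span ((\<lambda>l. \<Sum>r<i. M t r (j, l) *s b r) ` {..<k}) = vec.span ((\<lambda>l. W (1, t) (j, l)) ` {..<k})"
        by (metis (no_types, lifting) image_cong lessThan_iff)
    qed
  qed
  have Mc: "M t \<in> conf_matrices h i k" if t: "t \<in> {0..1}" for t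
    unfolding conf_matrices_def
  proof (intro CollectI conjI ballI impI allI)
    have eq: "indep_rows R (J \<times> {..<k}) (M t) = indep_rows R (J \<times> {..<k}) (\<lambda>r c. coord g r (u t c))"
      if "J \<subseteq> {1..h}" for R :: "nat set" and J
      using Mu[OF _ t] that by (intro indep_rows_cong) auto
    show "M t r (j, l) = (if l = r then 1 else 0)" if "r < k" for r j l using that by (simp add: M_def)
    show "indep_rows {..<i} ?C (M t)"
      using eq[OF order_refl] uind[OF condsI(3) t] by simp
    show "indep_rows {..<Suc k} ({j, j'} \<times> {..<k}) (M t)" if "j \<in> {1..h}" "j' \<in> {1..h}" "j \<noteq> j'" for j j'
      using eq[of "{j, j'}"] uind[OF condsI(2)[OF that] t] that by simp
  qed
  have "pathin (top_of_set (conf_matrices h i k)) M"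
  proof -
    have "continuous_on {0..1} (\<lambda>t. M t r c)" for r c
    proof -
      have "continuous_on {0..1} (\<lambda>t. coord g r (u t c))" if "c \<in> ?C"
        using continuous_map_coord[OF ucont[OF that], of g r] by simp
      then show ?thesis
        by (cases c; cases "r < k"; cases "c \<in> ?C") (simp_all add: M_def del: atLeastAtMost_iff mem_Sigma_iff)
    qed
    then have "continuous_on {0..1} M" using continuous_on_entries[of "{0..1}" M] by blast
    then show ?thesis using Mc by (auto simp: pathin_def)
  qed
  moreover have u01: "u 0 = u 1" using p01 by (simp add: u_def)
  have "M 0 = M 1" unfolding M_def u01 ..
  ultimately have "loop_null (top_of_set (conf_matrices h i k)) M"
    using simply_connected_conf_matrices[OF Mc[of 0] k] by (simp add: simply_connected_top_def)
  from loop_null_image[OF this continuous_map_conf_matrices[OF b(1) i k(3,2)]]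
  have "loop_null ?F (\<lambda>t. conf_of h k (\<lambda>c. \<Sum>r<i. M t r c *s b r))" by (simp add: o_def)
  then show ?thesis using hom loop_hom_null by blast
qed

section \<open>Direct sums: straightening the flag of partial sums\<close>

lemma conf_of_in_ordered_conf_direct_sum:
  fixes v :: "nat \<times> nat \<Rightarrow> complex^'n"
  assumes i: "h * k = i" and k: "1 \<le> k" and dim: "i \<le> vec.dim (v ` ({1..h} \<times> {..<k}))"
  shows "conf_of h k v \<in> ordered_conf h i k"
proof -
  let ?C = "{1..h} \<times> {..<k}"
  \<comment> \<open>At most \<open>h * k\<close> vectors that span at least \<open>i = h * k\<close>
    dimensions are distinct and independent; every dimension is then a matter of counting.\<close>
  have "vec.dim (v ` ?C) \<le> card (v ` ?C)" by (rule vec.dim_le_card) (auto intro: vec.span_base)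
  moreover have "card (v ` ?C) \<le> i"
    using card_image_le[of ?C v] i by (simp add: card_cartesian_product)
  ultimately have card: "card (v ` ?C) = i" "vec.dim (v ` ?C) = i" using dim by auto
  then have inj: "inj_on v ?C" using i by (intro eq_card_imp_inj_on) (simp_all add: card_cartesian_product)
  have ind: "vec.independent (v ` ?C)"
    by (rule vec.card_le_dim_spanning[of _ "v ` ?C"]) (use card in \<open>auto intro: vec.span_base\<close>)
  have dimC: "vec.dim (v ` D) = card D" if "D \<subseteq> ?C" for D
    using vec.dim_eq_card_independent[OF vec.independent_mono[OF ind image_mono[OF that]]]
      card_image[OF inj_on_subset[OF inj that]] by simp
  have im: "(\<lambda>l. v (j, l)) ` {..<k} = v ` ({j} \<times> {..<k})" for j by auto
  have gr: "conf_of h k v j \<in> grassmannian k" if j: "j \<in> {1..h}" for j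
  proof -
    have "vec.dim (v ` ({j} \<times> {..<k})) = k"
    proof -
      have "{j} \<times> {..<k} \<subseteq> ?C" using j by auto
      from dimC[OF this] show ?thesis by (simp add: card_cartesian_product)
    qed
    then show ?thesis unfolding conf_of_apply[OF j] im grassmannian_def by (simp add: vec.dim_span)
  qed
  have un: "vec.span (\<Union>j\<in>J. conf_of h k v j) = vec.span (v ` (J \<times> {..<k}))" if "J \<subseteq> {1..h}" for J
  proof
    have "conf_of h k v j \<subseteq> vec.span (v ` (J \<times> {..<k}))" if "j \<in> J" for j
    proof -
      have "j \<in> {1..h}" using that \<open>J \<subseteq> {1..h}\<close> by blast
      show ?thesis unfolding conf_of_apply[OF \<open>j \<in> {1..h}\<close>] im using that by (intro vec.span_mono) auto
    qed
    then show "vec.span (\<Union>j\<in>J. conf_of h k v j) \<subseteq> vec.span (v ` (J \<times> {..<k}))"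
      by (intro vec.span_minimal) auto
    have "v (j, l) \<in> conf_of h k v j" if "j \<in> J" "l < k" for j l
    proof -
      have "j \<in> {1..h}" using that \<open>J \<subseteq> {1..h}\<close> by blast
      show ?thesis unfolding conf_of_apply[OF \<open>j \<in> {1..h}\<close>] using that by (intro vec.span_base) auto
    qed
    then show "vec.span (v ` (J \<times> {..<k})) \<subseteq> vec.span (\<Union>j\<in>J. conf_of h k v j)"
      by (intro vec.span_mono) blast
  qed
  have dimJ: "vec.dim (\<Union>j\<in>J. conf_of h k v j) = card J * k" if "J \<subseteq> {1..h}" for J
  proof -
    have "vec.dim (\<Union>j\<in>J. conf_of h k v j) = vec.dim (v ` (J \<times> {..<k}))"
      using un[OF that] by (metis vec.dim_span)
    also have "\<dots> = card J * k" using dimC[of "J \<times> {..<k}"] that by (auto simp: card_cartesian_product)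
    finally show ?thesis .
  qed
  have "inj_on (conf_of h k v) {1..h}"
  proof (rule inj_onI, rule ccontr)
    fix j j' assume j: "j \<in> {1..h}" "j' \<in> {1..h}" and eq: "conf_of h k v j = conf_of h k v j'" and "j \<noteq> j'"
    have "vec.dim (conf_of h k v j) = 2 * k" using dimJ[of "{j, j'}"] j eq \<open>j \<noteq> j'\<close> by simp
    moreover have "vec.dim (conf_of h k v j) = k" using gr[OF j(1)] by (simp add: grassmannian_def)
    ultimately show False using k by simp
  qed
  then show ?thesis
    unfolding ordered_conf_iff using gr dimJ[of "{1..h}"] i by (auto simp: conf_of_def)
qed

text \<open>The frames of the first \<open>m\<close> entries are concatenated: vector
  \<open>c\<close> belongs to entry \<open>c div k + 1\<close>, at place \<open>c mod k\<close>.
  Since \<open>m * k\<close> vectors generate and \<open>m * k\<close> coordinates are independent,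
  the partial sum has dimension \<open>m * k\<close>.\<close>

lemma flag_in_chart:
  fixes H :: "nat \<Rightarrow> (complex^'n) set"
  assumes H: "H \<in> conf_chart h i k g" and i: "h * k = i" and k: "1 \<le> k" and m: "m \<in> {1..h}"
  shows "vec.span (\<Union>j\<in>{1..m}. H j)
      = vec.span ((\<lambda>c. nframe g k (H (Suc (c div k))) (c mod k)) ` {..<m * k})" (is "?S = vec.span (?f ` _)")
    and "vec.span (\<Union>j\<in>{1..m}. H j) \<in> chart g (m * k)"
proof -
  have gen: "vec.span (nframe g k (H j) ` {..<k}) = H j" if "j \<in> {1..m}" for j
    using span_nframe[OF conf_chartD(3)[OF H, of j]] that m by simp
  show eq: "?S = vec.span (?f ` {..<m * k})"
  proof
    have "H j \<subseteq> vec.span (?f ` {..<m * k})" if j: "j \<in> {1..m}" for j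
    proof -
      have "nframe g k (H j) l \<in> ?f ` {..<m * k}" if l: "l < k" for l
      proof (rule image_eqI[of _ _ "(j - 1) * k + l"])
        show "nframe g k (H j) l = ?f ((j - 1) * k + l)" using l j by simp
        have "(j - 1) * k + l < (j - 1) * k + k" using l by simp
        also have "\<dots> = j * k" using j by (cases j) auto
        also have "\<dots> \<le> m * k" using j by simp
        finally show "(j - 1) * k + l \<in> {..<m * k}" by simp
      qed
      then have "vec.span (nframe g k (H j) ` {..<k}) \<subseteq> vec.span (?f ` {..<m * k})"
        by (intro vec.span_mono) auto
      then show ?thesis using gen[OF j] by simp
    qed
    then show "?S \<subseteq> vec.span (?f ` {..<m * k})"
      by (rule vec.span_minimal[OF UN_least vec.subspace_span])
    have "?f c \<in> (\<Union>j\<in>{1..m}. H j)" if "c < m * k" for c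
    proof -
      have "c div k < m" using that by (simp add: less_mult_imp_div_less)
      then have j: "Suc (c div k) \<in> {1..m}" by simp
      then show ?thesis using nframe(1)[OF conf_chartD(3)[OF H, of "Suc (c div k)"]] m by fastforce
    qed
    then show "vec.span (?f ` {..<m * k}) \<subseteq> ?S" by (intro vec.span_mono) auto
  qed
  have ind: "indep_rows {..<m * k} ?S (coord g)"
    using conf_chartD(2)[OF H condsI(4)[OF m i]] by (simp add: indep_rows_span)
  have "vec.dim ?S \<le> card (?f ` {..<m * k})" unfolding eq by (rule vec.dim_le_card) auto
  also have "\<dots> \<le> m * k" using card_image_le[of "{..<m * k}" ?f] by simp
  finally have "vec.dim ?S = m * k" using indep_rows_dim_le[OF ind] by simp
  then show "?S \<in> chart g (m * k)" using ind by (simp add: chart_def grassmannian_def)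
qed

text \<open>\<open>V\<close> removes from each entry its projection to the previous partial sum,
  which ends in subspaces depending on the flag alone. \<open>Y\<close> then moves their normalised
  frames linearly to the dual basis. Both are triangular changes, so independence persists.\<close>

lemma conf_chart_loop_null_direct_sum:
  fixes g :: "complex^'n^'n"
  assumes p: "pathin (ordered_conf_topology h i k) p" "p ` {0..1} \<subseteq> conf_chart h i k g"
    and p01: "p 0 = p 1" and g: "invertible g" and k: "1 \<le> k" and hk: "h * k = i"
  shows "loop_null (ordered_conf_topology h i k) p"
proof -
  let ?F = "ordered_conf_topology h i k :: (nat \<Rightarrow> (complex^'n) set) topology"
  let ?n = "CARD('n)"
  let ?C = "{1..h} \<times> {..<k}"
  let ?I = "top_of_set {0..1::real}"
  let ?Q = "top_of_set ({0..1::real} \<times> {0..1::real})"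
  obtain b where b: "\<forall>r<?n. \<forall>s<?n. coord g r (b s) = (if r = s then 1 else 0)"
    using dual_basis_exists[OF g] by blast
  have pt: "p t \<in> conf_chart h i k g" if "t \<in> {0..1}" for t using p(2) that by blast
  have i: "i \<le> ?n" using ordered_conf_dim_le(1)[OF conf_chartD(1)[OF pt[of 0]]] by simp
  define u where "u t = (\<lambda>(j, l). nframe g k (p t j) l)" for t
  have ucont: "continuous_map ?I euclidean (\<lambda>t. u t c)" if "c \<in> ?C" for c
    using continuous_map_nframe_path[OF p] that by (cases c) (auto simp: u_def)
  define F where "F t m = vec.span (\<Union>j\<in>{1..m}. p t j)" for t m
  define e where "e t m = nframe g (m * k) (F t m)" for t m
  \<comment> \<open>\<open>P t m\<close> is the projection onto \<open>F t m\<close> along the vectors whose first \<open>m * k\<close> coordinates vanish.\<close>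
  define P where "P t m x = (\<Sum>q<m * k. coord g q x *s e t m q)" for t m x
  have Fch: "F t m \<in> chart g (m * k)" if "t \<in> {0..1}" "m \<in> {1..h}" for t m
    using flag_in_chart(2)[OF pt[OF that(1)] hk k that(2)] by (simp add: F_def)
  have Fsub: "vec.subspace (F t m)" for t m by (simp add: F_def)
  have Fmono: "F t m \<subseteq> F t m'" if "m \<le> m'" for t m m'
    unfolding F_def using that by (intro vec.span_mono UN_mono) auto
  have pF: "p t j \<subseteq> F t m" if "j \<in> {1..m}" for t j m
    unfolding F_def by (rule order_trans[OF _ vec.span_superset]) (use that in auto)
  have e: "e t m q \<in> F t m" "r < m * k \<Longrightarrow> coord g r (e t m q) = (if r = q then 1 else 0)"
    if "t \<in> {0..1}" "m \<in> {1..h}" for t m q r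
    using nframe(1,2)[OF Fch[OF that]] by (simp_all add: e_def)
  have econt: "continuous_map ?I euclidean (\<lambda>t. e t m q)" if m: "m \<in> {1..h}" for m q
  proof -
    let ?f = "\<lambda>t c. u t (Suc (c div k), c mod k)"
    have Feq: "F t m = vec.span (?f t ` {..<m * k})" if "t \<in> {0..1}" for t
      using flag_in_chart(1)[OF pt[OF that] hk k m] by (simp add: F_def u_def)
    have "continuous_map ?I (grassmannian_topology (m * k)) (\<lambda>t. vec.span (?f t ` {..<m * k}))"
    proof (rule continuous_map_span)
      show "continuous_map ?I euclidean (\<lambda>t. ?f t c)" if "c < m * k" for c
      proof (rule ucont)
        have "c div k < m" using that by (simp add: less_mult_imp_div_less)
        then show "(Suc (c div k), c mod k) \<in> ?C" using m k by auto
      qed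
      show "vec.dim (vec.span (?f t ` {..<m * k})) = m * k" if "t \<in> topspace ?I" for t
        using Fch[of t m] m that unfolding Feq[of t, symmetric, OF that[simplified topspace_euclidean_subtopology]]
        by (simp add: chart_def grassmannian_def)
    qed
    then have "continuous_map ?I (grassmannian_topology (m * k)) (\<lambda>t. F t m)"
      by (rule continuous_map_eq) (simp add: Feq)
    then have "continuous_map ?I (subtopology (grassmannian_topology (m * k)) (chart g (m * k))) (\<lambda>t. F t m)"
      using Fch m by (intro continuous_map_into_subtopology) auto
    from continuous_map_compose[OF this continuous_map_nframe, of q] show ?thesis by (simp add: o_def e_def)
  qed
  have P0: "P t 0 x = 0" for t x by (simp add: P_def)
  have PF: "P t m x \<in> F t m" if "t \<in> {0..1}" "m \<le> h" for t m x
  proof (cases "m = 0")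
    case True
    then show ?thesis using vec.subspace_0[OF Fsub] by (simp add: P0)
  next
    case False
    then have m: "m \<in> {1..h}" using that by simp
    show ?thesis unfolding P_def
      by (intro vec.subspace_sum[OF Fsub] vec.subspace_scale[OF Fsub] e(1)[OF that(1) m])
  qed
  have coordP: "coord g r (P t m x) = coord g r x" if "t \<in> {0..1}" "m \<le> h" "r < m * k" for t m r x
  proof -
    have m: "m \<in> {1..h}" using that by (cases m) auto
    have "coord g r (P t m x) = (\<Sum>q<m * k. if q = r then coord g q x else 0)"
      unfolding P_def coord_sum coord_linear using e(2)[OF that(1) m that(3)] by (intro sum.cong) auto
    then show ?thesis using that(3) by simp
  qed
  \<comment> \<open>The subtracted vector lies in the previous partial sum, so all \<open>V\<close>
    span the same total space. At 1 the first \<open>(j - 1) * k\<close> coordinates are cleared;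
    for j = 1 the projection \<open>P t 0\<close> is zero.\<close>
  define V where "V y = (\<lambda>(j, l). u (snd y) (j, l) - complex_of_real (fst y) *s P (snd y) (j - 1) (u (snd y) (j, l)))" for y
  \<comment> \<open>The last \<open>k\<close> of the \<open>j * k\<close> normalised vectors of the
    partial sum, namely those with vanishing first \<open>(j - 1) * k\<close> coordinates.\<close>
  define K where "K t = (\<lambda>(j, l). e t j ((j - 1) * k + l))" for t
  define Y where "Y y = (\<lambda>(j, l). (1 - complex_of_real (fst y)) *s K (snd y) (j, l)
      + complex_of_real (fst y) *s b ((j - 1) * k + l))" for y
  have uspan: "vec.span ((\<lambda>l. u t (j, l)) ` {..<k}) = p t j" if "t \<in> {0..1}" "j \<in> {1..h}" for t j
    using span_nframe[OF conf_chartD(3)[OF pt[OF that(1)] that(2)]] by (simp add: u_def)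
  have V_conf: "conf_of h k (V (s, t)) \<in> ordered_conf h i k" if t: "t \<in> {0..1}" for s t
  proof (rule conf_of_in_ordered_conf_direct_sum[OF hk k])
    let ?S = "vec.span (V (s, t) ` ?C)"
    have "p t j \<subseteq> ?S" if "j \<in> {1..h}" for j
      using that
    \<comment> \<open>The subtracted term lies in the sum of the earlier entries, which is contained
      in \<open>?S\<close> by induction; adding it back recovers the frame of entry
      \<open>j\<close>.\<close>
    proof (induction j rule: less_induct)
      case (less j)
      have "F t (j - 1) \<subseteq> ?S"
        unfolding F_def
      proof (rule vec.span_minimal[OF UN_least vec.subspace_span])
        fix j' assume "j' \<in> {1..j - 1}"
        then show "p t j' \<subseteq> ?S" using less.prems by (intro less.IH) auto
      qed
      then have "P t (j - 1) x \<in> ?S" for x using PF[OF t, of "j - 1"] less.prems by auto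
      moreover have "V (s, t) (j, l) \<in> ?S" if "l < k" for l using that less.prems by (intro vec.span_base) auto
      ultimately have "V (s, t) (j, l) + complex_of_real s *s P t (j - 1) (u t (j, l)) \<in> ?S" if "l < k" for l
        using that by (intro vec.span_add vec.span_scale)
      then have "u t (j, l) \<in> ?S" if "l < k" for l using that by (simp add: V_def)
      then have "vec.span ((\<lambda>l. u t (j, l)) ` {..<k}) \<subseteq> ?S" by (intro vec.span_minimal) auto
      then show ?case using uspan[OF t less.prems] by simp
    qed
    then have "vec.dim (\<Union>j\<in>{1..h}. p t j) \<le> vec.dim (V (s, t) ` ?C)"
      by (intro vec.dim_mono UN_least)
    then show "i \<le> vec.dim (V (s, t) ` ?C)"
      using conf_chartD(1)[OF pt[OF t]] by (simp add: ordered_conf_iff)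
  qed
  have V_end: "conf_of h k (V (1, t)) = conf_of h k (K t)" if t: "t \<in> {0..1}" for t
  proof (rule conf_of_cong)
    fix j assume j: "j \<in> {1..h}"
    let ?x = "\<lambda>l. V (1, t) (j, l)"
    let ?K = "\<lambda>l. K t (j, l)"
    have "?x l \<in> vec.span (?K ` {..<k})" if l: "l < k" for l
    proof -
      have xF: "?x l \<in> F t j"
      proof -
        have "u t (j, l) \<in> p t j" using nframe(1)[OF conf_chartD(3)[OF pt[OF t] j]] by (simp add: u_def)
        then have "u t (j, l) \<in> F t j" using pF[of j j t] j by auto
        moreover have "P t (j - 1) (u t (j, l)) \<in> F t j"
          using PF[OF t, of "j - 1"] Fmono[of "j - 1" j t] j by fastforce
        ultimately show ?thesis by (simp add: V_def vec.subspace_diff[OF Fsub])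
      qed
      have x0: "coord g r (?x l) = 0" if "r < (j - 1) * k" for r
      proof -
        have "j - 1 \<le> h" using j by auto
        from coordP[OF t this that] show ?thesis by (simp add: V_def coord_linear)
      qed
      let ?y = "\<Sum>l'<k. coord g ((j - 1) * k + l') (?x l) *s ?K l'"
      have jk: "j * k = (j - 1) * k + k" using j by (cases j) auto
      \<comment> \<open>Vectors of \<open>F t j\<close> are determined by their first
        \<open>j * k\<close> coordinates.\<close>
      have "?x l = ?y"
      proof (rule nframe(3)[OF Fch[OF t j] xF])
        show "?y \<in> F t j"
          using e(1)[OF t j] by (intro vec.subspace_sum[OF Fsub] vec.subspace_scale[OF Fsub]) (simp add: K_def)
        fix r assume r: "r < j * k"
        have cy: "coord g r ?y = (\<Sum>l'<k. coord g ((j - 1) * k + l') (?x l) * (if r = (j - 1) * k + l' then 1 else 0))"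
          unfolding coord_sum coord_linear using e(2)[OF t j r] by (simp add: K_def)
        show "coord g r (?x l) = coord g r ?y"
        proof (cases "r < (j - 1) * k")
          case True
          then show ?thesis unfolding cy x0[OF True] by (intro sum.neutral[symmetric]) auto
        next
          case False
          then obtain a where a: "r = (j - 1) * k + a" "a < k" using r jk by (metis add_less_cancel_left le_Suc_ex not_le)
          have "coord g r ?y = (\<Sum>l'<k. if l' = a then coord g r (?x l) else 0)"
            unfolding cy using a by (intro sum.cong) auto
          then show ?thesis using a by simp
        qed
      qed
      then show ?thesis using combination_in_span[of _ ?K k] by metis
    qed
    then have sub: "vec.span (?x ` {..<k}) \<subseteq> vec.span (?K ` {..<k})" by (intro vec.span_minimal) auto
    have "vec.dim (vec.span (?x ` {..<k})) = k"
      using ordered_conf_component[OF V_conf[OF t, of 1] j] conf_of_apply[OF j, of k "V (1, t)"]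
      by (simp add: grassmannian_def)
    moreover have "vec.dim (vec.span (?K ` {..<k})) \<le> card (?K ` {..<k})" by (rule vec.dim_le_card) auto
    moreover have "card (?K ` {..<k}) \<le> k" using card_image_le[of "{..<k}" ?K] by simp
    ultimately show "vec.span (?x ` {..<k}) = vec.span (?K ` {..<k})"
      using sub by (intro vec.subspace_dim_equal) auto
  qed
  have Y_conf: "conf_of h k (Y (s, t)) \<in> ordered_conf h i k" if t: "t \<in> {0..1}" for s t
  proof (rule conf_of_in_ordered_conf_direct_sum[OF hk k])
    \<comment> \<open>The coordinate matrix is block lower triangular with identity blocks on the
      diagonal; entries below these blocks are arbitrary.\<close>
    have c: "coord g r (Y (s, t) (j, l)) = (if r = (j - 1) * k + l then 1 else 0)"
      if "j \<in> {1..h}" "l < k" "r < j * k" for j l r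
    proof -
      have jk: "j * k = (j - 1) * k + k" using that by (cases j) auto
      have "j * k \<le> i" using that hk by auto
      then have "r < ?n" "(j - 1) * k + l < ?n" using i that jk by linarith+
      then have "coord g r (b ((j - 1) * k + l)) = (if r = (j - 1) * k + l then 1 else 0)" using b by simp
      then show ?thesis using e(2)[OF t that(1,3)] by (simp add: Y_def K_def coord_linear)
    qed
    have "indep_rows {..<i} (Y (s, t) ` ?C) (coord g)"
      unfolding indep_rows_image
      unfolding indep_rows_def
    proof (intro allI impI)
      fix w assume w: "\<forall>c\<in>?C. (\<Sum>r<i. w r * coord g r (Y (s, t) c)) = 0"
      have "\<forall>r<i. (h - d) * k \<le> r \<longrightarrow> w r = 0" if "d \<le> h" for d
        using that
      \<comment> \<open>Back substitution from the last block: column \<open>(j, l)\<close> involves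
        only the unknown at \<open>(j - 1) * k + l\<close> and those from \<open>j * k\<close> on,
        which are already zero.\<close>
      proof (induction d)
        case 0
        then show ?case using hk by auto
      next
        case (Suc d)
        then have IH: "\<forall>r<i. (h - d) * k \<le> r \<longrightarrow> w r = 0" by simp
        define j where "j = h - d"
        have j: "j \<in> {1..h}" "h - Suc d = j - 1" using Suc.prems by (auto simp: j_def)
        have jk: "j * k = (j - 1) * k + k" using j by (cases j) auto
        have ji: "j * k \<le> i" using j hk by auto
        show ?case
        proof (intro allI impI)
          fix r assume r: "r < i" "(h - Suc d) * k \<le> r"
          show "w r = 0"
          proof (cases "j * k \<le> r")
            case True
            then show ?thesis using IH r by (simp add: j_def)
          next
            case False
            then obtain l where l: "r = (j - 1) * k + l" "l < k"
              using r(2) jk j(2) by (metis add_less_cancel_left le_Suc_ex not_le)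
            have "(\<Sum>q<i. w q * coord g q (Y (s, t) (j, l))) = (\<Sum>q<i. if q = r then w q else 0)"
            proof (rule sum.cong[OF refl])
              fix q assume q: "q \<in> {..<i}"
              show "w q * coord g q (Y (s, t) (j, l)) = (if q = r then w q else 0)"
              proof (cases "j * k \<le> q")
                case True
                then have "w q = 0" using IH q by (simp add: j_def)
                then show ?thesis by auto
              next
                case False
                then show ?thesis using c[OF j(1) l(2), of q] l(1) by simp
              qed
            qed
            then show ?thesis using w j(1) l(2) r(1) by simp
          qed
        qed
      qed
      from this[of h] show "\<forall>r\<in>{..<i}. w r = 0" by simp
    qed
    from indep_rows_dim_le[OF this] show "i \<le> vec.dim (Y (s, t) ` ?C)" by simp
  qed
  have Kcont: "continuous_map ?I euclidean (\<lambda>t. K t c)" if "c \<in> ?C" for c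
    using econt that by (cases c) (auto simp: K_def)
  have ev: "u 0 = u 1" "\<And>m. F 0 m = F 1 m" using p01 by (auto simp: u_def F_def)
  then have ev': "\<And>m. e 0 m = e 1 m" by (simp add: e_def)
  then have "K 0 = K 1" "\<And>m. P 0 m = P 1 m" by (simp_all add: K_def fun_eq_iff P_def)
  note ev = ev ev' this
  have "loop_hom ?F p (\<lambda>t. conf_of h k (V (1, t)))"
  proof (rule loop_hom_conf_of[where W = V])
    show "continuous_map ?Q euclidean (\<lambda>y. V y c)" if c: "c \<in> ?C" for c
    proof -
      obtain j l where jl: "c = (j, l)" by (cases c)
      have "continuous_map ?Q euclidean (\<lambda>y. P (snd y) (j - 1) (u (snd y) c))"
      proof (cases "j - 1 = 0")
        case True
        then show ?thesis by (simp add: P0)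
      next
        case False
        then have "j - 1 \<in> {1..h}" using c jl by auto
        then show ?thesis unfolding P_def
          by (intro continuous_map_sum continuous_map_vec_scale continuous_map_coord
              continuous_map_snd_square[OF ucont[OF c]] continuous_map_snd_square[OF econt]) auto
      qed
      then show ?thesis
        unfolding V_def jl prod.case
        by (intro continuous_map_complex_diff continuous_map_vec_scale continuous_map_fst_square
            continuous_map_snd_square[OF ucont]) (use c jl in auto)
    qed
    show "conf_of h k (V (s, t)) \<in> ordered_conf h i k" if "t \<in> {0..1}" for s t by (rule V_conf[OF that])
    show "V (s, 0) = V (s, 1)" for s using ev by (simp add: V_def)
    show "p t = conf_of h k (V (0, t))" if "t \<in> {0..1}" for t
      using conf_chart_frames[OF pt[OF that]] by (simp add: V_def u_def)
  qed simp
  also have hom2: "loop_hom ?F (\<lambda>t. conf_of h k (V (1, t))) (\<lambda>t. conf_of h k (Y (1, 0)))"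
  proof (rule loop_hom_conf_of[where W = Y])
    show "continuous_map ?Q euclidean (\<lambda>y. Y y c)" if c: "c \<in> ?C" for c
    proof -
      obtain j l where jl: "c = (j, l)" by (cases c)
      show ?thesis unfolding Y_def jl prod.case
        by (intro continuous_map_add continuous_map_vec_scale continuous_map_complex_diff continuous_map_fst_square
            continuous_map_canonical_const continuous_map_snd_square[OF Kcont]) (use c jl in auto)
    qed
    show "conf_of h k (Y (s, t)) \<in> ordered_conf h i k" if "t \<in> {0..1}" for s t by (rule Y_conf[OF that])
    show "Y (s, 0) = Y (s, 1)" for s using ev by (simp add: Y_def)
    show "conf_of h k (V (1, t)) = conf_of h k (Y (0, t))" if "t \<in> {0..1}" for t
      using V_end[OF that] by (simp add: Y_def)
    show "conf_of h k (Y (1, 0)) = conf_of h k (Y (1, t))" for t by (simp add: Y_def)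
  qed
  finally (loop_hom_trans) show ?thesis unfolding loop_null_def by blast
qed

section \<open>Simple connectivity and the fundamental group\<close>

theorem simply_connected_ordered_conf:
  assumes k: "2 \<le> k" and h: "1 \<le> h" and ne: "(ordered_conf h i k :: (nat \<Rightarrow> (complex^'n) set) set) \<noteq> {}"
  shows "simply_connected_top (ordered_conf_topology h i k :: (nat \<Rightarrow> (complex^'n) set) topology)"
proof -
  let ?F = "ordered_conf_topology h i k :: (nat \<Rightarrow> (complex^'n) set) topology"
  obtain H0 :: "nat \<Rightarrow> (complex^'n) set" where H0: "H0 \<in> ordered_conf h i k" using ne by blast
  let ?U = "{conf_chart h i k g | g :: complex^'n^'n. invertible g \<and> H0 \<in> conf_chart h i k g}"
  show ?thesis
  proof (rule simply_connected_from_cover[where ?x0.0 = H0 and \<U> = ?U])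
    show "H0 \<in> topspace ?F" using H0 by (simp add: topspace_ordered_conf_topology)
    show "openin ?F U" if "U \<in> ?U" for U using that openin_conf_chart by blast
    show "H0 \<in> U" if "U \<in> ?U" for U using that by blast
    show "topspace ?F \<subseteq> \<Union> ?U"
    proof
      fix H assume "H \<in> topspace ?F"
      then have "H \<in> ordered_conf h i k" by (simp add: topspace_ordered_conf_topology)
      from conf_chart_common[OF H0 this] show "H \<in> \<Union> ?U" by blast
    qed
    show "\<exists>p. pathin ?F p \<and> p ` {0..1} \<subseteq> U \<inter> V \<and> p 0 = x \<and> p 1 = y"
      if "U \<in> ?U" "V \<in> ?U" "x \<in> U \<inter> V" "y \<in> U \<inter> V" for U V x y
    proof -
      obtain g g' where "U = conf_chart h i k g" "V = conf_chart h i k g'" using \<open>U \<in> ?U\<close> \<open>V \<in> ?U\<close> by blast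
      then show ?thesis using conf_charts_Int_path[of x h i k g g' y] that(3,4) by simp
    qed
    fix U p assume "U \<in> ?U" and p: "pathin ?F p" "p ` {0..1} \<subseteq> U" "p 0 = p 1"
    then obtain g where g: "invertible g" "U = conf_chart h i k g" by blast
    show "loop_null ?F p"
    proof (cases "h * k = i")
      case True
      then show ?thesis using conf_chart_loop_null_direct_sum[of h i k p g] p g k by simp
    next
      case False
      then have ihk: "i < h * k" using ordered_conf_dim_le(2)[OF H0] by simp
      \<comment> \<open>One subspace already has dimension \<open>k\<close>, so
        \<open>i < h * k\<close> excludes h = 1; two distinct subspaces then span at least
        \<open>k + 1\<close> dimensions.\<close>
      have "k \<le> i" using conds_le[OF H0 condsI(1)[of 1 h]] h by simp
      then have "1 < h" using ihk by (cases "h = 1") (use h in auto)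
      then have "Suc k \<le> i" using conds_le[OF H0 condsI(2)[of 1 h 2]] by simp
      then show ?thesis using conf_chart_loop_null[of h i k p g] p g k ihk by simp
    qed
  qed
qed

theorem mainTheorem2:
  fixes h i k :: nat
    and c :: "(nat \<Rightarrow> (complex^'n) set) set"
  assumes "h \<ge> 1" and "i \<ge> 1" and "1 < k" and "k < CARD('n)"
    and "(ordered_conf h i k :: (nat \<Rightarrow> (complex^'n) set) set) \<noteq> {}"
    and "c \<in> topspace (unordered_conf_topology h i k)"
  shows "fundamental_group (unordered_conf_topology h i k) c \<cong> sym_group h"
proof -
  let ?X = "ordered_conf_topology h i k :: (nat \<Rightarrow> (complex^'n) set) topology"
  have top: "topspace ?X = ordered_conf h i k" by (rule topspace_ordered_conf_topology)
  have perm: "\<sigma> permutes {1..h}" if "\<sigma> \<in> carrier (sym_group h)" for \<sigma>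
    using that by (simp add: sym_group_carrier)
  have act_in: "H \<circ> \<sigma> \<in> ordered_conf h i k"
    if H: "H \<in> ordered_conf h i k" and s: "\<sigma> permutes {1..h}" for H :: "nat \<Rightarrow> (complex^'n) set" and \<sigma>
  proof -
    have "(\<Union>j\<in>{1..h}. (H \<circ> \<sigma>) j) = (\<Union>j\<in>{1..h}. H j)"
      using permutes_image[OF s] by (metis image_comp)
    moreover have "inj_on (H \<circ> \<sigma>) {1..h}"
      using H permutes_image[OF s] permutes_inj_on[OF s] by (intro comp_inj_on) (auto simp: ordered_conf_def)
    moreover have "H \<circ> \<sigma> \<in> {1..h} \<rightarrow>\<^sub>E grassmannian k"
    proof (rule PiE_I)
      show "(H \<circ> \<sigma>) j \<in> grassmannian k" if "j \<in> {1..h}" for j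
        using H permutes_in_image[OF s] that by (auto simp: ordered_conf_def)
      show "(H \<circ> \<sigma>) j = undefined" if "j \<notin> {1..h}" for j
        using H permutes_not_in[OF s that] that by (auto simp: ordered_conf_def PiE_def extensional_def)
    qed
    ultimately show ?thesis using H by (simp add: ordered_conf_iff)
  qed
  interpret free_finite_action "sym_group h" ?X "unordered_conf_topology h i k" "perm_orbit h" "\<lambda>H \<sigma>. H \<circ> \<sigma>"
  proof (intro free_finite_action.intro free_finite_action_axioms.intro)
    show "group (sym_group h)" by (rule sym_group_is_group)
    show "finite (carrier (sym_group h))" by (simp add: sym_group_def finite_permutations)
    show "continuous_map ?X ?X (\<lambda>H. H \<circ> \<sigma>)" if "\<sigma> \<in> carrier (sym_group h)" for \<sigma>
    proof -
      have "continuous_map ?X (grassmannian_topology k) (\<lambda>H. (H \<circ> \<sigma>) j)" if "j \<in> {1..h}" for j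
        using continuous_map_component[of "\<sigma> j" h i k] permutes_in_image[OF perm[OF \<open>\<sigma> \<in> _\<close>], of j] that by simp
      moreover have "H \<circ> \<sigma> \<in> ordered_conf h i k" if "H \<in> topspace ?X" for H
        using act_in that perm[OF \<open>\<sigma> \<in> _\<close>] top by simp
      moreover have "H \<circ> \<sigma> \<in> extensional {1..h}" if "H \<in> topspace ?X" for H
        using calculation(2)[OF that] by (simp add: ordered_conf_def PiE_def)
      ultimately show ?thesis
        unfolding ordered_conf_topology_def[of h i k, where 'n = 'n] continuous_map_in_subtopology continuous_map_componentwise
        by (auto simp flip: ordered_conf_topology_def)
    qed
    show "H \<circ> (\<sigma> \<otimes>\<^bsub>sym_group h\<^esub> \<tau>) = (H \<circ> \<sigma>) \<circ> \<tau>" for H :: "nat \<Rightarrow> (complex^'n) set" and \<sigma> \<tau>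
      by (simp add: sym_group_mult comp_assoc)
    show "H \<circ> \<one>\<^bsub>sym_group h\<^esub> = H" for H :: "nat \<Rightarrow> (complex^'n) set" by (simp add: sym_group_one)
    show "\<sigma> = \<one>\<^bsub>sym_group h\<^esub>"
      if H: "H \<in> topspace ?X" and s: "\<sigma> \<in> carrier (sym_group h)" and eq: "H \<circ> \<sigma> = H" for H \<sigma>
    proof -
      have "\<sigma> j = j" for j
      \<comment> \<open>Freeness: inside the index range by injectivity of \<open>H\<close>, outside
        because a permutation of the range fixes everything else.\<close>
      proof (cases "j \<in> {1..h}")
        case True
        have "H (\<sigma> j) = H j" using fun_cong[OF eq, of j] by simp
        moreover have "inj_on H {1..h}" using H top by (simp add: ordered_conf_def)
        moreover have "\<sigma> j \<in> {1..h}" using True permutes_in_image[OF perm[OF s]] by blast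
        ultimately show ?thesis using True by (blast dest: inj_onD)
      next
        case False
        then show ?thesis by (rule permutes_not_in[OF perm[OF s]])
      qed
      then show ?thesis by (simp add: sym_group_one fun_eq_iff)
    qed
    show "quotient_map ?X (unordered_conf_topology h i k) (perm_orbit h)"
      unfolding unordered_conf_topology_def by (rule quotient_map_quotient_topology)
    show "perm_orbit h H = perm_orbit h H' \<longleftrightarrow> (\<exists>\<sigma>\<in>carrier (sym_group h). H' = H \<circ> \<sigma>)"
      for H H' :: "nat \<Rightarrow> (complex^'n) set"
    proof
      assume eq: "perm_orbit h H = perm_orbit h H'"
      have "H' \<in> perm_orbit h H'" unfolding perm_orbit_def using permutes_id[of "{1..h}"] by (metis (mono_tags, lifting) comp_id mem_Collect_eq)
      then show "\<exists>\<sigma>\<in>carrier (sym_group h). H' = H \<circ> \<sigma>"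
        unfolding eq[symmetric] by (auto simp: perm_orbit_def sym_group_carrier)
    next
      assume "\<exists>\<sigma>\<in>carrier (sym_group h). H' = H \<circ> \<sigma>"
      then obtain \<sigma> where s: "\<sigma> permutes {1..h}" and H': "H' = H \<circ> \<sigma>" by (auto simp: sym_group_carrier)
      have inv: "inv' \<sigma> permutes {1..h}" using s by (rule permutes_inv)
      have "H \<circ> \<tau> \<in> perm_orbit h H'" if "\<tau> permutes {1..h}" for \<tau>
      proof -
        have "H \<circ> \<tau> = H' \<circ> (inv' \<sigma> \<circ> \<tau>)"
          by (simp add: H' fun_eq_iff permutes_inverses(1)[OF s])
        then show ?thesis unfolding perm_orbit_def using permutes_compose[OF that inv] by blast
      qed
      moreover have "H' \<circ> \<tau> \<in> perm_orbit h H" if "\<tau> permutes {1..h}" for \<tau>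
        unfolding perm_orbit_def H' comp_assoc using permutes_compose[OF that s] by blast
      ultimately show "perm_orbit h H = perm_orbit h H'"
        unfolding perm_orbit_def by blast
    qed
    show "Hausdorff_space ?X"
      unfolding ordered_conf_topology_def
      by (intro Hausdorff_space_subtopology) (simp add: Hausdorff_space_product_topology Hausdorff_grassmannian)
  qed
  have "simply_connected_top ?X"
    using assms by (intro simply_connected_ordered_conf) auto
  then show ?thesis using assms(6) by (rule fundamental_group_quotient)
qed

end
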